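(* Let $\chi$ be a real Dirichlet character (i.e. taking its values in $\{-1,0,1\}$, with values $\pm1$ on integers coprime to its modulus) with modulus $N>1$ and conductor $u$. Let $Q:=u^2\prod_{p\mid N,\ p\nmid u} p$ (product over primes $p$). Then $\eta_{\chi}$ is a parabolic generalized modular function (of weight $0$) on $\Gamma_0(Q)$ with a cuspidal divisor. Further, $\eta_{\chi}$ is an $\eta$-quotient if and only if $\chi$ is principal.
   Context: Write $q=e^{2\pi i\tau}$ for $\tau$ in the upper half-plane $\mathcal{H}$. For a Dirichlet character $\chi$ with conductor $u$, the generalized Dedekind eta function is $$\eta_{\chi}(\tau):=\prod_{n=1}^{\infty}\prod_{a=1}^{u}(1-\zeta_u^{a}q^n)^{\bar\chi(an)},\qquad \zeta_u=e^{2\pi i/u},$$ complex powers being defined by the principal branch of the logarithm. By convention $\eta_{\mathbf{1}_1}$ is the classical Dedekind function $\eta(\tau)=q^{1/24}\prod_{n\ge1}(1-q^n)$. For $t\ge1$ let $(f|V_t)(\tau)=f(t\tau)$. A function $f:\mathcal{H}\to\mathbf{C}$ is an $\eta$-quotient (of level $M$) if there are a positive integer $M$ and complex numbers $c$ and $(a_t)_{t\mid M}$ with $f=c\prod_{t\mid M}(\eta|V_t)^{a_t}$. Let $\Gamma\subset \mathrm{SL}_2(\mathbf{Z})$ have finite index. A generalized modular function (GMF) of weight $0$ on $\Gamma$ is a holomorphic function $f$ on $\mathcal{H}$ such that (i) $f(\gamma\tau)=\nu(\gamma)f(\tau)$ for all $\gamma\in\Gamma$, where $\nu:\Gamma\to\mathbf{C}^*$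 is a (not necessarily unitary) character, and (ii) $f$ is meromorphic at the cusps of $\Gamma$. It is parabolic if moreover (iii) $\nu(\gamma)=1$ for every $\gamma\in\Gamma$ of trace $2$. A function has a cuspidal divisor if it has no zeros or poles in $\mathcal{H}$. $\Gamma_0(Q)=\{\left(\begin{smallmatrix}a&b\\c&d\end{smallmatrix}\right)\in\mathrm{SL}_2(\mathbf{Z}): Q\mid c\}$.
   Formalization: Parabolicity of η_χ is asserted only if, with P=Q/u², 24|φ(P) when u=1, 3|φ(P) when u=3, 2|φ(P) when u=4 (it fails otherwise, e.g. N=u=3); in η_χ, χ(a) is the value of the primitive character inducing χ; for principal χ, η_χ includes the factor q^(∏_{p|N}(1-p)/24). *)

theory Defs
  imports
    "HOL-Analysis.Analysis"
    "HOL-Complex_Analysis.Complex_Analysis"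
    "HOL-Number_Theory.Number_Theory"
    "HOL-Algebra.Coset"
begin

no_notation fps_nth (infixl "$" 75)

section \<open>Dirichlet characters\<close>

definition dirichlet_character :: "nat \<Rightarrow> (int \<Rightarrow> complex) \<Rightarrow> bool" where
  "dirichlet_character N chi \<longleftrightarrow>
     N > 0 \<and> chi 1 = 1 \<and>
     (\<forall>a b. chi (a * b) = chi a * chi b) \<and>
     (\<forall>a. chi (a + int N) = chi a) \<and>
     (\<forall>a. chi a = 0 \<longleftrightarrow> \<not> coprime a (int N))"

definition real_character :: "(int \<Rightarrow> complex) \<Rightarrow> bool" where
  "real_character chi \<longleftrightarrow> (\<forall>a. chi a \<in> {-1, 0, 1})"

definition principal_character :: "nat \<Rightarrow> (int \<Rightarrow> complex) \<Rightarrow> bool" where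
  "principal_character N chi \<longleftrightarrow> (\<forall>a. chi a = (if coprime a (int N) then 1 else 0))"

definition induced_modulus :: "nat \<Rightarrow> (int \<Rightarrow> complex) \<Rightarrow> nat \<Rightarrow> bool" where
  "induced_modulus N chi d \<longleftrightarrow>
     d dvd N \<and> (\<forall>a. coprime a (int N) \<longrightarrow> [a = 1] (mod int d) \<longrightarrow> chi a = 1)"

definition conductor :: "nat \<Rightarrow> (int \<Rightarrow> complex) \<Rightarrow> nat" where
  "conductor N chi = (LEAST d. induced_modulus N chi d)"

definition primitive_character :: "nat \<Rightarrow> (int \<Rightarrow> complex) \<Rightarrow> int \<Rightarrow> complex" where
  "primitive_character N chi =
     (THE \<psi>. dirichlet_character (conductor N chi) \<psi> \<and>
             (\<forall>a. coprime a (int N) \<longrightarrow> \<psi> a = chi a))"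

section \<open>Eta functions\<close>

definition upper_half_plane :: "complex set" where
  "upper_half_plane = {\<tau>. Im \<tau> > 0}"

definition q_of :: "complex \<Rightarrow> complex" where
  "q_of \<tau> = exp (2 * of_real pi * \<i> * \<tau>)"

definition zeta_root :: "nat \<Rightarrow> complex" where
  "zeta_root u = exp (2 * of_real pi * \<i> / of_nat u)"

definition dedekind_eta :: "complex \<Rightarrow> complex" where
  "dedekind_eta \<tau> = q_of (\<tau> / 24) * (\<Prod>n. 1 - q_of \<tau> ^ Suc n)"

text \<open>
  The generalized eta function of a character \<open>\<chi>\<close> modulo \<open>N\<close> of conductor \<open>u\<close>.
  Two conventions are fixed here.

  The exponent of \<open>1 - \<zeta>\<^sub>u\<^sup>a q\<^sup>n\<close> is \<open>\<chi>(an)\<close> conjugated, where the factor \<open>\<chi>(a)\<close> belongs to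
  the residue \<open>a\<close> modulo \<open>u\<close> and is the value of the primitive character inducing \<open>\<chi>\<close>,
  and \<open>\<chi>(n)\<close> is the value of \<open>\<chi>\<close> itself. For primitive \<open>\<chi>\<close> this is \<open>\<chi>(an)\<close> verbatim. With the
  imprimitive value \<open>\<chi>(a)\<close> the inner product is no longer governed by a Gauss sum, and
  modularity fails, for instance for the nonprincipal character modulo 3 viewed
  modulo 6, where only \<open>a = 1\<close> would survive.

  For \<open>u = 1\<close>, that is for principal \<open>\<chi>\<close>, the product needs a leading power of \<open>q\<close>, namely
  \<open>q\<^sup>1\<^sup>/\<^sup>2\<^sup>4\<close> for \<open>N = 1\<close>, where the function is the classical eta function. The power for general
  \<open>N\<close> is the one for which \<open>\<eta>\<^sub>\<chi>(\<tau>)\<close> is the product over squarefree \<open>d\<close> dividing \<open>N\<close> of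
  \<open>\<eta>(d \<tau>)\<close> to the \<open>\<mu>(d)\<close>. Without it \<open>\<eta>\<^sub>\<chi>\<close> is not modular: the product of the
  \<open>1 - q\<^sup>2\<^sup>n\<^sup>-\<^sup>1\<close> differs from \<open>\<eta>(\<tau>) / \<eta>(2 \<tau>)\<close> by a power of \<open>q\<close>.
\<close>

definition generalized_eta :: "nat \<Rightarrow> (int \<Rightarrow> complex) \<Rightarrow> complex \<Rightarrow> complex" where
  "generalized_eta N chi \<tau> =
     (let u = conductor N chi; \<psi> = primitive_character N chi in
       (if u = 1 then q_of (\<tau> * (\<Prod>p | prime p \<and> p dvd N. 1 - of_nat p) / 24) else 1) *
       (\<Prod>n. \<Prod>a=1..u. (1 - zeta_root u ^ a * q_of \<tau> ^ Suc n) powr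
                       cnj (\<psi> (int a) * chi (int (Suc n)))))"

lemma dirichlet_character_1_iff: "dirichlet_character 1 chi \<longleftrightarrow> chi = (\<lambda>_. 1)"
proof
  assume "dirichlet_character 1 chi"
  then have per: "chi (a + 1) = chi a" and one: "chi 1 = 1" for a
    by (auto simp: dirichlet_character_def)
  have "chi a = 1" for a
  proof (induction a rule: int_induct[where k = 1])
    case (step2 i)
    then show ?case using per[of "i - 1"] by simp
  qed (simp_all add: per one)
  then show "chi = (\<lambda>_. 1)" by auto
qed (simp add: dirichlet_character_def)

lemma generalized_eta_1: "generalized_eta 1 (\<lambda>_. 1) \<tau> = dedekind_eta \<tau>" if "\<tau> \<in> upper_half_plane"
proof -
  have cond: "conductor 1 (\<lambda>_. 1) = 1"
    unfolding conductor_def by (rule Least_equality) (auto simp: induced_modulus_def)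
  have prim: "primitive_character 1 (\<lambda>_. 1) = (\<lambda>_. 1)"
    unfolding primitive_character_def cond dirichlet_character_1_iff by (rule the_equality) auto
  have "norm (q_of \<tau>) < 1"
    using that by (auto simp: q_of_def upper_half_plane_def)
  then have "1 - q_of \<tau> ^ Suc n \<noteq> 0" for n
    using power_eq_1_iff[of "q_of \<tau>" "Suc n"] by auto
  moreover have "{p :: nat. prime p \<and> p dvd 1} = {}" by auto
  then have "(\<Prod>p | prime p \<and> p dvd (1::nat). 1 - of_nat p) = (1 :: complex)"
    by (simp only: prod.empty)
  moreover have "zeta_root 1 = 1" by (simp add: zeta_root_def)
  ultimately show ?thesis
    unfolding generalized_eta_def dedekind_eta_def Let_def cond prim by simp
qed

definition eta_quotient :: "(complex \<Rightarrow> complex) \<Rightarrow> bool" where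
  "eta_quotient f \<longleftrightarrow>
     (\<exists>(M::nat) (c::complex) (a :: nat \<Rightarrow> complex). M > 0 \<and>
        (\<forall>\<tau>\<in>upper_half_plane.
           f \<tau> = c * (\<Prod>t | t dvd M. dedekind_eta (of_nat t * \<tau>) powr a t)))"

section \<open>Generalized modular functions of weight 0\<close>

definition SL2Z :: "(int^2^2) monoid" where
  "SL2Z = \<lparr>carrier = {A. det A = 1}, mult = (**), one = mat 1\<rparr>"

definition Gamma0 :: "nat \<Rightarrow> (int^2^2) set" where
  "Gamma0 Q = {A \<in> carrier SL2Z. int Q dvd A $ 2 $ 1}"

definition finite_index :: "(int^2^2) set \<Rightarrow> bool" where
  "finite_index \<Gamma> \<longleftrightarrow> subgroup \<Gamma> SL2Z \<and> finite (rcosets\<^bsub>SL2Z\<^esub> \<Gamma>)"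

definition moeb :: "int^2^2 \<Rightarrow> complex \<Rightarrow> complex" where
  "moeb A \<tau> = (of_int (A$1$1) * \<tau> + of_int (A$1$2)) / (of_int (A$2$1) * \<tau> + of_int (A$2$2))"

definition translation :: "int \<Rightarrow> int^2^2" where
  "translation h = vector [vector [1, h], vector [0, 1]]"

text \<open>
  At the cusp \<open>A \<infinity>\<close> the function \<open>f(A \<tau>)\<close> is multiplied by a nonzero constant under
  \<open>\<tau> \<mapsto> \<tau> + h\<close>. That constant need not have absolute value 1, so the expansion has the form
  \<open>exp (2 \<pi> \<i> \<kappa> \<tau> / h)\<close> times a Laurent series with finite principal part in
  \<open>exp (2 \<pi> \<i> \<tau> / h)\<close>, for some complex \<open>\<kappa>\<close>. The order of the pole is absorbed into \<open>\<kappa>\<close>, which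
  leaves a power series.
\<close>

definition meromorphic_at_cusps :: "(int^2^2) set \<Rightarrow> (complex \<Rightarrow> complex) \<Rightarrow> bool" where
  "meromorphic_at_cusps \<Gamma> f \<longleftrightarrow>
     (\<forall>A \<in> carrier SL2Z. \<exists>(h::nat) (\<kappa>::complex) (c :: nat \<Rightarrow> complex).
        h > 0 \<and> A ** translation (int h) ** inv\<^bsub>SL2Z\<^esub> A \<in> \<Gamma> \<and>
        (\<forall>\<tau>\<in>upper_half_plane.
           (\<lambda>n. c n * q_of ((\<kappa> + of_nat n) * \<tau> / of_nat h)) sums f (moeb A \<tau>)))"

definition gmf_with_character ::
    "(int^2^2) set \<Rightarrow> (int^2^2 \<Rightarrow> complex) \<Rightarrow> (complex \<Rightarrow> complex) \<Rightarrow> bool" where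
  "gmf_with_character \<Gamma> \<nu> f \<longleftrightarrow>
     finite_index \<Gamma> \<and>
     (\<forall>A\<in>\<Gamma>. \<nu> A \<noteq> 0) \<and> (\<forall>A\<in>\<Gamma>. \<forall>B\<in>\<Gamma>. \<nu> (A ** B) = \<nu> A * \<nu> B) \<and>
     f holomorphic_on upper_half_plane \<and>
     (\<forall>A\<in>\<Gamma>. \<forall>\<tau>\<in>upper_half_plane. f (moeb A \<tau>) = \<nu> A * f \<tau>) \<and>
     meromorphic_at_cusps \<Gamma> f"

definition gmf :: "(int^2^2) set \<Rightarrow> (complex \<Rightarrow> complex) \<Rightarrow> bool" where
  "gmf \<Gamma> f \<longleftrightarrow> (\<exists>\<nu>. gmf_with_character \<Gamma> \<nu> f)"

definition parabolic_gmf :: "(int^2^2) set \<Rightarrow> (complex \<Rightarrow> complex) \<Rightarrow> bool" where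
  "parabolic_gmf \<Gamma> f \<longleftrightarrow>
     (\<exists>\<nu>. gmf_with_character \<Gamma> \<nu> f \<and> (\<forall>A\<in>\<Gamma>. trace A = 2 \<longrightarrow> \<nu> A = 1))"

definition cuspidal_divisor :: "(complex \<Rightarrow> complex) \<Rightarrow> bool" where
  "cuspidal_divisor f \<longleftrightarrow> (\<forall>\<tau>\<in>upper_half_plane. f \<tau> \<noteq> 0 \<and> \<not> is_pole f \<tau>)"

section \<open>The level and the parabolicity condition\<close>

definition tame_part :: "nat \<Rightarrow> (int \<Rightarrow> complex) \<Rightarrow> nat" where
  "tame_part N chi = (\<Prod>p | prime p \<and> p dvd N \<and> \<not> p dvd conductor N chi. p)"

definition eta_level :: "nat \<Rightarrow> (int \<Rightarrow> complex) \<Rightarrow> nat" where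
  "eta_level N chi = conductor N chi ^ 2 * tame_part N chi"

text \<open>
  The order of \<open>\<eta>\<^sub>\<chi>\<close> at a cusp of \<open>\<Gamma>\<^sub>0(Q)\<close>, in the local parameter of that cusp, is 0 or
  plus or minus \<open>J(u) \<phi>(P) / 24\<close>. Here \<open>P\<close> is the tame part and \<open>J(u)\<close> is \<open>u\<^sup>2\<close> times the product of
  the \<open>1 - p\<^sup>-\<^sup>2\<close> over primes \<open>p\<close> dividing \<open>u\<close>. The function is parabolic only if this is an
  integer. As \<open>J(1) = 1\<close>, \<open>J(3) = 8\<close>, \<open>J(4) = 12\<close>, and 24 divides \<open>J(u)\<close> for every other
  conductor \<open>u\<close> of a real character, the condition is the one below. It is not vacuous.
  For the nonprincipal character modulo 3 (level 9), the matrix with rows \<open>(-2, 1)\<close> and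
  \<open>(-9, 4)\<close> has trace 2 but acts on \<open>\<eta>\<^sub>\<chi>\<close> by a primitive cube root of unity. For the principal
  character modulo 2, \<open>\<tau> \<mapsto> \<tau> + 1\<close> acts by a primitive 24th root of unity.
\<close>

definition integral_cusp_orders :: "nat \<Rightarrow> (int \<Rightarrow> complex) \<Rightarrow> bool" where
  "integral_cusp_orders N chi \<longleftrightarrow>
     (conductor N chi = 1 \<longrightarrow> 24 dvd totient (tame_part N chi)) \<and>
     (conductor N chi = 3 \<longrightarrow> 3 dvd totient (tame_part N chi)) \<and>
     (conductor N chi = 4 \<longrightarrow> 2 dvd totient (tame_part N chi))"

end

theory Submission
  imports Defs "HOL-Computational_Algebra.Squarefree"
begin

text \<open>
  Let \<open>u\<close> be the conductor, \<open>P\<close> the tame part and \<open>\<psi>\<close> the primitive character inducing \<open>\<chi>\<close>.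
  Grouping the factors of the product by the residues of \<open>n\<close> modulo \<open>M = uP\<close> writes \<open>|\<eta>\<^sub>\<chi>(\<tau>)|\<^sup>2\<close> as a product
  of absolute values of Siegel functions at the points \<open>(b/M, a/u)\<close>, taken at \<open>M \<tau>\<close>, with exponents
  \<open>\<chi>(b) \<psi>(a)\<close>. The absolute value of a Siegel function is invariant under \<open>SL\<^sub>2(\<int>)\<close> acting on \<open>\<tau>\<close> and on
  the point. For the inversion this follows from Liouville's theorem applied to a quotient of theta
  functions, the constant being fixed by the three half periods. As \<open>\<Gamma>\<^sub>0(Q)\<close>, conjugated
  by \<open>M\<close>, only permutes the points and preserves the exponents, \<open>|\<eta>\<^sub>\<chi>|\<close> is \<open>\<Gamma>\<^sub>0(Q)\<close>-invariant, and by the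
  maximum principle \<open>\<eta>\<^sub>\<chi>\<close> transforms by a unitary character. The value of that character at a parabolic element is
  determined by the order at the cusp that it fixes. This order is a character sum of Bernoulli
  polynomials, which Gauss sums evaluate to a multiple of \<open>J(u) \<phi>(P) / 24\<close>.

  If \<open>\<eta>\<^sub>\<chi>\<close> is an eta quotient, comparing logarithms on the imaginary axis at the power \<open>q\<^sup>k\<close>, with \<open>k\<close> prime to all
  levels, gives \<open>g \<chi>(k) \<sigma>(k) = a\<^sub>1 \<sigma>(k)\<close> for the Gauss sum \<open>g \<noteq> 0\<close>, hence \<open>\<chi>(k) = \<chi>(1) = 1\<close>.
\<close>

section \<open>Theta functions and absolute values of Siegel functions\<close>

text \<open>A Siegel function itself changes by roots of unity under the modular group, and general
  complex powers change branch. Both troubles vanish for absolute values with exponents in {-1, 0,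
  1}, so the modular side is a statement about real numbers. The square of the modulus appears
  because the theta product at (b/M, a/u) also contains the factors belonging to (-b/M, -a/u), which
  carry the same exponent. The level is dictated by the points: conjugation by M turns the lower
  left entry c into c/M, and u must divide c/M for the second coordinate, of denominator u, to leave
  the first one unchanged modulo 1. This is divisibility of c by uM = u^2 P. Orders multiplied by
  cusp widths have a denominator dividing 24 in general, whence the condition for parabolicity of
  the function itself and the unconditional result for its 24th power. For eta quotients the
  exponents are arbitrary complex numbers, and the principal branch is controlled only on the
  imaginary axis.\<close>

definition qpoch :: "complex \<Rightarrow> complex \<Rightarrow> complex" where
  "qpoch w q = (\<Prod>k. 1 - w * q ^ k)"

lemma summable_qpoch:
  fixes w q :: complex
  assumes "norm q < 1"
  shows "summable (\<lambda>k. norm (w * q ^ k))"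
  using assms by (simp add: norm_mult norm_power summable_mult summable_geometric)

lemma convergent_prod_qpoch:
  fixes w q :: complex
  assumes "norm q < 1"
  shows "convergent_prod (\<lambda>k. 1 - w * q ^ k)"
  using summable_qpoch[OF assms, of w]
  by (intro abs_convergent_prod_imp_convergent_prod summable_imp_abs_convergent_prod) simp

lemma qpoch_LIMSEQ:
  assumes "norm q < 1"
  shows "(\<lambda>n. \<Prod>k<n. 1 - w * q ^ k) \<longlonglongrightarrow> qpoch w q"
  using has_prod_imp_tendsto'[OF convergent_prod_has_prod[OF convergent_prod_qpoch[OF assms, of w]]]
  unfolding qpoch_def .

lemma qpoch_rec:
  assumes "norm q < 1"
  shows "qpoch w q = (1 - w) * qpoch (w * q) q"
proof -
  have "(\<lambda>n. \<Prod>k<Suc n. 1 - w * q ^ k) \<longlonglongrightarrow> qpoch w q"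
    using qpoch_LIMSEQ[OF assms, of w] by (rule LIMSEQ_Suc)
  moreover have "(\<Prod>k<Suc n. 1 - w * q ^ k) = (1 - w) * (\<Prod>k<n. 1 - (w * q) * q ^ k)" for n
    unfolding prod.lessThan_Suc_shift by (simp add: mult_ac)
  moreover have "(\<lambda>n. (1 - w) * (\<Prod>k<n. 1 - (w * q) * q ^ k)) \<longlonglongrightarrow> (1 - w) * qpoch (w * q) q"
    by (intro tendsto_intros qpoch_LIMSEQ assms)
  ultimately show ?thesis
    using LIMSEQ_unique by auto
qed

lemma qpoch_nonzero:
  assumes "norm q < 1" "\<And>k. w * q ^ k \<noteq> 1"
  shows "qpoch w q \<noteq> 0"
  unfolding qpoch_def
  by (rule prodinf_nonzero) (use assms convergent_prod_qpoch in \<open>auto simp: eq_commute[of 1]\<close>)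

lemma norm_power_mult_less_1:
  fixes q :: "'a::real_normed_field"
  assumes "norm q < 1" "norm w < 1"
  shows "norm (w * q ^ k) < 1"
proof -
  have "norm (w * q ^ k) = norm w * norm q ^ k" by (simp add: norm_mult norm_power)
  also have "\<dots> \<le> norm w * 1" using assms by (intro mult_left_mono power_le_one) auto
  finally show ?thesis using assms by simp
qed

lemma qpoch_nonzero':
  assumes "norm q < 1" "norm w < 1"
  shows "qpoch w q \<noteq> 0"
  using norm_power_mult_less_1[OF assms] by (intro qpoch_nonzero assms) (metis norm_one less_irrefl)

lemma sums_Ln_qpoch:
  assumes "norm q < 1" "norm w < 1"
  shows "summable (\<lambda>k. Ln (1 - w * q ^ k))" "exp (\<Sum>k. Ln (1 - w * q ^ k)) = qpoch w q"
proof -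
  have nz: "1 - w * q ^ k \<noteq> 0" for k
    using norm_power_mult_less_1[OF assms, of k] by auto
  show *: "summable (\<lambda>k. Ln (1 - w * q ^ k))"
    by (rule summable_Ln_complex[OF convergent_prod_qpoch[OF assms(1)] nz])
  show "exp (\<Sum>k. Ln (1 - w * q ^ k)) = qpoch w q"
    unfolding qpoch_def using prodinf_exp[OF *] nz by simp
qed

text \<open>The bound is explicit in \<open>w\<close> and \<open>q\<close> together, because at a
  cusp the argument and the nome tend to 0 simultaneously.\<close>

lemma norm_qpoch_minus_1_le:
  assumes "norm q < 1"
  shows "norm (qpoch w q - 1) \<le> exp (norm w / (1 - norm q)) - 1"
proof (rule tendsto_upperbound)
  show "(\<lambda>n. norm ((\<Prod>k<n. 1 - w * q ^ k) - 1)) \<longlonglongrightarrow> norm (qpoch w q - 1)"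
    by (intro tendsto_intros qpoch_LIMSEQ assms)
  have "norm ((\<Prod>k<n. 1 - w * q ^ k) - 1) \<le> exp (norm w / (1 - norm q)) - 1" for n
  proof -
    have "norm ((\<Prod>k<n. 1 + - (w * q ^ k)) - 1) \<le> (\<Prod>k<n. 1 + norm (- (w * q ^ k))) - 1"
      by (rule norm_prod_minus1_le_prod_minus1)
    also have "(\<Prod>k<n. 1 + norm (- (w * q ^ k))) \<le> exp (\<Sum>k<n. norm (- (w * q ^ k)))"
      by (rule prod_le_exp_sum) auto
    also have "(\<Sum>k<n. norm (- (w * q ^ k))) \<le> (\<Sum>k. norm (w * q ^ k))"
      using summable_qpoch[OF assms, of w] by (simp add: sum_le_suminf)
    also have "\<dots> = norm w / (1 - norm q)"
      using assms by (simp add: norm_mult norm_power suminf_mult suminf_geometric)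
    finally show ?thesis by simp
  qed
  then show "\<forall>\<^sub>F n in sequentially.
      norm ((\<Prod>k<n. 1 - w * q ^ k) - 1) \<le> exp (norm w / (1 - norm q)) - 1"
    by simp
qed simp

lemma qpoch_holomorphic:
  assumes "norm q < 1"
  shows "(\<lambda>w. qpoch w q) holomorphic_on UNIV"
proof (rule holomorphic_uniform_sequence[OF open_UNIV])
  show "(\<lambda>w. \<Prod>k<n. 1 - w * q ^ k) holomorphic_on UNIV" for n
    by (intro holomorphic_intros)
  fix x :: complex
  have "uniformly_convergent_on (cball x 1) (\<lambda>n w. \<Prod>k<n. 1 - w * q ^ k)"
  proof (rule uniformly_convergent_on_prod')
    show "uniformly_convergent_on (cball x 1) (\<lambda>N w. \<Sum>n<N. norm (1 - w * q ^ n - 1))"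
    proof (rule Weierstrass_m_test'_ev)
      show "\<forall>\<^sub>F n in sequentially. \<forall>w\<in>cball x 1. norm (norm (1 - w * q ^ n - 1)) \<le> (norm x + 1) * norm q ^ n"
      proof (intro always_eventually allI ballI)
        fix n w assume "w \<in> cball x 1"
        then have "norm w \<le> norm x + 1"
          using norm_triangle_ineq2[of w x] by (simp add: dist_norm norm_minus_commute)
        then show "norm (norm (1 - w * q ^ n - 1)) \<le> (norm x + 1) * norm q ^ n"
          by (simp add: norm_mult norm_power mult_right_mono)
      qed
      show "summable (\<lambda>n. (norm x + 1) * norm q ^ n)"
        using assms by (simp add: summable_mult summable_geometric)
    qed
  qed (auto intro!: continuous_intros)
  then obtain l where l: "uniform_limit (cball x 1) (\<lambda>n w. \<Prod>k<n. 1 - w * q ^ k) l sequentially"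
    by (auto simp: uniformly_convergent_on_def)
  have "l w = qpoch w q" if "w \<in> cball x 1" for w
    using tendsto_uniform_limitI[OF l that] qpoch_LIMSEQ[OF assms, of w] LIMSEQ_unique by blast
  then have "uniform_limit (cball x 1) (\<lambda>n w. \<Prod>k<n. 1 - w * q ^ k) (\<lambda>w. qpoch w q) sequentially"
    using l by (subst uniform_limit_cong'[of _ _ _ _ l]) auto
  then show "\<exists>d>0. cball x d \<subseteq> UNIV \<and>
      uniform_limit (cball x d) (\<lambda>n w. \<Prod>k<n. 1 - w * q ^ k) (\<lambda>w. qpoch w q) sequentially"
    by (intro exI[of _ 1]) auto
qed

lemma qpoch_holomorphic_compose [holomorphic_intros]:
  assumes "norm q < 1" "f holomorphic_on A"
  shows "(\<lambda>z. qpoch (f z) q) holomorphic_on A"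
  using holomorphic_on_compose_gen[OF assms(2) qpoch_holomorphic[OF assms(1)]] by (simp add: o_def)

lemma qpoch_mult_neg:
  assumes "norm q < 1"
  shows "qpoch w q * qpoch (-w) q = qpoch (w ^ 2) (q ^ 2)"
proof -
  have q2: "norm (q ^ 2) < 1" using assms by (simp add: norm_power power_less_one_iff)
  have "(\<lambda>n. (\<Prod>k<n. 1 - w * q ^ k) * (\<Prod>k<n. 1 - (-w) * q ^ k)) \<longlonglongrightarrow> qpoch w q * qpoch (-w) q"
    by (intro tendsto_intros qpoch_LIMSEQ assms)
  moreover have "(\<Prod>k<n. 1 - w * q ^ k) * (\<Prod>k<n. 1 - (-w) * q ^ k) = (\<Prod>k<n. 1 - w ^ 2 * (q ^ 2) ^ k)" for n
    unfolding prod.distrib[symmetric]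
    by (intro prod.cong) (auto simp: algebra_simps power2_eq_square power_mult_distrib)
  ultimately show ?thesis
    using qpoch_LIMSEQ[OF q2, of "w ^ 2"] LIMSEQ_unique by simp
qed

lemma qpoch_odd_even:
  assumes "norm q < 1"
  shows "qpoch w (q ^ 2) * qpoch (w * q) (q ^ 2) = qpoch w q"
proof -
  have q2: "norm (q ^ 2) < 1" using assms by (simp add: norm_power power_less_one_iff)
  have "(\<lambda>n. (\<Prod>k<n. 1 - w * (q ^ 2) ^ k) * (\<Prod>k<n. 1 - (w * q) * (q ^ 2) ^ k))
          \<longlonglongrightarrow> qpoch w (q ^ 2) * qpoch (w * q) (q ^ 2)"
    by (intro tendsto_intros qpoch_LIMSEQ q2)
  moreover have "(\<Prod>k<n. 1 - w * (q ^ 2) ^ k) * (\<Prod>k<n. 1 - (w * q) * (q ^ 2) ^ k)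
      = (\<Prod>k<2*n. 1 - w * q ^ k)" for n
    by (induction n) (auto simp: power_mult[symmetric] mult_ac)
  moreover have "(\<lambda>n. \<Prod>k<2*n. 1 - w * q ^ k) \<longlonglongrightarrow> qpoch w q"
    using LIMSEQ_subseq_LIMSEQ[OF qpoch_LIMSEQ[OF assms, of w], of "\<lambda>n. 2 * n"]
    by (simp add: o_def strict_mono_def)
  ultimately show ?thesis
    using LIMSEQ_unique by auto
qed

text \<open>Euler's identity between partitions into odd parts and into distinct parts. Splitting
  (q; q) by parity gives (q; q^2) (q^2; q^2), and the second factor is (q; q) (-q; q).\<close>

lemma qpoch_euler:
  assumes "norm q < 1"
  shows "qpoch q (q ^ 2) * qpoch (-q) q = 1"
proof -
  have "qpoch q q \<noteq> 0" by (rule qpoch_nonzero') (use assms in auto)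
  moreover have "qpoch q q = qpoch q (q^2) * (qpoch q q * qpoch (-q) q)"
    using qpoch_odd_even[OF assms, of q] qpoch_mult_neg[OF assms, of q] by (simp add: power2_eq_square)
  ultimately show ?thesis by (simp add: mult_ac)
qed

text \<open>Jacobi's theta function in product form without the factor (q; q). Leaving that factor
  out is what gives the Siegel functions weight 0.\<close>

definition theta :: "complex \<Rightarrow> complex \<Rightarrow> complex" where
  "theta w q = qpoch w q * qpoch (q / w) q"

lemma theta_mult_q:
  assumes "norm q < 1" "w \<noteq> 0" "q \<noteq> 0"
  shows "theta (q * w) q = - theta w q / w"
proof -
  have "theta (q * w) q = qpoch (w * q) q * ((1 - 1 / w) * qpoch (q / w) q)"
    using qpoch_rec[OF assms(1), of "1 / w"] assms(2,3) by (simp add: theta_def mult_ac)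
  also have "\<dots> = - theta w q / w"
    unfolding theta_def qpoch_rec[OF assms(1), of w] using assms(2) by (simp add: field_simps)
  finally show ?thesis .
qed

lemma theta_divide_q:
  assumes "norm q < 1" "w \<noteq> 0" "q \<noteq> 0"
  shows "theta (w / q) q = - (w / q) * theta w q"
  using theta_mult_q[OF assms(1), of "w / q"] assms by (simp add: field_simps)

lemma theta_inverse:
  assumes "norm q < 1" "w \<noteq> 0"
  shows "theta (1 / w) q = - theta w q / w"
proof -
  have "theta (1 / w) q = ((1 - 1 / w) * qpoch (q / w) q) * qpoch (w * q) q"
    using qpoch_rec[OF assms(1), of "1 / w"] assms(2) by (simp add: theta_def mult_ac)
  also have "\<dots> = - theta w q / w"
    unfolding theta_def qpoch_rec[OF assms(1), of w] using assms(2) by (simp add: field_simps)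
  finally show ?thesis .
qed

text \<open>Splits off the simple zero at w = 1. The remaining factor tends to 1 at a cusp and is
  nonzero at w = 1.\<close>

lemma theta_factor:
  assumes "norm q < 1"
  shows "theta w q = (1 - w) * (qpoch (w * q) q * qpoch (q / w) q)"
  using qpoch_rec[OF assms, of w] by (simp add: theta_def)

lemma theta_1: "norm q < 1 \<Longrightarrow> theta 1 q = 0"
  by (simp add: theta_factor)

lemma theta_nonzero:
  assumes q: "norm q < 1" "w \<noteq> 0" "q \<noteq> 0" and n: "\<And>n. w \<noteq> q powi n"
  shows "theta w q \<noteq> 0"
proof -
  have 1: "w * q ^ k \<noteq> 1" for k
  proof
    assume "w * q ^ k = 1"
    then have "w = q powi (- int k)" using q by (simp add: power_int_minus field_simps)
    then show False using n by blast
  qed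
  have 2: "q / w * q ^ k \<noteq> 1" for k
  proof
    assume "q / w * q ^ k = 1"
    then have "w = q powi (int (Suc k))" using q by (simp only: power_int_of_nat) (simp add: field_simps)
    then show False using n by blast
  qed
  show ?thesis
    using qpoch_nonzero[OF q(1) 1] qpoch_nonzero[OF q(1) 2] by (simp add: theta_def)
qed

section \<open>The exponential q and absolute values of Siegel functions\<close>

lemma q_of_add: "q_of (x + y) = q_of x * q_of y"
  by (simp add: q_of_def algebra_simps exp_add)
lemma q_of_minus: "q_of (- x) = 1 / q_of x"
  by (simp add: q_of_def exp_minus field_simps)
lemma q_of_diff: "q_of (x - y) = q_of x / q_of y"
  by (simp add: q_of_def algebra_simps exp_diff)
lemma q_of_nonzero [simp]: "q_of x \<noteq> 0"
  by (simp add: q_of_def)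
lemma q_of_0 [simp]: "q_of 0 = 1"
  by (simp add: q_of_def)
lemma q_of_of_int [simp]: "q_of (of_int n) = 1"
  unfolding q_of_def using exp_integer_2pi[of "of_int n"] by (simp add: mult_ac)
lemma q_of_of_nat [simp]: "q_of (of_nat n) = 1"
  using q_of_of_int[of "int n"] by simp
lemma q_of_1 [simp]: "q_of 1 = 1"
  using q_of_of_int[of 1] by simp
lemma q_of_eq_1_iff: "q_of x = 1 \<longleftrightarrow> x \<in> \<int>"
proof
  assume "q_of x = 1"
  then obtain n :: int where n: "Im (2 * of_real pi * \<i> * x) = of_int (2 * n) * pi" "Re (2 * of_real pi * \<i> * x) = 0"
    by (auto simp: q_of_def exp_eq_1)
  then have "x = of_int n" by (auto simp: complex_eq_iff)
  then show "x \<in> \<int>" by simp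
qed (auto elim!: Ints_cases)
lemma q_of_power: "q_of x ^ n = q_of (of_nat n * x)"
  by (simp add: q_of_def exp_of_nat_mult[symmetric] mult_ac)
lemma q_of_powi: "q_of x powi n = q_of (of_int n * x)"
  by (simp add: q_of_def exp_power_int mult_ac)
lemma norm_q_of: "norm (q_of x) = exp (- 2 * pi * Im x)"
  by (simp add: q_of_def)
lemma norm_q_of_less_1: "Im x > 0 \<Longrightarrow> norm (q_of x) < 1"
  by (simp add: norm_q_of)
lemma q_of_holomorphic [holomorphic_intros]: "f holomorphic_on A \<Longrightarrow> (\<lambda>x. q_of (f x)) holomorphic_on A"
  unfolding q_of_def by (intro holomorphic_intros)

text \<open>The modulus of the Siegel function with characteristic (r, s): the first factor is the
  modulus of q to the power B(r)/2, where B(r) = r^2 - r + 1/6 is the second Bernoulli polynomial.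
  This power makes the function periodic in r, since the quasi-periodicity of \<open>theta\<close>
  cancels against B(r + 1) - B(r) = 2r.\<close>

definition siegel_norm :: "real \<Rightarrow> real \<Rightarrow> complex \<Rightarrow> real" where
  "siegel_norm r s \<tau> = exp (- pi * Im \<tau> * (r^2 - r + 1/6)) * norm (theta (q_of (of_real r * \<tau> + of_real s)) (q_of \<tau>))"

lemma siegel_norm_add_1_right: "siegel_norm r (s + 1) \<tau> = siegel_norm r s \<tau>"
  by (simp add: siegel_norm_def q_of_add add.assoc[symmetric])

lemma siegel_norm_add_1_left:
  assumes "Im \<tau> > 0"
  shows "siegel_norm (r + 1) s \<tau> = siegel_norm r s \<tau>"
proof -
  have *: "q_of (of_real (r + 1) * \<tau> + of_real s) = q_of \<tau> * q_of (of_real r * \<tau> + of_real s)"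
    by (simp add: q_of_add[symmetric] algebra_simps)
  have "norm (theta (q_of (of_real (r + 1) * \<tau> + of_real s)) (q_of \<tau>)) =
      norm (theta (q_of (of_real r * \<tau> + of_real s)) (q_of \<tau>)) * exp (2 * pi * r * Im \<tau>)"
    unfolding * by (subst theta_mult_q)
      (use assms in \<open>auto simp: norm_q_of_less_1 norm_mult norm_divide norm_q_of exp_minus field_simps\<close>)
  moreover have "exp (- pi * Im \<tau> * ((r+1)^2 - (r+1) + 1/6)) * exp (2 * pi * r * Im \<tau>) = exp (- pi * Im \<tau> * (r^2 - r + 1/6))"
    unfolding exp_add[symmetric] by (simp add: power2_eq_square algebra_simps)
  ultimately show ?thesis unfolding siegel_norm_def by (simp add: mult_ac)
qed

lemma shift_int_eq:
  fixes f :: "real \<Rightarrow> 'a"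
  assumes "\<And>x. f (x + 1) = f x"
  shows "f (x + of_int n) = f x"
proof (induction n rule: int_induct[where k = 0])
  case (step1 i) then show ?case using assms[of "x + of_int i"] by (simp add: algebra_simps)
next
  case (step2 i) then show ?case using assms[of "x + of_int i - 1"] by (simp add: algebra_simps)
qed simp

lemma siegel_norm_add_int:
  assumes "Im \<tau> > 0"
  shows "siegel_norm (r + of_int m) (s + of_int n) \<tau> = siegel_norm r s \<tau>"
  using shift_int_eq[of "\<lambda>r. siegel_norm r (s + of_int n) \<tau>" r m] siegel_norm_add_1_left[OF assms]
    shift_int_eq[of "\<lambda>s. siegel_norm r s \<tau>" s n] siegel_norm_add_1_right by simp

lemma siegel_norm_minus:
  assumes "Im \<tau> > 0"
  shows "siegel_norm (- r) (- s) \<tau> = siegel_norm r s \<tau>"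
proof -
  have *: "q_of (of_real (- r) * \<tau> + of_real (- s)) = 1 / q_of (of_real r * \<tau> + of_real s)"
    by (simp add: q_of_minus[symmetric] algebra_simps)
  have "norm (theta (q_of (of_real (- r) * \<tau> + of_real (- s))) (q_of \<tau>)) =
      norm (theta (q_of (of_real r * \<tau> + of_real s)) (q_of \<tau>)) * exp (2 * pi * r * Im \<tau>)"
    unfolding * by (subst theta_inverse)
      (use assms in \<open>auto simp: norm_q_of_less_1 norm_mult norm_divide norm_q_of exp_minus field_simps\<close>)
  moreover have "exp (- pi * Im \<tau> * ((-r)^2 - (-r) + 1/6)) * exp (2 * pi * r * Im \<tau>) = exp (- pi * Im \<tau> * (r^2 - r + 1/6))"
    unfolding exp_add[symmetric] by (simp add: power2_eq_square algebra_simps)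
  ultimately show ?thesis unfolding siegel_norm_def by (simp add: mult_ac)
qed

lemma siegel_norm_translate: "siegel_norm r s (\<tau> + of_int n) = siegel_norm r (s + r * of_int n) \<tau>"
  by (simp add: siegel_norm_def q_of_add algebra_simps)

lemma theta_q_of_nonzero:
  assumes "Im \<tau> > 0" "\<And>m n. z \<noteq> of_int m * \<tau> + of_int n"
  shows "theta (q_of z) (q_of \<tau>) \<noteq> 0"
proof (rule theta_nonzero)
  fix m show "q_of z \<noteq> q_of \<tau> powi m"
  proof
    assume "q_of z = q_of \<tau> powi m"
    then have "q_of (z - of_int m * \<tau>) = 1"
      by (simp add: q_of_powi q_of_diff)
    then show False
      using assms(2) by (auto simp: q_of_eq_1_iff elim!: Ints_cases) (metis diff_eq_eq add.commute)
  qed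
qed (use assms norm_q_of_less_1 in auto)

lemma siegel_norm_int:
  assumes "Im \<tau> > 0" "r \<in> \<int>" "s \<in> \<int>"
  shows "siegel_norm r s \<tau> = 0"
proof -
  obtain m n where "r = of_int m" "s = of_int n" using assms by (auto elim!: Ints_cases)
  then have "siegel_norm r s \<tau> = siegel_norm 0 0 \<tau>"
    using siegel_norm_add_int[OF assms(1), of 0 m 0 n] by simp
  then show ?thesis using assms by (simp add: siegel_norm_def theta_1 norm_q_of_less_1)
qed

text \<open>The product is free of \<tau>, so it calibrates the inversion formula. The powers of q
  cancel because the Bernoulli values at 1/2, 0, 1/2 are -1/12, 1/6, -1/12. The infinite products
  cancel by Euler's identity, and 2 is the factor 1 - w at w = -1.\<close>

lemma siegel_norm_half_periods:
  assumes "Im \<tau> > 0"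
  shows "siegel_norm (1/2) 0 \<tau> * siegel_norm 0 (1/2) \<tau> * siegel_norm (1/2) (1/2) \<tau> = 2"
proof -
  define p where "p = q_of (\<tau> / 2)"
  have p2: "q_of \<tau> = p ^ 2" by (simp add: p_def q_of_power)
  have m1: "q_of (1/2) = -1" by (simp add: q_of_def)
  have q: "norm (p ^ 2) < 1" using norm_q_of_less_1[OF assms] p2 by simp
  have p: "norm p < 1" unfolding p_def by (rule norm_q_of_less_1) (use assms in simp)
  have p0: "p \<noteq> 0" by (simp add: p_def)
  have *: "siegel_norm (1/2) 0 \<tau> = exp (pi * Im \<tau> / 12) * norm (qpoch p (p^2) * qpoch p (p^2))"
    using p0 unfolding siegel_norm_def theta_def p2 by (simp add: p_def[symmetric] power2_eq_square)
  have **: "siegel_norm (1/2) (1/2) \<tau> = exp (pi * Im \<tau> / 12) * norm (qpoch (-p) (p^2) * qpoch (-p) (p^2))"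
    using p0 unfolding siegel_norm_def theta_def p2
    by (simp add: p_def[symmetric] q_of_add m1[simplified] power2_eq_square)
  have "theta (-1) (p^2) = 2 * (qpoch (-(p^2)) (p^2) * qpoch (-(p^2)) (p^2))"
    by (subst theta_factor[OF q]) simp
  then have ***: "siegel_norm 0 (1/2) \<tau> = exp (- pi * Im \<tau> / 6) * (2 * norm (qpoch (-(p^2)) (p^2) * qpoch (-(p^2)) (p^2)))"
    unfolding siegel_norm_def p2 by (simp add: m1[simplified] norm_mult)
  have e1: "exp (pi * Im \<tau> / 12) * exp (pi * Im \<tau> / 12) * exp (- pi * Im \<tau> / 6) = 1"
    unfolding exp_add[symmetric] by simp
  have "qpoch p (p^2) * qpoch (-p) (p^2) = qpoch (p^2) ((p^2)^2)" by (rule qpoch_mult_neg[OF q])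
  then have e2: "qpoch p (p^2) * qpoch (-p) (p^2) * qpoch (-(p^2)) (p^2) = 1"
    using qpoch_euler[OF q] by simp
  have "siegel_norm (1/2) 0 \<tau> * siegel_norm 0 (1/2) \<tau> * siegel_norm (1/2) (1/2) \<tau>
     = 2 * (exp (pi * Im \<tau> / 12) * exp (pi * Im \<tau> / 12) * exp (- pi * Im \<tau> / 6)) *
        norm (qpoch p (p^2) * qpoch (-p) (p^2) * qpoch (-(p^2)) (p^2)) ^ 2"
    unfolding * ** *** by (simp add: norm_mult power2_eq_square mult_ac)
  then show ?thesis unfolding e1 e2 by simp
qed

text \<open>A limit at 0 makes the singularity there removable. Periodicity carries this to all
  lattice points and makes the entire extension bounded by its values on one parallelogram, so
  Liouville's theorem applies.\<close>

lemma elliptic_constant: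
  fixes Q :: "complex \<Rightarrow> complex" and \<tau> :: complex
  defines "\<Lambda> \<equiv> {z. \<exists>m n. z = of_int m * \<tau> + of_int n}"
  assumes \<tau>: "Im \<tau> > 0"
    and hol: "\<And>z. z \<notin> \<Lambda> \<Longrightarrow> Q field_differentiable at z"
    and per: "\<And>z. z \<notin> \<Lambda> \<Longrightarrow> Q (z + 1) = Q z" "\<And>z. z \<notin> \<Lambda> \<Longrightarrow> Q (z + \<tau>) = Q z"
    and lim: "Q \<midarrow>0\<rightarrow> c"
  shows "z \<notin> \<Lambda> \<Longrightarrow> Q z = c"
proof -
  define R where "R z = (if z \<in> \<Lambda> then c else Q z)" for z
  have add: "z + w \<in> \<Lambda> \<longleftrightarrow> z \<in> \<Lambda>" if "w \<in> \<Lambda>" for z w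
  proof -
    obtain m n where w: "w = of_int m * \<tau> + of_int n" using \<open>w \<in> \<Lambda>\<close> by (auto simp: \<Lambda>_def)
    show ?thesis
    proof
      assume "z + w \<in> \<Lambda>"
      then obtain m' n' where "z + w = of_int m' * \<tau> + of_int n'" by (auto simp: \<Lambda>_def)
      then have "z = of_int (m' - m) * \<tau> + of_int (n' - n)" using w by (simp add: algebra_simps)
      then show "z \<in> \<Lambda>" unfolding \<Lambda>_def by blast
    next
      assume "z \<in> \<Lambda>"
      then obtain m' n' where "z = of_int m' * \<tau> + of_int n'" by (auto simp: \<Lambda>_def)
      then have "z + w = of_int (m' + m) * \<tau> + of_int (n' + n)" using w by (simp add: algebra_simps)
      then show "z + w \<in> \<Lambda>" unfolding \<Lambda>_def by blast
    qed
  qed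
  have lattice: "of_int m * \<tau> + of_int n \<in> \<Lambda>" for m n by (auto simp: \<Lambda>_def)
  have base: "0 \<in> \<Lambda>" "1 \<in> \<Lambda>" "\<tau> \<in> \<Lambda>"
    using lattice[of 0 0] lattice[of 0 1] lattice[of 1 0] by simp_all
  have R1: "R (z + 1) = R z" and R\<tau>: "R (z + \<tau>) = R z" for z
    using per add base by (auto simp: R_def)
  have Rn: "R (z + of_int n) = R z" for z n
  proof (induction n rule: int_induct[where k = 0])
    case (step1 i) then show ?case using R1[of "z + of_int i"] by (simp add: algebra_simps)
  next
    case (step2 i) then show ?case using R1[of "z + of_int i - 1"] by (simp add: algebra_simps)
  qed simp
  have Rm: "R (z + of_int m * \<tau>) = R z" for z m
  proof (induction m rule: int_induct[where k = 0])
    case (step1 i) then show ?case using R\<tau>[of "z + of_int i * \<tau>"] by (simp add: algebra_simps)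
  next
    case (step2 i) then show ?case using R\<tau>[of "z + of_int i * \<tau> - \<tau>"] by (simp add: algebra_simps)
  qed simp
  \<comment> \<open>Distinct lattice points are at least d apart: a difference of imaginary part
    below Im \<tau> has m = 0, and then it is an integer n with |n| < 1.\<close>
  define d where "d = min 1 (Im \<tau>)"
  have d: "d > 0" using \<tau> by (simp add: d_def)
  have iso: "z = 0" if *: "z \<in> \<Lambda>" "norm z < d" for z
  proof -
    obtain m n where z: "z = of_int m * \<tau> + of_int n" using * by (auto simp: \<Lambda>_def)
    have "\<bar>Im z\<bar> < Im \<tau>" using that abs_Im_le_cmod[of z] by (simp add: d_def)
    then have "\<bar>real_of_int m\<bar> * Im \<tau> < 1 * Im \<tau>" using \<tau> by (simp add: z abs_mult)
    then have "\<bar>real_of_int m\<bar> < 1" using \<tau> by (simp only: mult_less_cancel_right_pos)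
    then have m: "m = 0" by linarith
    have "\<bar>Re z\<bar> < 1" using that abs_Re_le_cmod[of z] by (simp add: d_def)
    then have "n = 0" using z m by simp
    then show ?thesis using z m by simp
  qed
  have R_off: "R field_differentiable at z" if z: "z \<in> ball 0 d - {0}" for z
  proof -
    have "R field_differentiable at z \<longleftrightarrow> Q field_differentiable at z"
    proof -
      have ev: "eventually (\<lambda>w. R w = Q w) (nhds z)"
      proof (rule eventually_mono)
        show "eventually (\<lambda>w. w \<in> ball 0 d - {0}) (nhds z)"
          using z by (intro eventually_nhds_in_open) auto
      qed (use iso in \<open>auto simp: R_def\<close>)
      show ?thesis
        unfolding field_differentiable_def
        by (intro ex_cong1 DERIV_cong_ev refl ev)
    qed
    then show ?thesis using hol[of z] iso[of z] z by auto
  qed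
  have "R holomorphic_on ball 0 d"
  proof (rule no_isolated_singularity'[of "{0}"])
    fix z :: complex assume "z \<in> {0}"
    have "(R \<longlongrightarrow> c) (at 0)"
      using lim
    proof (rule Lim_transform_eventually)
      show "\<forall>\<^sub>F x in at 0. Q x = R x"
      proof (rule eventually_mono)
        show "eventually (\<lambda>w. w \<in> ball 0 d - {0}) (at 0)"
          using d by (intro eventually_at_in_open) auto
      qed (use iso in \<open>auto simp: R_def\<close>)
    qed
    then show "(R \<longlongrightarrow> R z) (at z within ball 0 d)"
      using \<open>z \<in> {0}\<close> base d by (auto simp: R_def intro: tendsto_within_subset)
  next
    show "R holomorphic_on ball 0 d - {0}"
      using R_off by (auto simp: holomorphic_on_def intro: field_differentiable_at_within)
  qed auto
  then have R0: "R field_differentiable at 0"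
    using d by (simp add: holomorphic_on_imp_differentiable_at)
  have closedL: "\<exists>e>0. \<forall>w. dist w z < e \<longrightarrow> w \<notin> \<Lambda>" if "z \<notin> \<Lambda>" for z
  proof (cases "\<exists>w\<in>\<Lambda>. dist w z < d / 2")
    case False then show ?thesis using d by (intro exI[of _ "d/2"]) auto
  next
    case True
    then obtain w where w: "w \<in> \<Lambda>" "dist w z < d / 2" by blast
    have "w \<noteq> z" using w that by auto
    show ?thesis
    proof (intro exI[of _ "min (d/2) (dist w z)"] conjI allI impI notI)
      fix x assume x: "dist x z < min (d/2) (dist w z)" "x \<in> \<Lambda>"
      have "x - w + w \<in> \<Lambda>" using x by simp
      then have "x - w \<in> \<Lambda>" using add[OF w(1)] by blast
      moreover have "norm (x - w) < d"
        using x(1) w(2) dist_triangle2[of x w z] by (simp add: dist_norm)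
      ultimately have "x = w" using iso by fastforce
      then show False using x by simp
    qed (use \<open>w \<noteq> z\<close> d in auto)
  qed
  have "R field_differentiable at z" for z
  proof (cases "z \<in> \<Lambda>")
    case True
    then obtain m n where z: "z = of_int m * \<tau> + of_int n" by (auto simp: \<Lambda>_def)
    have "R (w - z) = R w" for w
      using Rm[of "w + of_int (- n)" "- m"] Rn[of w "- n"] z by (simp add: algebra_simps)
    then have "R = (\<lambda>w. R (w - z))" by auto
    moreover have "(\<lambda>w. R (w - z)) field_differentiable at z"
    proof -
      have "(R \<circ> (\<lambda>w. w - z)) field_differentiable at z"
        by (rule field_differentiable_compose) (use R0 in \<open>auto intro: derivative_intros\<close>)
      then show ?thesis by (simp add: o_def)
    qed
    ultimately show ?thesis by simp
  next
    case False
    then obtain e where e: "e > 0" "\<And>w. dist w z < e \<Longrightarrow> w \<notin> \<Lambda>" using closedL by blast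
    have "eventually (\<lambda>w. R w = Q w) (nhds z)"
    proof (rule eventually_mono)
      show "eventually (\<lambda>w. w \<in> ball z e) (nhds z)"
        using e by (intro eventually_nhds_in_open) auto
    qed (use e in \<open>auto simp: R_def dist_commute\<close>)
    then have "R field_differentiable at z \<longleftrightarrow> Q field_differentiable at z"
      unfolding field_differentiable_def by (intro ex_cong1 DERIV_cong_ev refl)
    then show ?thesis using hol False by blast
  qed
  then have ent: "R holomorphic_on UNIV"
    by (auto simp: holomorphic_on_def intro: field_differentiable_at_within)
  have "bounded (range R)"
  proof -
    define K where "K = (\<lambda>(r, s). complex_of_real r * \<tau> + complex_of_real s) ` ({0..1} \<times> {0..1::real})"
    have "compact K" unfolding K_def
      by (intro compact_continuous_image compact_Times) (auto intro!: continuous_intros simp: case_prod_unfold)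
    then have "compact (R ` K)"
      using ent holomorphic_on_imp_continuous_on
      by (metis compact_continuous_image continuous_on_subset subset_UNIV)
    moreover have "range R \<subseteq> R ` K"
    proof clarify
      fix z :: complex
      define r where "r = Im z / Im \<tau>"
      define s where "s = Re z - r * Re \<tau>"
      have z: "z = of_real r * \<tau> + of_real s"
        using \<tau> by (simp add: complex_eq_iff r_def s_def)
      define z' where "z' = of_real (frac r) * \<tau> + of_real (frac s)"
      have "z = z' + of_int \<lfloor>r\<rfloor> * \<tau> + of_int \<lfloor>s\<rfloor>"
        unfolding z z'_def frac_def by (simp add: algebra_simps)
      then have "R z = R z'" using Rn Rm by simp
      moreover have "z' \<in> K"
        unfolding K_def z'_def using frac_ge_0[of r] frac_lt_1[of r] frac_ge_0[of s] frac_lt_1[of s]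
        by (intro image_eqI[of _ _ "(frac r, frac s)"]) (auto simp: less_imp_le)
      ultimately show "R z \<in> R ` K" by auto
    qed
    ultimately show ?thesis using bounded_subset compact_imp_bounded by blast
  qed
  then obtain k where "\<And>z. R z = k"
    using Liouville_theorem[OF ent] by (auto simp: constant_on_def)
  moreover have "R 0 = c" using base by (simp add: R_def)
  ultimately have "R z = c" for z by metis
  then show "z \<notin> \<Lambda> \<Longrightarrow> Q z = c" by (metis R_def)
qed

text \<open>The functions of z on the two sides have their zeros at the same lattice points. The
  exponential of a quadratic polynomial is the Gaussian factor that also makes their behaviour under
  z + 1 and z + \<tau> agree, so the quotient is elliptic and extends over 0.\<close>

lemma theta_ratio_constant:
  assumes \<tau>: "Im \<tau> > 0"
  obtains c where "\<And>z. (\<And>m n. z \<noteq> of_int m * \<tau> + of_int n) \<Longrightarrow>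
     theta (q_of (z / \<tau>)) (q_of (- 1 / \<tau>)) * exp (\<i> * pi * (- (z^2) / \<tau> + z - z / \<tau>)) = c * theta (q_of z) (q_of \<tau>)"
proof -
  define \<sigma> where "\<sigma> = - 1 / \<tau>"
  have \<tau>0: "\<tau> \<noteq> 0" using \<tau> by auto
  have \<sigma>: "Im \<sigma> > 0" using \<tau> unfolding \<sigma>_def by (auto simp: Im_divide sum_power2_gt_zero_iff)
  define E where "E z = exp (\<i> * pi * (- (z^2) / \<tau> + z - z / \<tau>))" for z
  define Q where "Q z = theta (q_of (z / \<tau>)) (q_of \<sigma>) / theta (q_of z) (q_of \<tau>) * E z" for z
  define \<Lambda> where "\<Lambda> = {z. \<exists>m n. z = of_int m * \<tau> + of_int n}"
  have q: "norm (q_of \<tau>) < 1" "norm (q_of \<sigma>) < 1" using norm_q_of_less_1 \<tau> \<sigma> by auto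
  have th_hol: "(\<lambda>z. theta (q_of (f z)) (q_of t)) holomorphic_on UNIV"
    if "f holomorphic_on UNIV" "Im t > 0" for f t
    unfolding theta_def using that by (intro holomorphic_intros norm_q_of_less_1) auto
  have nz: "theta (q_of z) (q_of \<tau>) \<noteq> 0" if "z \<notin> \<Lambda>" for z
    using theta_q_of_nonzero[OF \<tau>, of z] that unfolding \<Lambda>_def by blast
  have "Q field_differentiable at z" if "z \<notin> \<Lambda>" for z
  proof -
    have "(\<lambda>z. theta (q_of (z / \<tau>)) (q_of \<sigma>)) holomorphic_on UNIV"
      by (rule th_hol) (use \<sigma> \<tau>0 in \<open>auto intro!: holomorphic_intros\<close>)
    moreover have "(\<lambda>z. theta (q_of z) (q_of \<tau>)) holomorphic_on UNIV"
      by (rule th_hol) (use \<tau> in \<open>auto intro!: holomorphic_intros\<close>)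
    moreover have "E holomorphic_on UNIV"
      unfolding E_def[abs_def] using \<tau>0 by (auto intro!: holomorphic_intros)
    ultimately have "(\<lambda>z. theta (q_of (z / \<tau>)) (q_of \<sigma>)) field_differentiable at z"
      "(\<lambda>z. theta (q_of z) (q_of \<tau>)) field_differentiable at z"
      "E field_differentiable at z"
      using holomorphic_on_imp_differentiable_at[OF _ open_UNIV UNIV_I] by blast+
    then show ?thesis unfolding Q_def[abs_def] using nz[OF that]
      by (intro field_differentiable_mult field_differentiable_divide) auto
  qed
  moreover have "Q (z + 1) = Q z" for z
  proof -
    have "theta (q_of ((z + 1) / \<tau>)) (q_of \<sigma>) = theta (q_of (z / \<tau>) / q_of \<sigma>) (q_of \<sigma>)"
      by (simp add: q_of_diff[symmetric] \<sigma>_def add_divide_distrib)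
    also have "\<dots> = - (q_of (z / \<tau>) / q_of \<sigma>) * theta (q_of (z / \<tau>)) (q_of \<sigma>)"
      by (rule theta_divide_q) (use q in auto)
    finally have 1: "theta (q_of ((z + 1) / \<tau>)) (q_of \<sigma>) = - (q_of (z / \<tau>) / q_of \<sigma>) * theta (q_of (z / \<tau>)) (q_of \<sigma>)" .
    have "\<i> * pi * (- ((z+1)^2) / \<tau> + (z+1) - (z+1) / \<tau>)
        = \<i> * pi * (- (z^2) / \<tau> + z - z / \<tau>) + 2 * pi * \<i> * (\<sigma> - z / \<tau>) + \<i> * pi"
      using \<tau>0 by (simp add: \<sigma>_def field_simps power2_eq_square)
    then have 2: "E (z + 1) = - E z * (q_of \<sigma> / q_of (z / \<tau>))"
      unfolding E_def q_of_diff[symmetric] by (simp add: exp_add q_of_def mult_ac)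
    show ?thesis unfolding Q_def 1 2 by (simp add: q_of_add)
  qed
  moreover have "Q (z + \<tau>) = Q z" for z
  proof -
    have "theta (q_of (z + \<tau>)) (q_of \<tau>) = theta (q_of \<tau> * q_of z) (q_of \<tau>)"
      by (simp add: q_of_add[symmetric] add.commute)
    also have "\<dots> = - theta (q_of z) (q_of \<tau>) / q_of z"
      by (rule theta_mult_q) (use q in auto)
    finally have 1: "theta (q_of (z + \<tau>)) (q_of \<tau>) = - theta (q_of z) (q_of \<tau>) / q_of z" .
    have "\<i> * pi * (- ((z+\<tau>)^2) / \<tau> + (z+\<tau>) - (z+\<tau>) / \<tau>)
        = \<i> * pi * (- (z^2) / \<tau> + z - z / \<tau>) + 2 * pi * \<i> * (- z) - \<i> * pi"
      using \<tau>0 by (simp add: field_simps power2_eq_square)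
    then have 2: "E (z + \<tau>) = - E z / q_of z"
      unfolding E_def q_of_minus[symmetric, unfolded divide_inverse]
      by (simp add: exp_diff exp_add q_of_def exp_minus divide_inverse mult_ac)
    have 3: "q_of ((z + \<tau>) / \<tau>) = q_of (z / \<tau>)"
      using \<tau>0 by (simp add: add_divide_distrib q_of_add)
    show ?thesis unfolding Q_def 1 2 3 by simp
  qed
  moreover obtain c where "Q \<midarrow>0\<rightarrow> c"
  proof
    define N1 where "N1 z = qpoch (q_of (z / \<tau>) * q_of \<sigma>) (q_of \<sigma>) * qpoch (q_of \<sigma> / q_of (z / \<tau>)) (q_of \<sigma>)" for z
    define D1 where "D1 z = qpoch (q_of z * q_of \<tau>) (q_of \<tau>) * qpoch (q_of \<tau> / q_of z) (q_of \<tau>)" for z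
    have "N1 holomorphic_on UNIV" "D1 holomorphic_on UNIV" "E holomorphic_on UNIV"
      unfolding N1_def[abs_def] D1_def[abs_def] E_def[abs_def] using \<tau>0 q by (auto intro!: holomorphic_intros)
    then have cont: "isCont N1 0" "isCont D1 0" "isCont E 0"
      by (auto simp: holomorphic_on_imp_continuous_on continuous_on_eq_continuous_at
          dest!: holomorphic_on_imp_continuous_on)
    have D0: "D1 0 \<noteq> 0" using qpoch_nonzero'[OF q(1) q(1)] by (simp add: D1_def)
    have q': "((\<lambda>z. q_of (a * z)) has_field_derivative 2 * pi * \<i> * a) (at 0)" for a
      unfolding q_of_def by (auto intro!: derivative_eq_intros)
    have l: "(\<lambda>z. (1 - q_of (a * z)) / z) \<midarrow>0\<rightarrow> - (2 * pi * \<i> * a)" for a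
    proof -
      have "(\<lambda>z. (q_of (a * z) - 1) / z) \<midarrow>0\<rightarrow> 2 * pi * \<i> * a"
        using q'[of a] by (simp add: has_field_derivative_iff)
      from tendsto_minus[OF this] show ?thesis
        by (simp add: minus_divide_left)
    qed
    \<comment> \<open>Both thetas vanish at z = 0 through their first factor 1 - w. Dividing each of
      these by z leaves a quotient of derivatives, and the other factors are continuous and nonzero
      in the denominator.\<close>
    have "(\<lambda>z. ((1 - q_of (1 / \<tau> * z)) / z) / ((1 - q_of (1 * z)) / z) * (N1 z / D1 z) * E z)
        \<midarrow>0\<rightarrow> (- (2 * pi * \<i> * (1 / \<tau>))) / (- (2 * pi * \<i> * 1)) * (N1 0 / D1 0) * E 0"
      by (intro tendsto_mult tendsto_divide l) (use cont D0 in \<open>auto simp: isCont_def\<close>)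
    then show "Q \<midarrow>0\<rightarrow> (- (2 * pi * \<i> * (1 / \<tau>))) / (- (2 * pi * \<i> * 1)) * (N1 0 / D1 0) * E 0"
    proof (rule Lim_transform_eventually)
      have "\<forall>\<^sub>F z in at 0. z \<noteq> (0::complex)" by (simp add: eventually_at_filter)
      then show "\<forall>\<^sub>F z in at 0. ((1 - q_of (1 / \<tau> * z)) / z) / ((1 - q_of (1 * z)) / z) * (N1 z / D1 z) * E z = Q z"
        by eventually_elim (simp add: Q_def N1_def D1_def theta_factor[OF q(1)] theta_factor[OF q(2)])
    qed
  qed
  ultimately have "Q z = c" if "z \<notin> \<Lambda>" for z
    using elliptic_constant[of \<tau> Q c z, folded \<Lambda>_def] \<tau> that by blast
  then have "theta (q_of (z / \<tau>)) (q_of \<sigma>) * E z = c * theta (q_of z) (q_of \<tau>)" if "z \<notin> \<Lambda>" for z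
    using nz[OF that] that unfolding Q_def by (metis nonzero_eq_divide_eq times_divide_eq_left)
  then show ?thesis
    by (intro that[of c]) (auto simp: \<Lambda>_def E_def \<sigma>_def)
qed

section \<open>Sums over residues\<close>

text \<open>The periodic second Bernoulli function.\<close>

definition beta2 :: "real \<Rightarrow> real" where
  "beta2 x = frac x ^ 2 - frac x + 1/6"

lemma beta2_add_int [simp]: "beta2 (x + of_int n) = beta2 x"
  by (simp add: beta2_def)

lemma bij_betw_affine_mod:
  fixes c d n :: int
  assumes "n > 0" "coprime c n"
  shows "bij_betw (\<lambda>k. (c * k + d) mod n) {0..<n} {0..<n}"
proof -
  have "inj_on (\<lambda>k. (c * k + d) mod n) {0..<n}"
  proof (rule inj_onI)
    fix x y assume xy: "x \<in> {0..<n}" "y \<in> {0..<n}" "(c * x + d) mod n = (c * y + d) mod n"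
    then have "[c * x + d = c * y + d] (mod n)" by (simp add: cong_def)
    then have "[c * x = c * y] (mod n)" by (simp add: cong_add_rcancel)
    then have "[x = y] (mod n)" using assms by (simp add: cong_mult_lcancel)
    then show "x = y" using xy by (simp add: cong_def)
  qed
  moreover have "(\<lambda>k. (c * k + d) mod n) ` {0..<n} \<subseteq> {0..<n}" using assms by auto
  ultimately show ?thesis
    unfolding bij_betw_def using endo_inj_surj[of "{0..<n}"] by auto
qed

lemma periodic_mod:
  fixes F :: "int \<Rightarrow> 'a"
  assumes "\<And>a. F (a + n) = F a"
  shows "F (a mod n) = F a" "F (a + n * k) = F a"
proof -
  have *: "F (a + n * k) = F a" for a k
  proof (induction k rule: int_induct[where k = 0])
    case (step1 i) then show ?case using assms[of "a + n * i"] by (simp add: algebra_simps)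
  next
    case (step2 i) then show ?case using assms[of "a + n * i - n"] by (simp add: algebra_simps)
  qed simp
  show "F (a + n * k) = F a" by (rule *)
  show "F (a mod n) = F a" using *[of "a mod n" "a div n"] by (simp add: mult.commute)
qed

lemma periodic_cong:
  fixes F :: "int \<Rightarrow> 'a"
  assumes "\<And>a. F (a + n) = F a" "[a = b] (mod n)"
  shows "F a = F b"
  using periodic_mod(1)[of F n a] periodic_mod(1)[of F n b] assms by (simp add: cong_def)

lemma sum_periodic_affine:
  fixes F :: "int \<Rightarrow> 'a::comm_monoid_add"
  assumes "n > 0" "coprime c n" "\<And>a. F (a + n) = F a"
  shows "(\<Sum>k\<in>{0..<n}. F (c * k + d)) = (\<Sum>k\<in>{0..<n}. F k)"
  using sum.reindex_bij_betw[OF bij_betw_affine_mod[OF assms(1,2)], of F d] periodic_mod(1)[of F n, OF assms(3)] by simp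

lemma prod_periodic_affine:
  fixes F :: "int \<Rightarrow> 'a::comm_monoid_mult"
  assumes "n > 0" "coprime c n" "\<And>a. F (a + n) = F a"
  shows "(\<Prod>k\<in>{0..<n}. F (c * k + d)) = (\<Prod>k\<in>{0..<n}. F k)"
  using prod.reindex_bij_betw[OF bij_betw_affine_mod[OF assms(1,2)], of F d] periodic_mod(1)[of F n, OF assms(3)] by simp

text \<open>The parametrisation b = i n + j m of the residues modulo mn is chosen for fractions:
  b/(mn) splits as i/m + j/n.\<close>

lemma sum_crt:
  fixes F :: "int \<Rightarrow> 'a::comm_monoid_add"
  assumes mn: "m > 0" "n > 0" "coprime m n" and per: "\<And>a. F (a + m * n) = F a"
  shows "(\<Sum>b\<in>{0..<m*n}. F b) = (\<Sum>i\<in>{0..<m}. \<Sum>j\<in>{0..<n}. F (i * n + j * m))"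
proof -
  define g where "g = (\<lambda>(i, j). (i * n + j * m) mod (m * n))"
  have inj: "inj_on g ({0..<m} \<times> {0..<n})"
  proof (rule inj_onI, clarify)
    fix i j i' j' assume ij: "i \<in> {0..<m}" "j \<in> {0..<n}" "i' \<in> {0..<m}" "j' \<in> {0..<n}" "g (i, j) = g (i', j')"
    then have c: "[i * n + j * m = i' * n + j' * m] (mod (m * n))" by (simp add: g_def cong_def)
    from cong_modulus_mult[OF c] have "[i * n = i' * n] (mod m)"
      by (simp add: cong_def)
    then have "[i = i'] (mod m)" using mn by (subst (asm) cong_mult_rcancel) (auto simp: coprime_commute)
    then have "i = i'" using ij by (simp add: cong_def)
    from c have "[i * n + j * m = i' * n + j' * m] (mod (n * m))" by (simp add: mult.commute)
    from cong_modulus_mult[OF this] have "[j * m = j' * m] (mod n)" by (simp add: cong_def)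
    then have "[j = j'] (mod n)" using mn by (subst (asm) cong_mult_rcancel) auto
    then have "j = j'" using ij by (simp add: cong_def)
    with \<open>i = i'\<close> show "i = i' \<and> j = j'" by simp
  qed
  have sub: "g ` ({0..<m} \<times> {0..<n}) \<subseteq> {0..<m*n}" using mn by (auto simp: g_def)
  have "card (g ` ({0..<m} \<times> {0..<n})) = card {0..<m*n}"
    using mn by (simp add: card_image[OF inj] card_cartesian_product nat_mult_distrib)
  then have "g ` ({0..<m} \<times> {0..<n}) = {0..<m*n}" using sub by (intro card_subset_eq) auto
  then have "bij_betw g ({0..<m} \<times> {0..<n}) {0..<m*n}" using inj by (simp add: bij_betw_def)
  then have "(\<Sum>b\<in>{0..<m*n}. F b) = (\<Sum>x\<in>{0..<m}\<times>{0..<n}. F (g x))"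
    using sum.reindex_bij_betw by metis
  also have "\<dots> = (\<Sum>(i,j)\<in>{0..<m}\<times>{0..<n}. F (i * n + j * m))"
    using periodic_mod(1)[of F "m * n", OF per] by (intro sum.cong) (auto simp: g_def)
  finally show ?thesis by (simp add: sum.cartesian_product)
qed

text \<open>The substitution a \<mapsto> t a permutes the residues and multiplies the sum by X(t),
  which is not 1.\<close>

lemma sum_twist_vanish:
  fixes X F :: "int \<Rightarrow> 'a::idom"
  assumes "n > 0" "coprime t n" "\<And>a. X (t * a) = X t * X a" "\<And>a. X (a + n) = X a" "X t \<noteq> 1"
    "\<And>a. F (t * a) = F a" "\<And>a. F (a + n) = F a"
  shows "(\<Sum>a\<in>{0..<n}. X a * F a) = 0"
proof -
  have "(\<Sum>a\<in>{0..<n}. X a * F a) = (\<Sum>a\<in>{0..<n}. X (t * a) * F (t * a))"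
    using sum_periodic_affine[of n t "\<lambda>a. X a * F a" 0] assms by simp
  also have "\<dots> = X t * (\<Sum>a\<in>{0..<n}. X a * F a)"
    unfolding assms(3,6) by (simp add: sum_distrib_left mult_ac)
  finally show ?thesis using assms(5) by (metis mult_cancel_right1)
qed

lemma sum_multiples:
  fixes F :: "int \<Rightarrow> 'a::comm_monoid_add"
  assumes "d > 0" "d dvd n"
  shows "(\<Sum>k | k \<in> {0..<n} \<and> d dvd k. F k) = (\<Sum>j\<in>{0..<n div d}. F (d * j))"
proof (rule sum.reindex_bij_witness[where i = "\<lambda>j. d * j" and j = "\<lambda>k. k div d"])
  fix j assume "j \<in> {0..<n div d}"
  then have "0 \<le> j" "j < n div d" by auto
  moreover have "d * (n div d) = n" using assms by simp
  ultimately show "d * j \<in> {k. k \<in> {0..<n} \<and> d dvd k}" using assms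
    by (metis (no_types, lifting) atLeastLessThan_iff dvd_triv_left mem_Collect_eq mult_less_cancel_left_pos
        mult_nonneg_nonneg order_less_imp_le)
next
  fix k assume "k \<in> {k. k \<in> {0..<n} \<and> d dvd k}"
  then show "k div d \<in> {0..<n div d}" using assms by (auto elim!: dvdE simp: pos_imp_zdiv_nonneg_iff)
qed (use assms in auto)

section \<open>Sieving by prime factors\<close>

lemma prod_one_minus:
  fixes f :: "'b \<Rightarrow> 'a::comm_ring_1"
  assumes "finite S"
  shows "(\<Prod>p\<in>S. 1 - f p) = (\<Sum>D\<in>Pow S. (-1) ^ card D * (\<Prod>p\<in>D. f p))"
proof -
  have "(\<Prod>p\<in>S. - f p + 1) = (\<Sum>D\<in>Pow S. (\<Prod>p\<in>D. - f p) * (\<Prod>p\<in>S-D. 1))"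
    by (rule prod_add[OF assms])
  also have "\<dots> = (\<Sum>D\<in>Pow S. (-1) ^ card D * (\<Prod>p\<in>D. f p))"
    by (simp add: prod_uminus)
  finally show ?thesis by (simp add: algebra_simps)
qed

lemma prod_primes_dvd_iff:
  fixes D :: "nat set" and k :: int
  assumes "finite D" "\<And>p. p \<in> D \<Longrightarrow> prime p"
  shows "int (\<Prod>D) dvd k \<longleftrightarrow> (\<forall>p\<in>D. int p dvd k)"
  using assms
proof (induction D rule: finite_induct)
  case (insert p D)
  have "coprime p (\<Prod>D)" using insert
    by (intro prod_coprime_right) (auto intro!: primes_coprime)
  then have "coprime (int p) (int (\<Prod>D))" by (simp only: coprime_int_iff)
  then have "int p * int (\<Prod>D) dvd k \<longleftrightarrow> int p dvd k \<and> int (\<Prod>D) dvd k"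
    by (metis divides_mult dvd_mult_left dvd_mult_right)
  then show ?case using insert by simp
qed simp

lemma sum_inclusion_exclusion:
  fixes F :: "int \<Rightarrow> 'a::comm_ring_1" and S :: "nat set"
  assumes "finite S" "\<And>p. p \<in> S \<Longrightarrow> prime p" "finite A"
  shows "(\<Sum>k | k \<in> A \<and> (\<forall>p\<in>S. \<not> int p dvd k). F k) = (\<Sum>D\<in>Pow S. (-1) ^ card D * (\<Sum>k | k \<in> A \<and> int (\<Prod>D) dvd k. F k))"
proof -
  have fin: "finite D" if "D \<in> Pow S" for D using that assms(1) finite_subset by auto
  have pr: "(\<Prod>p\<in>D. if int p dvd k then 1 else 0 :: 'a) = (if \<forall>p\<in>D. int p dvd k then 1 else 0)"
    if "finite D" for D and k :: int using that by (induction D rule: finite_induct) auto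
  have ind: "(if \<forall>p\<in>S. \<not> int p dvd k then 1 else 0 :: 'a) = (\<Sum>D\<in>Pow S. (-1) ^ card D * (if int (\<Prod>D) dvd k then 1 else 0))" for k
  proof -
    have "(if \<forall>p\<in>S. \<not> int p dvd k then 1 else 0 :: 'a) = (\<Prod>p\<in>S. 1 - (if int p dvd k then 1 else 0))"
    proof (cases "\<forall>p\<in>S. \<not> int p dvd k")
      case False
      then have "\<exists>p\<in>S. (1 - (if int p dvd k then 1 else 0) :: 'a) = 0" by auto
      then show ?thesis using False prod_zero[OF assms(1)] by (metis (no_types, lifting))
    qed simp
    also have "\<dots> = (\<Sum>D\<in>Pow S. (-1) ^ card D * (\<Prod>p\<in>D. if int p dvd k then 1 else 0))"
      by (rule prod_one_minus[OF assms(1)])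
    also have "\<dots> = (\<Sum>D\<in>Pow S. (-1) ^ card D * (if int (\<Prod>D) dvd k then 1 else 0))"
    proof (intro sum.cong refl)
      fix D assume "D \<in> Pow S"
      then have "int (\<Prod>D) dvd k \<longleftrightarrow> (\<forall>p\<in>D. int p dvd k)"
        using prod_primes_dvd_iff[of D k] fin assms(2) by blast
      then show "(-1) ^ card D * (\<Prod>p\<in>D. if int p dvd k then 1 else 0 :: 'a) = (-1) ^ card D * (if int (\<Prod>D) dvd k then 1 else 0)"
        using pr[OF fin[OF \<open>D \<in> Pow S\<close>], of k] by simp
    qed
    finally show ?thesis .
  qed
  have "(\<Sum>k | k \<in> A \<and> (\<forall>p\<in>S. \<not> int p dvd k). F k) = (\<Sum>k\<in>A. (if \<forall>p\<in>S. \<not> int p dvd k then 1 else 0) * F k)"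
    using assms(3) by (intro sum.mono_neutral_cong_left) auto
  also have "\<dots> = (\<Sum>D\<in>Pow S. (-1) ^ card D * (\<Sum>k\<in>A. (if int (\<Prod>D) dvd k then 1 else 0) * F k))"
    unfolding ind sum_distrib_left sum_distrib_right by (subst sum.swap) (simp add: mult_ac)
  also have "\<dots> = (\<Sum>D\<in>Pow S. (-1) ^ card D * (\<Sum>k | k \<in> A \<and> int (\<Prod>D) dvd k. F k))"
    using assms(3) by (intro sum.cong refl arg_cong2[of _ _ _ _ "(*)"] sum.mono_neutral_cong_right) auto
  finally show ?thesis .
qed

lemma coprime_int_iff_prime_factors:
  assumes "n > 0"
  shows "coprime k (int n) \<longleftrightarrow> (\<forall>p\<in>prime_factors n. \<not> int p dvd k)"
proof
  assume "coprime k (int n)"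
  then show "\<forall>p\<in>prime_factors n. \<not> int p dvd k"
    by (metis coprime_common_divisor in_prime_factors_iff int_dvd_int_iff not_prime_unit prime_nat_int_transfer)
next
  assume *: "\<forall>p\<in>prime_factors n. \<not> int p dvd k"
  show "coprime k (int n)"
  proof (rule ccontr)
    assume "\<not> coprime k (int n)"
    then have "nat (gcd k (int n)) \<noteq> 1" by (metis coprime_iff_gcd_eq_1 gcd_ge_0_int nat_0_le of_nat_1)
    then obtain p where p: "prime p" "p dvd nat (gcd k (int n))" using prime_factor_nat by blast
    then have "int p dvd gcd k (int n)" by (metis gcd_ge_0_int int_dvd_int_iff nat_0_le)
    then have "int p dvd k" "p dvd n" by auto
    then show False using * p assms by (auto simp: in_prime_factors_iff)
  qed
qed

lemma prod_subset_prime_factors_dvd: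
  assumes "D \<subseteq> prime_factors (n::nat)"
  shows "\<Prod>D dvd n" "\<Prod>D > 0"
proof -
  have fin: "finite D" using assms finite_subset by blast
  have "int (\<Prod>D) dvd int n"
    using assms by (subst prod_primes_dvd_iff[OF fin]) (auto simp: in_prime_factors_iff subset_iff)
  then show "\<Prod>D dvd n" by (simp only: int_dvd_int_iff)
  show "\<Prod>D > 0" using fin assms
    by (auto intro!: Nat.gr0I simp: in_prime_factors_iff subset_iff)
qed

text \<open>Mobius inversion. A subset D of the prime factors stands for the squarefree divisor
  \<open>\<Prod>D\<close>, and the sign is its Mobius value.\<close>

lemma sum_coprime_inclusion_exclusion:
  fixes F :: "int \<Rightarrow> 'a::comm_ring_1"
  assumes "n > 0"
  shows "(\<Sum>k | k \<in> {0..<int n} \<and> coprime k (int n). F k) =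
    (\<Sum>D\<in>Pow (prime_factors n). (-1) ^ card D * (\<Sum>j\<in>{0..<int (n div \<Prod>D)}. F (int (\<Prod>D) * j)))"
proof -
  have "(\<Sum>k | k \<in> {0..<int n} \<and> coprime k (int n). F k) =
    (\<Sum>D\<in>Pow (prime_factors n). (-1) ^ card D * (\<Sum>k | k \<in> {0..<int n} \<and> int (\<Prod>D) dvd k. F k))"
    unfolding coprime_int_iff_prime_factors[OF assms]
    by (rule sum_inclusion_exclusion) (auto simp: in_prime_factors_iff)
  also have "\<dots> = (\<Sum>D\<in>Pow (prime_factors n). (-1) ^ card D * (\<Sum>j\<in>{0..<int (n div \<Prod>D)}. F (int (\<Prod>D) * j)))"
  proof (rule sum.cong[OF refl], rule arg_cong2[of _ _ _ _ "(*)"], rule refl)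
    fix D assume "D \<in> Pow (prime_factors n)"
    then have D: "\<Prod>D dvd n" "\<Prod>D > 0" using prod_subset_prime_factors_dvd by auto
    show "(\<Sum>k | k \<in> {0..<int n} \<and> int (\<Prod>D) dvd k. F k) = (\<Sum>j\<in>{0..<int (n div \<Prod>D)}. F (int (\<Prod>D) * j))"
    proof -
      have "(\<Sum>k | k \<in> {0..<int n} \<and> int d dvd k. F k) = (\<Sum>j\<in>{0..<int (n div d)}. F (int d * j))"
        if "d dvd n" "d > 0" for d
        using sum_multiples[of "int d" "int n" F] that by (simp add: zdiv_int)
      then show ?thesis using D by blast
    qed
  qed
  finally show ?thesis .
qed

text \<open>The distribution relation of the second Bernoulli function (Raabe's multiplication
  formula).\<close>

lemma sum_beta2_distribution:
  assumes "n > 0"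
  shows "(\<Sum>j\<in>{0..<int n}. beta2 (\<theta> + of_int j / of_nat n)) = beta2 (of_nat n * \<theta>) / of_nat n"
proof -
  \<comment> \<open>Rotating the summation index by the integer part of n \<theta> leaves the
    arguments (j + t)/n, which already lie in [0, 1), so that \<open>frac\<close>
    disappears.\<close>
  define m where "m = \<lfloor>of_nat n * \<theta>\<rfloor>"
  define t where "t = frac (of_nat n * \<theta>)"
  have t: "0 \<le> t" "t < 1" by (auto simp: t_def frac_lt_1)
  have \<theta>: "\<theta> = (of_int m + t) / of_nat n" using assms by (simp add: m_def t_def frac_def field_simps)
  define F where "F j = beta2 ((of_int j + t) / of_nat n)" for j :: int
  have per: "F (a + int n) = F a" for a
  proof -
    have "(of_int (a + int n) + t) / of_nat n = (of_int a + t) / of_nat n + of_int 1"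
      using assms by (simp add: field_simps)
    then show ?thesis unfolding F_def by (simp only: beta2_add_int)
  qed
  have "(\<Sum>j\<in>{0..<int n}. beta2 (\<theta> + of_int j / of_nat n)) = (\<Sum>j\<in>{0..<int n}. F (1 * j + m))"
    by (intro sum.cong refl) (simp add: F_def \<theta> add_divide_distrib[symmetric] add_ac)
  also have "\<dots> = (\<Sum>j\<in>{0..<int n}. F j)"
    by (rule sum_periodic_affine) (use assms per in auto)
  also have "\<dots> = (\<Sum>j<n. F (int j))"
    by (rule sum.reindex_bij_witness[of _ int nat]) auto
  also have "\<dots> = (\<Sum>j<n. ((of_nat j + t) / of_nat n)^2 - (of_nat j + t) / of_nat n + 1/6)"
  proof (intro sum.cong refl)
    fix j assume "j \<in> {..<n}"
    then have "real j + 1 \<le> real n" by simp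
    then have "frac ((of_nat j + t) / of_nat n) = (of_nat j + t) / of_nat n"
      using t by (subst frac_eq) (auto simp: field_simps)
    then show "F (int j) = ((of_nat j + t) / of_nat n)^2 - (of_nat j + t) / of_nat n + 1/6"
      by (simp add: F_def beta2_def)
  qed
  also have "\<dots> = (t^2 - t + 1/6) / of_nat n"
  proof -
    define N where "N = real n"
    have N: "N \<noteq> 0" using assms by (simp add: N_def)
    \<comment> \<open>The number k of terms is kept apart from N so that induction on k is possible;
      at k = n = N the polynomial collapses.\<close>
    have s: "6 * (\<Sum>j<k. (of_nat j + t)^2 - N * (of_nat j + t) + N^2 / 6) =
       real k * (real k - 1) * (2 * real k - 1) + 6 * t * real k * (real k - 1) + 6 * real k * t^2
         - 3 * N * real k * (real k - 1) - 6 * N * real k * t + real k * N^2" for k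
      by (induction k) (simp_all add: algebra_simps power2_eq_square)
    have "(\<Sum>j<n. ((of_nat j + t) / N)^2 - (of_nat j + t) / N + 1/6)
        = (\<Sum>j<n. (of_nat j + t)^2 - N * (of_nat j + t) + N^2 / 6) / N^2"
      unfolding sum_divide_distrib using N by (intro sum.cong refl) (simp add: field_simps power2_eq_square)
    also have "\<dots> = (6 * (\<Sum>j<n. (of_nat j + t)^2 - N * (of_nat j + t) + N^2 / 6)) / (6 * N^2)" by simp
    also have "\<dots> = (t^2 - t + 1/6) / N"
      unfolding s N_def[symmetric] using N by (simp add: field_simps power2_eq_square)
    finally show ?thesis unfolding N_def .
  qed
  also have "\<dots> = beta2 (of_nat n * \<theta>) / of_nat n" by (simp add: beta2_def t_def)
  finally show ?thesis .
qed

text \<open>Sieving reduces to full residue systems modulo n/d. By the distribution relation at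
  \<theta> = 0 each contributes d/(6n), because the Bernoulli value at 0 is 1/6. The signed sum over
  d is then an Euler product.\<close>

lemma sum_coprime_beta2:
  assumes "n > 0"
  shows "(\<Sum>k | k \<in> {0..<int n} \<and> coprime k (int n). beta2 (of_int k / of_nat n)) = (\<Prod>p\<in>prime_factors n. 1 - real p) / (6 * of_nat n)"
proof -
  have "(\<Sum>k | k \<in> {0..<int n} \<and> coprime k (int n). beta2 (of_int k / of_nat n)) =
    (\<Sum>D\<in>Pow (prime_factors n). (-1) ^ card D * (\<Sum>j\<in>{0..<int (n div \<Prod>D)}. beta2 (of_int (int (\<Prod>D) * j) / of_nat n)))"
    by (rule sum_coprime_inclusion_exclusion[OF assms])
  also have "\<dots> = (\<Sum>D\<in>Pow (prime_factors n). (-1) ^ card D * (real (\<Prod>D) / (6 * of_nat n)))"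
  proof (intro sum.cong refl arg_cong2[of _ _ _ _ "(*)"])
    fix D assume "D \<in> Pow (prime_factors n)"
    then have D: "\<Prod>D dvd n" "\<Prod>D > 0" using prod_subset_prime_factors_dvd by auto
    define k where "k = n div \<Prod>D"
    have n: "n = \<Prod>D * k" and k: "k > 0" using D assms by (auto simp: k_def dvd_div_eq_0_iff intro: Nat.gr0I)
    have "(\<Sum>j\<in>{0..<int k}. beta2 (of_int (int (\<Prod>D) * j) / of_nat n)) = (\<Sum>j\<in>{0..<int k}. beta2 (0 + of_int j / of_nat k))"
    proof (intro sum.cong refl arg_cong[of _ _ beta2])
      fix j :: int
      have "real_of_int (int d * j) / real (d * k) = 0 + real_of_int j / real k" if "d > 0" for d
        using that k by simp
      from this[of "\<Prod>D"] show "real_of_int (int (\<Prod>D) * j) / real n = 0 + real_of_int j / real k"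
        using D(2) n by metis
    qed
    also have "\<dots> = beta2 0 / of_nat k" using sum_beta2_distribution[OF k, of 0] by simp
    also have "\<dots> = real (\<Prod>D) / (6 * of_nat n)"
    proof -
      have "beta2 0 / of_nat k = real d / (6 * of_nat (d * k))" if "d > 0" for d
        using that k by (simp add: beta2_def)
      from this[of "\<Prod>D"] show ?thesis using D(2) n by metis
    qed
    finally show "(\<Sum>j\<in>{0..<int (n div \<Prod>D)}. beta2 (of_int (int (\<Prod>D) * j) / of_nat n)) = real (\<Prod>D) / (6 * of_nat n)"
      by (simp add: k_def)
  qed
  also have "\<dots> = (\<Sum>D\<in>Pow (prime_factors n). (-1) ^ card D * (\<Prod>p\<in>D. real p)) / (6 * of_nat n)"
    by (simp add: sum_divide_distrib)
  also have "\<dots> = (\<Prod>p\<in>prime_factors n. 1 - real p) / (6 * of_nat n)"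
    by (subst prod_one_minus) auto
  finally show ?thesis .
qed

section \<open>Modular invariance of Siegel functions\<close>

text \<open>At z = r \<tau> + s the modulus of the Gaussian factor is exactly the discrepancy
  between the Bernoulli powers of the two sides, up to a quantity free of r and s. At lattice points
  both sides vanish.\<close>

lemma siegel_norm_proportional:
  assumes \<tau>: "Im \<tau> > 0"
  obtains C where "\<And>r s. siegel_norm (- s) r (- 1 / \<tau>) = C * siegel_norm r s \<tau>"
proof -
  define \<sigma> where "\<sigma> = - 1 / \<tau>"
  have \<tau>0: "\<tau> \<noteq> 0" using \<tau> by auto
  have \<sigma>: "Im \<sigma> > 0" using \<tau> unfolding \<sigma>_def by (auto simp: Im_divide sum_power2_gt_zero_iff)
  obtain c where c: "\<And>z. (\<And>m n. z \<noteq> of_int m * \<tau> + of_int n) \<Longrightarrow>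
     theta (q_of (z / \<tau>)) (q_of \<sigma>) * exp (\<i> * pi * (- (z^2) / \<tau> + z - z / \<tau>)) = c * theta (q_of z) (q_of \<tau>)"
    using theta_ratio_constant[OF \<tau>] unfolding \<sigma>_def by blast
  define C where "C = norm c * exp (pi * (Im \<tau> - Im \<sigma>) / 6)"
  have "siegel_norm (- s) r \<sigma> = C * siegel_norm r s \<tau>" for r s
  proof (cases "r \<in> \<int> \<and> s \<in> \<int>")
    case True
    then show ?thesis by (simp add: siegel_norm_int \<tau> \<sigma>)
  next
    case False
    define z where "z = of_real r * \<tau> + of_real s"
    have "z \<noteq> of_int m * \<tau> + of_int n" for m n
    proof
      assume *: "z = of_int m * \<tau> + of_int n"
      then have "Im z = Im (of_int m * \<tau> + of_int n)" by (rule arg_cong)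
      then have r: "r = of_int m" using \<tau> by (simp add: z_def)
      have "Re z = Re (of_int m * \<tau> + of_int n)" using * by (rule arg_cong)
      then have "s = of_int n" using r by (simp add: z_def)
      then show False using r False by simp
    qed
    then have "norm (theta (q_of (z / \<tau>)) (q_of \<sigma>) * exp (\<i> * pi * (- (z^2) / \<tau> + z - z / \<tau>))) = norm (c * theta (q_of z) (q_of \<tau>))"
      using c by simp
    \<comment> \<open>With \<sigma> = -1/\<tau> one has z/\<tau> = r - s \<sigma> and z^2/\<tau> =
      r^2 \<tau> + 2rs - s^2 \<sigma>, so the imaginary part is linear in Im \<tau> and Im
      \<sigma>.\<close>
    moreover have "Re (\<i> * pi * (- (z^2) / \<tau> + z - z / \<tau>)) = pi * Im \<tau> * (r^2 - r) - pi * Im \<sigma> * (s^2 + s)"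
    proof -
      have zt: "z / \<tau> = of_real r - of_real s * \<sigma>" using \<tau>0 by (simp add: z_def \<sigma>_def field_simps)
      have "z^2 / \<tau> = (z / \<tau>) * z" by (simp add: power2_eq_square)
      also have "\<dots> = of_real (r^2) * \<tau> + of_real (2 * r * s) - of_real (s^2) * \<sigma>"
        using \<tau>0 unfolding z_def \<sigma>_def by (simp add: field_simps power2_eq_square)
      finally have "- (z^2) / \<tau> + z - z / \<tau> = - (of_real (r^2) * \<tau> + of_real (2 * r * s) - of_real (s^2) * \<sigma>) + z - (of_real r - of_real s * \<sigma>)"
        unfolding zt by simp
      then have "Im (- (z^2) / \<tau> + z - z / \<tau>)
          = Im (- (of_real (r^2) * \<tau> + of_real (2 * r * s) - of_real (s^2) * \<sigma>) + z - (of_real r - of_real s * \<sigma>))"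
        by (rule arg_cong)
      then have *: "Im (- (z^2) / \<tau> + z - z / \<tau>) = - (r^2 * Im \<tau> - s^2 * Im \<sigma>) + r * Im \<tau> + s * Im \<sigma>"
        by (simp add: z_def)
      have "Re (\<i> * pi * w) = - pi * Im w" for w :: complex by simp
      from this[of "- (z^2) / \<tau> + z - z / \<tau>"] show ?thesis
        unfolding * by (simp only:) (simp add: algebra_simps)
    qed
    ultimately have 1: "norm (theta (q_of (z / \<tau>)) (q_of \<sigma>)) * exp (pi * Im \<tau> * (r^2 - r) - pi * Im \<sigma> * (s^2 + s))
        = norm c * norm (theta (q_of z) (q_of \<tau>))"
      by (simp only: norm_mult norm_exp_eq_Re)
    have 2: "z / \<tau> = of_real (- s) * \<sigma> + of_real r" using \<tau>0 by (simp add: z_def \<sigma>_def field_simps)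
    have "siegel_norm (- s) r \<sigma> = norm (theta (q_of (z / \<tau>)) (q_of \<sigma>)) * exp (- pi * Im \<sigma> * ((-s)^2 - (-s) + 1/6))"
      unfolding siegel_norm_def 2 by simp
    also have "exp (- pi * Im \<sigma> * ((-s)^2 - (-s) + 1/6)) = exp (pi * Im \<tau> * (r^2 - r) - pi * Im \<sigma> * (s^2 + s)) *
       (exp (pi * (Im \<tau> - Im \<sigma>) / 6) * exp (- pi * Im \<tau> * (r^2 - r + 1/6)))"
      unfolding exp_add[symmetric] by (simp add: algebra_simps add_divide_distrib diff_divide_distrib)
    also have "norm (theta (q_of (z / \<tau>)) (q_of \<sigma>)) * \<dots> =
       (norm (theta (q_of (z / \<tau>)) (q_of \<sigma>)) * exp (pi * Im \<tau> * (r^2 - r) - pi * Im \<sigma> * (s^2 + s))) *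
       (exp (pi * (Im \<tau> - Im \<sigma>) / 6) * exp (- pi * Im \<tau> * (r^2 - r + 1/6)))"
      by (simp only: mult.assoc)
    also have "\<dots> = C * siegel_norm r s \<tau>"
      unfolding 1 unfolding C_def siegel_norm_def z_def by (simp only: mult_ac)
    finally show ?thesis .
  qed
  then show ?thesis using that unfolding \<sigma>_def by blast
qed

text \<open>Modulo integers the inversion permutes the three half periods, so comparing the products
  over them at \<tau> and -1/\<tau> gives C^3 = 1, and C is real.\<close>

lemma siegel_norm_inversion:
  assumes \<tau>: "Im \<tau> > 0"
  shows "siegel_norm (- s) r (- 1 / \<tau>) = siegel_norm r s \<tau>"
proof -
  define \<sigma> where "\<sigma> = - 1 / \<tau>"
  have \<sigma>: "Im \<sigma> > 0" using \<tau> unfolding \<sigma>_def by (auto simp: Im_divide sum_power2_gt_zero_iff)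
  obtain C where C: "\<And>r s. siegel_norm (- s) r \<sigma> = C * siegel_norm r s \<tau>"
    using siegel_norm_proportional[OF \<tau>] unfolding \<sigma>_def by blast
  have p1: "siegel_norm 0 (1/2) \<sigma> = C * siegel_norm (1/2) 0 \<tau>" using C[of 0 "1/2"] by simp
  have p2: "siegel_norm (1/2) 0 \<sigma> = C * siegel_norm 0 (1/2) \<tau>"
    using C[of "1/2" 0] siegel_norm_add_int[OF \<sigma>, of "-1/2" 1 0 0] by simp
  have p3: "siegel_norm (1/2) (1/2) \<sigma> = C * siegel_norm (1/2) (1/2) \<tau>"
    using C[of "1/2" "1/2"] siegel_norm_add_int[OF \<sigma>, of "-1/2" 1 "1/2" 0] by simp
  have "siegel_norm (1/2) 0 \<sigma> * siegel_norm 0 (1/2) \<sigma> * siegel_norm (1/2) (1/2) \<sigma>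
      = C ^ 3 * (siegel_norm (1/2) 0 \<tau> * siegel_norm 0 (1/2) \<tau> * siegel_norm (1/2) (1/2) \<tau>)"
    unfolding p1 p2 p3 by (simp only: power3_eq_cube mult_ac)
  then have "2 = C ^ 3 * 2"
    unfolding siegel_norm_half_periods[OF \<tau>] siegel_norm_half_periods[OF \<sigma>] .
  then have "C ^ 3 = 1" by simp
  then have "C = 1"
    using power_eq_1_iff[of C 3] by (auto simp: abs_if power3_eq_cube split: if_splits)
  then show ?thesis using C unfolding \<sigma>_def by simp
qed

text \<open>Euclid's algorithm on the bottom row reduces the claim to inversion and translations.\<close>

lemma siegel_norm_modular:
  fixes a b c d :: int
  assumes "a * d - b * c = 1" "Im \<tau> > 0"
  shows "siegel_norm r s ((of_int a * \<tau> + of_int b) / (of_int c * \<tau> + of_int d))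
       = siegel_norm (r * of_int a + s * of_int c) (r * of_int b + s * of_int d) \<tau>"
  using assms
proof (induction "nat \<bar>c\<bar>" arbitrary: a b c d r s \<tau> rule: less_induct)
  case less
  show ?case
  proof (cases "c = 0")
    case True
    then have "a = 1 \<and> d = 1 \<or> a = -1 \<and> d = -1" using less.prems(1) by (simp add: zmult_eq_1_iff)
    then show ?thesis
    proof (elim disjE conjE)
      assume "a = 1" "d = 1"
      then show ?thesis using True siegel_norm_translate[of r s \<tau> b] by (simp add: add_ac)
    next
      assume "a = -1" "d = -1"
      then show ?thesis
        using True siegel_norm_translate[of r s \<tau> "- b"] siegel_norm_minus[OF less.prems(2), of r "s - r * of_int b"]
        by (simp add: algebra_simps)
    qed
  next
    case False
    define n where "n = d div c"
    define d' where "d' = d - n * c"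
    define b' where "b' = b - n * a"
    define \<tau>' where "\<tau>' = \<tau> + of_int n"
    define \<sigma> where "\<sigma> = - 1 / \<tau>'"
    have \<tau>': "Im \<tau>' > 0" using less.prems by (simp add: \<tau>'_def)
    then have \<tau>'0: "\<tau>' \<noteq> 0" by auto
    have \<sigma>: "Im \<sigma> > 0" using \<tau>' unfolding \<sigma>_def by (auto simp: Im_divide sum_power2_gt_zero_iff)
    \<comment> \<open>Writing the given matrix as another one followed on the right by the inversion
      and a translation by n makes -d' the new lower left entry, a remainder modulo c.\<close>
    have "d' = d mod c" by (simp add: d'_def n_def minus_div_mult_eq_mod)
    then have lt: "nat \<bar>- d'\<bar> < nat \<bar>c\<bar>" using False abs_mod_less[of c d] by simp
    have det: "(- b') * c - a * (- d') = 1" using less.prems(1) by (simp add: b'_def d'_def algebra_simps)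
    have "(of_int (- b') * \<sigma> + of_int a) / (of_int (- d') * \<sigma> + of_int c)
        = ((of_int a * \<tau>' + of_int b') / \<tau>') / ((of_int c * \<tau>' + of_int d') / \<tau>')"
      using \<tau>'0 by (simp add: \<sigma>_def field_simps)
    also have "\<dots> = (of_int a * \<tau>' + of_int b') / (of_int c * \<tau>' + of_int d')"
      using \<tau>'0 by simp
    also have "\<dots> = (of_int a * \<tau> + of_int b) / (of_int c * \<tau> + of_int d)"
      by (simp add: \<tau>'_def b'_def d'_def algebra_simps)
    finally have "siegel_norm r s ((of_int a * \<tau> + of_int b) / (of_int c * \<tau> + of_int d)) =
       siegel_norm r s ((of_int (- b') * \<sigma> + of_int a) / (of_int (- d') * \<sigma> + of_int c))" by simp
    also have "\<dots> = siegel_norm (r * of_int (- b') + s * of_int (- d')) (r * of_int a + s * of_int c) \<sigma>"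
      by (rule less.hyps[OF lt det \<sigma>])
    also have "\<dots> = siegel_norm (- (r * of_int b' + s * of_int d')) (r * of_int a + s * of_int c) (- 1 / \<tau>')"
      by (simp add: \<sigma>_def algebra_simps)
    also have "\<dots> = siegel_norm (r * of_int a + s * of_int c) (r * of_int b' + s * of_int d') \<tau>'"
      by (rule siegel_norm_inversion[OF \<tau>'])
    also have "\<dots> = siegel_norm (r * of_int a + s * of_int c) (r * of_int b + s * of_int d) \<tau>"
      unfolding \<tau>'_def siegel_norm_translate by (simp add: b'_def d'_def algebra_simps)
    finally show ?thesis .
  qed
qed

text \<open>The limit Im \<tau> \<rightarrow> \<infinity>, uniform in the real part. This uniformity
  is what later bounds a function on a punctured neighbourhood of q = 0.\<close>

abbreviation at_ioo :: "complex filter" where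
  "at_ioo \<equiv> filtercomap Im at_top"

lemma qpoch_tendsto_1:
  assumes "(q \<longlongrightarrow> 0) F" "(w \<longlongrightarrow> 0) F"
  shows "((\<lambda>x. qpoch (w x) (q x)) \<longlongrightarrow> 1) F"
proof (rule LIM_zero_cancel, rule Lim_null_comparison)
  have "\<forall>\<^sub>F x in F. norm (q x) < 1" using order_tendstoD(2)[OF tendsto_norm_zero[OF assms(1)], of 1] by simp
  then show "\<forall>\<^sub>F x in F. norm (qpoch (w x) (q x) - 1) \<le> exp (norm (w x) / (1 - norm (q x))) - 1"
    by eventually_elim (rule norm_qpoch_minus_1_le)
  have "((\<lambda>x. exp (norm (w x) / (1 - norm (q x))) - 1) \<longlongrightarrow> exp (0 / (1 - 0)) - 1) F"
    by (intro tendsto_intros tendsto_norm_zero assms) auto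
  then show "((\<lambda>x. exp (norm (w x) / (1 - norm (q x))) - 1) \<longlongrightarrow> 0) F" by simp
qed

lemma tendsto_q_of_0:
  assumes "c > 0"
  shows "((\<lambda>\<tau>. q_of (of_real c * \<tau> + of_real s)) \<longlongrightarrow> 0) at_ioo"
proof (rule tendsto_norm_zero_cancel)
  have "filterlim (\<lambda>\<tau>. - (2 * pi * c * Im \<tau>)) at_bot at_ioo"
    using assms by (intro filterlim_uminus_at_bot_at_top[THEN filterlim_compose]
      filterlim_tendsto_pos_mult_at_top[OF tendsto_const] filterlim_filtercomap) auto
  then have "((\<lambda>\<tau>. exp (- (2 * pi * c * Im \<tau>))) \<longlongrightarrow> 0) at_ioo"
    by (rule filterlim_compose[OF exp_at_bot])
  then show "((\<lambda>\<tau>. norm (q_of (of_real c * \<tau> + of_real s))) \<longlongrightarrow> 0) at_ioo"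
    by (simp add: norm_q_of mult_ac)
qed

lemma eventually_Im_gt: "\<forall>\<^sub>F \<tau> in at_ioo. Im \<tau> > c"
  using eventually_gt_at_top[of c] unfolding eventually_filtercomap by blast

text \<open>After reducing r to its fractional part t, all factors of theta tend to 1 except 1 - w
  when t = 0. That one stays equal to 1 - exp(2 \<pi> i s), which is nonzero since s is then not an
  integer.\<close>

lemma siegel_norm_asymp:
  assumes "\<not> (r \<in> \<int> \<and> s \<in> \<int>)"
  obtains L where "L > 0" "((\<lambda>\<tau>. siegel_norm r s \<tau> * exp (pi * Im \<tau> * beta2 r)) \<longlongrightarrow> L) at_ioo"
proof -
  define t where "t = frac r"
  have t: "0 \<le> t" "t < 1" by (auto simp: t_def frac_lt_1)
  have r: "t + of_int \<lfloor>r\<rfloor> = r" by (simp add: t_def frac_def)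
  have eq: "siegel_norm r s \<tau> * exp (pi * Im \<tau> * beta2 r) = norm (theta (q_of (of_real t * \<tau> + of_real s)) (q_of \<tau>))"
    if "Im \<tau> > 0" for \<tau>
  proof -
    have "siegel_norm r s \<tau> = siegel_norm t s \<tau>"
      using siegel_norm_add_int[OF that, of t "\<lfloor>r\<rfloor>" s 0] r by simp
    then show ?thesis
      unfolding siegel_norm_def beta2_def t_def[symmetric] by (simp add: exp_minus)
  qed
  define L where "L = (if t = 0 then norm (1 - q_of (of_real s)) else 1)"
  have q0: "(q_of \<longlongrightarrow> 0) at_ioo" using tendsto_q_of_0[of 1 0] by simp
  have l1: "((\<lambda>\<tau>. qpoch (q_of (of_real t * \<tau> + of_real s) * q_of \<tau>) (q_of \<tau>)) \<longlongrightarrow> 1) at_ioo"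
  proof (rule qpoch_tendsto_1[OF q0])
    show "((\<lambda>\<tau>. q_of (of_real t * \<tau> + of_real s) * q_of \<tau>) \<longlongrightarrow> 0) at_ioo"
      using tendsto_q_of_0[of "1 + t" s] t by (simp add: q_of_add[symmetric] algebra_simps)
  qed
  have l2: "((\<lambda>\<tau>. qpoch (q_of \<tau> / q_of (of_real t * \<tau> + of_real s)) (q_of \<tau>)) \<longlongrightarrow> 1) at_ioo"
  proof (rule qpoch_tendsto_1[OF q0])
    show "((\<lambda>\<tau>. q_of \<tau> / q_of (of_real t * \<tau> + of_real s)) \<longlongrightarrow> 0) at_ioo"
      using tendsto_q_of_0[of "1 - t" "-s"] t by (simp add: q_of_diff[symmetric] algebra_simps)
  qed
  have l3: "((\<lambda>\<tau>. norm (1 - q_of (of_real t * \<tau> + of_real s))) \<longlongrightarrow> L) at_ioo"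
  proof (cases "t = 0")
    case False
    then have "((\<lambda>\<tau>. norm (1 - q_of (of_real t * \<tau> + of_real s))) \<longlongrightarrow> norm (1 - (0::complex))) at_ioo"
      using t by (intro tendsto_intros tendsto_q_of_0) auto
    then show ?thesis using False by (simp add: L_def)
  qed (simp add: L_def)
  have "((\<lambda>\<tau>. norm (theta (q_of (of_real t * \<tau> + of_real s)) (q_of \<tau>))) \<longlongrightarrow> L * norm (1 * (1::complex))) at_ioo"
  proof (rule Lim_transform_eventually)
    show "((\<lambda>\<tau>. norm (1 - q_of (of_real t * \<tau> + of_real s)) * norm (qpoch (q_of (of_real t * \<tau> + of_real s) * q_of \<tau>) (q_of \<tau>)
       * qpoch (q_of \<tau> / q_of (of_real t * \<tau> + of_real s)) (q_of \<tau>))) \<longlongrightarrow> L * norm (1 * (1::complex))) at_ioo"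
      by (intro tendsto_mult tendsto_norm l1 l2 l3)
    show "\<forall>\<^sub>F \<tau> in at_ioo. norm (1 - q_of (of_real t * \<tau> + of_real s)) * norm (qpoch (q_of (of_real t * \<tau> + of_real s) * q_of \<tau>) (q_of \<tau>)
       * qpoch (q_of \<tau> / q_of (of_real t * \<tau> + of_real s)) (q_of \<tau>)) = norm (theta (q_of (of_real t * \<tau> + of_real s)) (q_of \<tau>))"
      using eventually_Im_gt[of 0] by eventually_elim (simp add: theta_factor norm_q_of_less_1 norm_mult)
  qed
  then have "((\<lambda>\<tau>. siegel_norm r s \<tau> * exp (pi * Im \<tau> * beta2 r)) \<longlongrightarrow> L) at_ioo"
    unfolding norm_one mult_1_right
  proof (rule Lim_transform_eventually)
    show "\<forall>\<^sub>F \<tau> in at_ioo. norm (theta (q_of (of_real t * \<tau> + of_real s)) (q_of \<tau>)) = siegel_norm r s \<tau> * exp (pi * Im \<tau> * beta2 r)"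
      using eventually_Im_gt[of 0] by eventually_elim (simp add: eq)
  qed
  moreover have "L > 0"
  proof (cases "t = 0")
    case True
    then have "r \<in> \<int>" by (simp add: t_def frac_eq_0_iff)
    then have "s \<notin> \<int>" using assms by simp
    then have "complex_of_real s \<notin> \<int>" by (simp only: of_real_in_Ints_iff not_False_eq_True)
    then show ?thesis using True by (simp add: L_def q_of_eq_1_iff eq_commute[of 1])
  qed (simp add: L_def)
  ultimately show ?thesis using that by blast
qed

section \<open>Gauss sums\<close>

lemma sum_roots_of_unity:
  assumes "n > 0"
  shows "(\<Sum>j\<in>{0..<int n}. q_of (of_int (j * c) / of_nat n)) = (if int n dvd c then of_nat n else 0)"
proof -
  define z where "z = q_of (of_int c / of_nat n)"
  have "(\<Sum>j\<in>{0..<int n}. q_of (of_int (j * c) / of_nat n)) = (\<Sum>j<n. z ^ j)"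
    by (rule sum.reindex_bij_witness[of _ int nat]) (auto simp: z_def q_of_power)
  moreover have "z = 1 \<longleftrightarrow> int n dvd c"
  proof -
    have "z = 1 \<longleftrightarrow> (of_int c / of_nat n :: complex) \<in> \<int>" by (simp add: z_def q_of_eq_1_iff)
    also have "\<dots> \<longleftrightarrow> int n dvd c"
    proof
      assume "(of_int c / of_nat n :: complex) \<in> \<int>"
      then obtain k where "(of_int c / of_nat n :: complex) = of_int k" by (auto elim: Ints_cases)
      then have "(of_int c :: complex) = of_int (k * int n)" using assms by (simp add: field_simps)
      then have "c = k * int n" by (simp only: of_int_eq_iff)
      then show "int n dvd c" by simp
    next
      assume "int n dvd c"
      then obtain k where "c = int n * k" by blast
      then show "(of_int c / of_nat n :: complex) \<in> \<int>" using assms by simp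
    qed
    finally show ?thesis .
  qed
  moreover have "z ^ n = 1" using assms by (simp add: z_def q_of_power)
  ultimately show ?thesis by (auto simp: sum_gp_strict)
qed

lemma sum_coprime_indicator:
  assumes "n > 0"
  shows "(\<Sum>k\<in>{0..<int n}. of_bool (coprime k (int n))) = (of_nat (totient n) :: 'a::comm_semiring_1)"
proof -
  have "(\<Sum>k\<in>{0..<int n}. of_bool (coprime k (int n)) :: 'a) = (\<Sum>k\<in>{0<..n}. of_bool (coprime k n))"
  proof (rule sum.reindex_bij_witness[where i = "\<lambda>k. int n - int k" and j = "\<lambda>k. n - nat k"])
    fix k assume k: "k \<in> {0..<int n}"
    have *: "int (n - nat k) = - k + int n" using k by auto
    have "coprime (n - nat k) n \<longleftrightarrow> coprime (- k + int n) (int n)"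
      unfolding *[symmetric] coprime_int_iff ..
    also have "\<dots> \<longleftrightarrow> coprime (-k) (int n)" by (metis coprime_add_one_left coprime_iff_gcd_eq_1 gcd_add1)
    finally show "of_bool (coprime (n - nat k) n) = (of_bool (coprime k (int n)) :: 'a)" by simp
  qed auto
  also have "\<dots> = (\<Sum>k\<in>totatives n. 1)"
    unfolding totatives_def by (intro sum.mono_neutral_cong_right) auto
  finally show ?thesis by (simp add: totient_def)
qed

text \<open>Only the primes dividing the modulus of \<chi> matter, so uP can take the place of N.
  The character has integer values because they serve as exponents of \<open>powi\<close>. The last
  assumption is primitivity: no proper divisor of u is an induced modulus.\<close>

locale real_primitive_character =
  fixes u P :: nat and \<psi> :: "int \<Rightarrow> int"
  assumes u_pos: "u > 0" and P_pos: "P > 0" and squarefree_P: "squarefree P"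
    and coprime_uP: "coprime u P" and uP_gt_1: "u * P > 1"
    and psi_mult: "\<psi> (a * b) = \<psi> a * \<psi> b"
    and psi_per: "\<psi> (a + int u) = \<psi> a"
    and psi_0_iff: "\<psi> a = 0 \<longleftrightarrow> \<not> coprime a (int u)"
    and psi_vals: "\<psi> a \<in> {-1, 0, 1}"
    and psi_prim: "d dvd u \<Longrightarrow> d < u \<Longrightarrow> \<exists>t. coprime t (int u) \<and> [t = 1] (mod int d) \<and> \<psi> t \<noteq> 1"
begin

definition chi :: "int \<Rightarrow> int" where
  "chi b = (if coprime b (int P) then \<psi> b else 0)"

lemma psi_square: "coprime a (int u) \<Longrightarrow> \<psi> a * \<psi> a = 1"
  using psi_vals[of a] psi_0_iff[of a] by auto

lemma psi_1 [simp]: "\<psi> 1 = 1"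
  using psi_mult[of 1 1] psi_0_iff[of 1] by simp

lemma psi_cong: "[a = b] (mod int u) \<Longrightarrow> \<psi> a = \<psi> b"
  by (rule periodic_cong[of \<psi> "int u"]) (simp_all add: psi_per)

lemma psi_add_mult: "\<psi> (a + int u * k) = \<psi> a"
  using periodic_mod(2)[of \<psi> "int u", OF psi_per] .

text \<open>Primitivity supplies a t that is 1 modulo d, hence preserves F, but has \<psi>(t)
  different from 1.\<close>

lemma psi_vanish:
  fixes F :: "int \<Rightarrow> 'a::{idom,ring_char_0}"
  assumes "d dvd u" "d < u" and per: "\<And>a. F (a + int d) = F a"
  shows "(\<Sum>a\<in>{0..<int u}. of_int (\<psi> a) * F a) = 0"
proof -
  obtain t where t: "coprime t (int u)" "[t = 1] (mod int d)" "\<psi> t \<noteq> 1"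
    using psi_prim[OF assms(1,2)] by blast
  obtain m where m: "u = d * m" using assms(1) by blast
  show ?thesis
  proof (rule sum_twist_vanish[of _ t])
    show "F (t * a) = F a" for a
      using cong_scalar_right[OF t(2), of a] by (intro periodic_cong[of F "int d", OF per]) simp
    show "F (a + int u) = F a" for a
      using periodic_mod(2)[of F "int d", OF per, of a "int m"] by (simp add: m)
  qed (use t u_pos in \<open>auto simp: psi_mult psi_per\<close>)
qed

lemma chi_mult: "chi (a * b) = chi a * chi b"
  by (simp add: chi_def psi_mult)

lemma chi_per: "chi (a + int (u * P)) = chi a"
proof -
  have "coprime (a + int (u * P)) (int P) \<longleftrightarrow> coprime a (int P)"
    by (metis coprime_iff_gcd_eq_1 gcd_add_mult gcd.commute of_nat_mult add.commute)
  then show ?thesis using psi_add_mult[of a "int P"] by (simp add: chi_def)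
qed

lemma chi_0_iff: "chi a = 0 \<longleftrightarrow> \<not> coprime a (int (u * P))"
  by (simp add: chi_def psi_0_iff)

lemma chi_vals: "chi a \<in> {-1, 0, 1}"
  using psi_vals[of a] by (simp add: chi_def)

lemma chi_0 [simp]: "chi 0 = 0"
  unfolding chi_0_iff using uP_gt_1 by (auto simp del: of_nat_mult)

text \<open>Here \<open>chi\<close> is imprimitive at the primes of P, so primitivity of
  \<open>\<psi>\<close> can be used only at the part x1 of x that divides u. The Chinese remainder
  theorem lifts the twisting unit to one that is 1 modulo P and therefore also modulo x2.\<close>

lemma chi_vanish:
  fixes F :: "int \<Rightarrow> 'a::{idom,ring_char_0}"
  assumes "x dvd u * P" "\<not> u dvd x" and per: "\<And>a. F (a + int x) = F a"
  shows "(\<Sum>b\<in>{0..<int (u * P)}. of_int (chi b) * F b) = 0"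
proof -
  obtain x1 x2 where x: "x = x1 * x2" "x1 dvd u" "x2 dvd P" using division_decomp[OF assms(1)] by blast
  have "x1 < u" using x assms(2) u_pos by (metis dvd_imp_le dvd_triv_left le_neq_implies_less)
  then obtain t0 where t0: "coprime t0 (int u)" "[t0 = 1] (mod int x1)" "\<psi> t0 \<noteq> 1"
    using psi_prim[of x1] x by blast
  obtain t where t: "[t = t0] (mod int u)" "[t = 1] (mod int P)"
    using binary_chinese_remainder_int[of "int u" "int P" t0 1] coprime_uP by auto
  have cu: "coprime t (int u)" using t(1) t0(1) cong_imp_coprime cong_sym by blast
  have cP: "coprime t (int P)" using t(2) cong_imp_coprime[of 1 t "int P"] cong_sym by auto
  have "[t = 1] (mod int x1)"
    using cong_trans[OF cong_dvd_modulus[OF t(1), of "int x1"] t0(2)] x by simp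
  moreover have "[t = 1] (mod int x2)" using cong_dvd_modulus[OF t(2), of "int x2"] x by simp
  moreover have "coprime (int x1) (int x2)" using coprime_uP x by (simp add: coprime_divisors)
  ultimately have tx: "[t = 1] (mod int x)" unfolding x(1) of_nat_mult by (intro coprime_cong_mult)
  obtain m where m: "u * P = x * m" using assms(1) by blast
  show ?thesis
  proof (rule sum_twist_vanish[of _ t])
    show "F (t * a) = F a" for a
      using cong_scalar_right[OF tx, of a] by (intro periodic_cong[of F "int x", OF per]) simp
    show "F (a + int (u * P)) = F a" for a
      using periodic_mod(2)[of F "int x", OF per, of a "int m"] by (simp add: m)
    show "(of_int (chi (a + int (u * P))) :: 'a) = of_int (chi a)" for a unfolding chi_per ..
    show "(of_int (chi t) :: 'a) \<noteq> 1" using psi_cong[OF t(1)] t0(3) cP by (simp add: chi_def)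
    show "coprime t (int (u * P))" using cu cP by simp
  qed (use uP_gt_1 u_pos P_pos in \<open>auto simp: chi_mult\<close>)
qed

definition ee :: "int \<Rightarrow> complex" where
  "ee k = q_of (of_int k / of_nat u)"

definition gauss :: complex where
  "gauss = (\<Sum>a\<in>{0..<int u}. of_int (\<psi> a) * ee a)"

lemma ee_add: "ee (a + b) = ee a * ee b"
  by (simp add: ee_def add_divide_distrib q_of_add)

lemma ee_mult_u [simp]: "ee (int u * k) = 1"
  using u_pos by (simp add: ee_def)

lemma ee_sum: "(\<Sum>k\<in>{0..<int u}. ee (k * c)) = (if int u dvd c then of_nat u else 0)"
  unfolding ee_def by (rule sum_roots_of_unity[OF u_pos])

text \<open>For k prime to u this is a change of variable. Otherwise the additive character has
  period a proper divisor of u and primitivity kills the sum, matching \<psi>(k) = 0.\<close>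

lemma gauss_separable: "(\<Sum>a\<in>{0..<int u}. of_int (\<psi> a) * ee (a * k)) = of_int (\<psi> k) * gauss"
proof (cases "coprime k (int u)")
  case True
  have "(\<Sum>a\<in>{0..<int u}. of_int (\<psi> (k * a)) * ee (k * a)) = gauss"
    unfolding gauss_def
    using sum_periodic_affine[of "int u" k "\<lambda>a. of_int (\<psi> a) * ee a" 0] True u_pos ee_mult_u[of 1]
    by (simp add: psi_per ee_add)
  then have "of_int (\<psi> k) * (\<Sum>a\<in>{0..<int u}. of_int (\<psi> a) * ee (a * k)) = gauss"
    by (simp add: psi_mult sum_distrib_left mult_ac)
  moreover have "(of_int (\<psi> k) * of_int (\<psi> k) :: complex) = 1"
    using psi_square[OF True] by (metis of_int_1 of_int_mult)
  ultimately show ?thesis by (metis mult.assoc mult_1)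
next
  case False
  define v where "v = gcd k (int u)"
  have v: "v > 0" "v \<noteq> 1" using False u_pos by (auto simp: v_def coprime_iff_gcd_eq_1)
  define d where "d = nat (int u div v)"
  have uv: "int u = int d * v" using v u_pos by (simp add: d_def v_def pos_imp_zdiv_nonneg_iff)
  obtain k' where k': "k = v * k'" using v_def by (metis dvdE gcd_dvd1)
  have "int d dvd int u" using uv by simp
  then have "d dvd u" by simp
  moreover have "d < u"
  proof -
    have "int d * 1 < int d * v" using v uv u_pos by (intro mult_strict_left_mono) (auto intro!: Nat.gr0I)
    then show ?thesis using uv by simp
  qed
  ultimately have "(\<Sum>a\<in>{0..<int u}. of_int (\<psi> a) * ee (a * k)) = 0"
  proof (rule psi_vanish)
    fix a
    have "(a + int d) * k = a * k + int u * k'" by (simp add: k' uv algebra_simps)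
    then show "ee ((a + int d) * k) = ee (a * k)" by (simp add: ee_add)
  qed
  then show ?thesis using False by (simp add: psi_0_iff)
qed

text \<open>Fourier inversion: the transform of \<open>\<psi>\<close> is \<open>gauss\<close> times
  \<open>\<psi>\<close>, and transforming again recovers u times the value at 1. The purpose is that
  \<open>gauss\<close> is nonzero.\<close>

lemma gauss_square: "of_int (\<psi> (-1)) * gauss * gauss = of_nat u"
proof -
  have "(\<Sum>k\<in>{0..<int u}. (\<Sum>a\<in>{0..<int u}. of_int (\<psi> a) * ee (a * k)) * ee (- k))
      = (\<Sum>a\<in>{0..<int u}. of_int (\<psi> a) * (\<Sum>k\<in>{0..<int u}. ee (k * (a - 1))))"
    unfolding sum_distrib_left sum_distrib_right
    by (subst sum.swap) (simp add: ee_add[symmetric] mult.assoc algebra_simps)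
  also have "\<dots> = (\<Sum>a\<in>{0..<int u}. if [a = 1] (mod int u) then of_int (\<psi> a) * of_nat u else 0)"
    unfolding ee_sum by (intro sum.cong refl) (auto simp: cong_iff_dvd_diff)
  also have "\<dots> = (\<Sum>a\<in>{1 mod int u}. of_int (\<psi> a) * of_nat u)"
    using u_pos by (intro sum.mono_neutral_cong_right) (auto simp: cong_def)
  also have "\<dots> = of_nat u" using periodic_mod(1)[of \<psi> "int u", OF psi_per, of 1] by simp
  finally have "of_nat u = (\<Sum>k\<in>{0..<int u}. of_int (\<psi> k) * gauss * ee (- k))"
    by (simp only: gauss_separable)
  also have "\<dots> = gauss * (\<Sum>k\<in>{0..<int u}. of_int (\<psi> k) * ee (k * (- 1)))"
    by (simp add: sum_distrib_left mult_ac)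
  also have "\<dots> = of_int (\<psi> (-1)) * gauss * gauss" unfolding gauss_separable by simp
  finally show ?thesis ..
qed

lemma gauss_nonzero: "gauss \<noteq> 0"
  using gauss_square u_pos by auto

lemma psi_minus_1: "\<psi> (-1) * \<psi> (-1) = 1"
  by (rule psi_square) simp

text \<open>Convolution squares the Fourier transform. As \<open>\<psi>\<close> is real, the square
  of \<psi>(k) is the indicator of the units, so the self-convolution is \<psi>(-1) times the
  Ramanujan sum modulo u.\<close>

lemma autocorrelation:
  "(of_int (\<Sum>a\<in>{0..<int u}. \<psi> a * \<psi> (c - a)) :: complex) =
     of_int (\<psi> (-1)) * (\<Sum>k | k \<in> {0..<int u} \<and> coprime k (int u). ee (k * c))"
proof -
  have "of_int (\<Sum>a\<in>{0..<int u}. \<psi> a * \<psi> (c - a)) * gauss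
     = (\<Sum>a\<in>{0..<int u}. of_int (\<psi> a) * (of_int (\<psi> (c - a)) * gauss))"
    by (simp add: sum_distrib_right mult.assoc)
  also have "\<dots> = (\<Sum>k\<in>{0..<int u}. of_int (\<psi> k) * ee (k * c) * (\<Sum>a\<in>{0..<int u}. of_int (\<psi> a) * ee (a * (- k))))"
    unfolding gauss_separable[symmetric] sum_distrib_left
    by (subst sum.swap) (simp add: ee_add[symmetric] algebra_simps)
  also have "\<dots> = (\<Sum>k\<in>{0..<int u}. of_int (\<psi> (-1)) * (if coprime k (int u) then ee (k * c) else 0)) * gauss"
    unfolding gauss_separable sum_distrib_right
  proof (rule sum.cong[OF refl])
    fix k
    have "(of_int (\<psi> k) * of_int (\<psi> k) :: complex) = (if coprime k (int u) then 1 else 0)"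
      using psi_square[of k] psi_0_iff[of k] by (metis mult_zero_left of_int_0 of_int_1 of_int_mult)
    moreover have "\<psi> (- k) = \<psi> (-1) * \<psi> k" using psi_mult[of "-1" k] by simp
    ultimately show "of_int (\<psi> k) * ee (k * c) * (of_int (\<psi> (- k)) * gauss) =
         of_int (\<psi> (-1)) * (if coprime k (int u) then ee (k * c) else 0) * gauss"
      by (simp add: algebra_simps split: if_splits) 
  qed
  finally have "of_int (\<Sum>a\<in>{0..<int u}. \<psi> a * \<psi> (c - a)) =
      (\<Sum>k\<in>{0..<int u}. of_int (\<psi> (-1)) * (if coprime k (int u) then ee (k * c) else 0))"
    \<comment> \<open>Both sides were multiplied by \<open>gauss\<close> so that \<psi>(c - a) could
      be expanded in additive characters.\<close>
    using gauss_nonzero mult_right_cancel by blast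
  also have "\<dots> = of_int (\<psi> (-1)) * (\<Sum>k | k \<in> {0..<int u} \<and> coprime k (int u). ee (k * c))"
    unfolding sum_distrib_left[symmetric] by (simp only: sum.inter_filter finite_atLeastLessThan_int)
  finally show ?thesis .
qed

definition dsum :: "real \<Rightarrow> real" where
  "dsum \<theta> = (\<Sum>a\<in>{0..<int u}. \<Sum>b\<in>{0..<int u}. of_int (\<psi> a * \<psi> b) * beta2 (of_int (a + b) / of_nat u + \<theta>))"

text \<open>Collecting the terms with a + b = c leaves a Ramanujan sum against Bernoulli values.
  Mobius inversion opens the Ramanujan sum, and each divisor d gives one distribution
  relation.\<close>

lemma dsum_eq:
  "dsum \<theta> = of_int (\<psi> (-1)) * (\<Sum>D\<in>Pow (prime_factors u). (-1) ^ card D * (of_nat u / of_nat (\<Prod>D)^2 * beta2 (of_nat (\<Prod>D) * \<theta>)))"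
proof -
  have "dsum \<theta> = (\<Sum>a\<in>{0..<int u}. \<Sum>c\<in>{0..<int u}. of_int (\<psi> a * \<psi> (c - a)) * beta2 (of_int c / of_nat u + \<theta>))"
    unfolding dsum_def
  proof (rule sum.cong[OF refl])
    fix a
    define F where "F c = of_int (\<psi> a * \<psi> (c - a)) * beta2 (of_int c / of_nat u + \<theta>)" for c
    have "F (c + int u) = F c" for c
    proof -
      have "of_int (c + int u) / of_nat u + \<theta> = (of_int c / of_nat u + \<theta>) + of_int 1" using u_pos by (simp add: field_simps)
      then have "beta2 (of_int (c + int u) / of_nat u + \<theta>) = beta2 (of_int c / of_nat u + \<theta>)" by (simp only: beta2_add_int)
      moreover have "\<psi> (c + int u - a) = \<psi> (c - a)" using psi_per[of "c - a"] by (simp add: algebra_simps)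
      ultimately show ?thesis by (simp only: F_def)
    qed
    then have "(\<Sum>b\<in>{0..<int u}. F (1 * b + a)) = (\<Sum>c\<in>{0..<int u}. F c)"
      using u_pos by (intro sum_periodic_affine) auto
    then show "(\<Sum>b\<in>{0..<int u}. of_int (\<psi> a * \<psi> b) * beta2 (of_int (a + b) / of_nat u + \<theta>)) = (\<Sum>c\<in>{0..<int u}. of_int (\<psi> a * \<psi> (c - a)) * beta2 (of_int c / of_nat u + \<theta>))"
      by (simp add: F_def add.commute)
  qed
  also have "\<dots> = (\<Sum>c\<in>{0..<int u}. of_int (\<Sum>a\<in>{0..<int u}. \<psi> a * \<psi> (c - a)) * beta2 (of_int c / of_nat u + \<theta>))"
    by (subst sum.swap) (simp add: sum_distrib_right)
  finally have "complex_of_real (dsum \<theta>) = (\<Sum>c\<in>{0..<int u}. of_int (\<Sum>a\<in>{0..<int u}. \<psi> a * \<psi> (c - a)) * of_real (beta2 (of_int c / of_nat u + \<theta>)))"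
    by simp
  also have "\<dots> = of_int (\<psi> (-1)) * (\<Sum>k | k \<in> {0..<int u} \<and> coprime k (int u). \<Sum>c\<in>{0..<int u}. ee (k * c) * of_real (beta2 (of_int c / of_nat u + \<theta>)))"
    unfolding autocorrelation sum_distrib_left sum_distrib_right by (subst sum.swap) (simp add: mult.assoc)
  also have "\<dots> = of_int (\<psi> (-1)) * (\<Sum>D\<in>Pow (prime_factors u). (-1) ^ card D * (\<Sum>j\<in>{0..<int (u div \<Prod>D)}. \<Sum>c\<in>{0..<int u}. ee (int (\<Prod>D) * j * c) * of_real (beta2 (of_int c / of_nat u + \<theta>))))"
    unfolding sum_coprime_inclusion_exclusion[OF u_pos] ..
  also have "\<dots> = of_int (\<psi> (-1)) * (\<Sum>D\<in>Pow (prime_factors u). (-1) ^ card D * of_real (of_nat u / of_nat (\<Prod>D)^2 * beta2 (of_nat (\<Prod>D) * \<theta>)))"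
  proof (rule arg_cong2[of _ _ _ _ "(*)"], rule refl, rule sum.cong[OF refl], rule arg_cong2[of _ _ _ _ "(*)"], rule refl)
    fix D assume "D \<in> Pow (prime_factors u)"
    then have "\<Prod>D dvd u" "\<Prod>D > 0" using prod_subset_prime_factors_dvd by auto
    moreover have "(\<Sum>j\<in>{0..<int (u div d)}. \<Sum>c\<in>{0..<int u}. ee (int d * j * c) * of_real (beta2 (of_int c / of_nat u + \<theta>)))
        = of_real (of_nat u / of_nat d^2 * beta2 (of_nat d * \<theta>))" if "d dvd u" "d > 0" for d
    proof -
      define k where "k = u div d"
      have u: "u = d * k" and k: "k > 0" using that u_pos by (auto simp: k_def dvd_div_eq_0_iff intro: Nat.gr0I)
      have "(\<Sum>j\<in>{0..<int k}. \<Sum>c\<in>{0..<int u}. ee (int d * j * c) * of_real (beta2 (of_int c / of_nat u + \<theta>)))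
         = (\<Sum>c\<in>{0..<int u}. (\<Sum>j\<in>{0..<int k}. q_of (of_int (j * c) / of_nat k)) * of_real (beta2 (of_int c / of_nat u + \<theta>)))"
      proof -
        have "ee (int d * j * c) = q_of (of_int (j * c) / of_nat k)" for j c
          unfolding ee_def using that k by (simp add: u)
        then show ?thesis by (subst sum.swap) (simp add: sum_distrib_right)
      qed
      also have "\<dots> = (\<Sum>c\<in>{0..<int u}. if int k dvd c then of_nat k * of_real (beta2 (of_int c / of_nat u + \<theta>)) else 0)"
        unfolding sum_roots_of_unity[OF k] by (intro sum.cong) auto
      also have "\<dots> = (\<Sum>c | c \<in> {0..<int u} \<and> int k dvd c. of_nat k * of_real (beta2 (of_int c / of_nat u + \<theta>)))"
        by (subst sum.inter_filter) auto
      \<comment> \<open>Orthogonality has left only c = k i with u = d k, so c/u = i/d runs over the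
        d-th parts of 1. The weight k = u/d and the factor 1/d of the distribution relation combine
        to u/d^2.\<close>
      also have "\<dots> = (\<Sum>i\<in>{0..<int u div int k}. of_nat k * of_real (beta2 (of_int (int k * i) / of_nat u + \<theta>)))"
        using k u by (intro sum_multiples) auto
      also have "\<dots> = of_nat k * of_real (\<Sum>i\<in>{0..<int d}. beta2 (\<theta> + of_int i / of_nat d))"
        using k that by (simp add: u sum_distrib_left add.commute)
      also have "\<dots> = of_real (of_nat u / of_nat d^2 * beta2 (of_nat d * \<theta>))"
        unfolding sum_beta2_distribution[OF that(2)] using that(2) by (simp add: u power2_eq_square)
      finally show ?thesis by (simp add: k_def)
    qed
    ultimately show "(\<Sum>j\<in>{0..<int (u div \<Prod>D)}. \<Sum>c\<in>{0..<int u}. ee (int (\<Prod>D) * j * c) * of_real (beta2 (of_int c / of_nat u + \<theta>)))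
        = of_real (of_nat u / of_nat (\<Prod>D)^2 * beta2 (of_nat (\<Prod>D) * \<theta>))" by blast
  qed
  also have "\<dots> = of_real (of_int (\<psi> (-1)) * (\<Sum>D\<in>Pow (prime_factors u). (-1) ^ card D * (of_nat u / of_nat (\<Prod>D)^2 * beta2 (of_nat (\<Prod>D) * \<theta>))))"
    by (simp only: of_real_mult of_real_sum of_real_power of_real_minus of_real_1 of_real_of_int_eq)
  finally show ?thesis by (simp only: of_real_eq_iff)
qed

end

section \<open>Character sums at the cusps\<close>

lemma squarefree_mult_imp_coprime:
  assumes "squarefree (a * b :: nat)"
  shows "coprime a b"
proof (rule coprimeI)
  fix c assume "c dvd a" "c dvd b"
  then have "c ^ 2 dvd a * b" by (simp add: power2_eq_square mult_dvd_mono)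
  then show "is_unit c" using squarefreeD[OF assms] by blast
qed

lemma squarefree_prod_prime_factors:
  assumes "squarefree (n::nat)"
  shows "\<Prod>(prime_factors n) = n"
proof -
  have n: "n > 0" using assms by (auto intro!: Nat.gr0I)
  have "n = (\<Prod>p\<in>prime_factors n. p ^ multiplicity p n)"
    by (rule prime_factorization_nat[OF n])
  also have "\<dots> = (\<Prod>p\<in>prime_factors n. p)"
  proof (rule prod.cong[OF refl])
    fix p assume p: "p \<in> prime_factors n"
    then have "multiplicity p n > 0" by (simp add: prime_factors_multiplicity)
    moreover have "multiplicity p n \<le> 1"
      using assms n p squarefree_factorial_semiring'[of n] by (auto simp: prime_factors_multiplicity)
    ultimately have "multiplicity p n = 1" by simp
    then show "p ^ multiplicity p n = p" by simp
  qed
  finally show ?thesis by simp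
qed

lemma squarefree_prod_one_minus:
  assumes "squarefree (n::nat)"
  shows "(\<Prod>p\<in>prime_factors n. 1 - real p) = (-1) ^ card (prime_factors n) * real (totient n)"
proof -
  have "real (totient n) = (\<Prod>p\<in>prime_factors n. real p) * (\<Prod>p\<in>prime_factors n. 1 - 1 / real p)"
    unfolding totient_formula2 by (subst squarefree_prod_prime_factors[OF assms, symmetric]) simp
  also have "\<dots> = (\<Prod>p\<in>prime_factors n. real p - 1)"
    unfolding prod.distrib[symmetric] by (intro prod.cong) (auto simp: field_simps in_prime_factors_iff)
  also have "(-1) ^ card (prime_factors n) * \<dots> = (\<Prod>p\<in>prime_factors n. - (real p - 1))"
    by (simp only: prod_uminus)
  finally show ?thesis by simp
qed

lemma sum_separate3:
  fixes G :: "'a \<Rightarrow> 'b \<Rightarrow> real"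
  shows "(\<Sum>i\<in>I. \<Sum>k\<in>K. \<Sum>l\<in>L. c * x l * (y k * G i k)) = c * sum x L * (\<Sum>k\<in>K. y k * (\<Sum>i\<in>I. G i k))"
proof -
  have "(\<Sum>i\<in>I. \<Sum>k\<in>K. \<Sum>l\<in>L. c * x l * (y k * G i k)) = (\<Sum>i\<in>I. \<Sum>k\<in>K. c * sum x L * (y k * G i k))"
    by (simp only: sum_distrib_left sum_distrib_right)
  also have "\<dots> = (\<Sum>k\<in>K. \<Sum>i\<in>I. c * sum x L * (y k * G i k))" by (rule sum.swap)
  also have "\<dots> = c * sum x L * (\<Sum>k\<in>K. y k * (\<Sum>i\<in>I. G i k))" by (simp only: sum_distrib_left)
  finally show ?thesis .
qed

context real_primitive_character begin

lemma dsum_add_int: "dsum (\<theta> + of_int n) = dsum \<theta>"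
  unfolding dsum_def by (simp add: add.assoc[symmetric])

text \<open>Multiplying i by x and a by y permutes residues; the values \<psi>(x) and \<psi>(y) come
  out because they are their own inverses.\<close>

lemma sum_psi_affine:
  assumes "coprime x (int u)" "coprime y (int u)"
  shows "(\<Sum>i\<in>{0..<int u}. \<Sum>a\<in>{0..<int u}. of_int (\<psi> i * \<psi> a) * beta2 (of_int (i * x + a * y) / of_nat u + \<theta>))
    = of_int (\<psi> x * \<psi> y) * dsum \<theta>"
proof -
  define F where "F c = beta2 (of_int c / of_nat u + \<theta>)" for c :: int
  have per: "F (c + int u * k) = F c" for c k
  proof -
    have "of_int (c + int u * k) / of_nat u + \<theta> = (of_int c / of_nat u + \<theta>) + of_int k" using u_pos by (simp add: field_simps)
    then show ?thesis unfolding F_def by (simp only: beta2_add_int)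
  qed
  have sq: "real_of_int (\<psi> z) = of_int (\<psi> w) * of_int (\<psi> (w * z))" if "coprime w (int u)" for z w
    using psi_square[OF that] unfolding psi_mult by (metis mult.assoc mult_1 of_int_mult)
  have one: "(\<Sum>i\<in>{0..<int u}. of_int (\<psi> i) * G (w * i)) = of_int (\<psi> w) * (\<Sum>i\<in>{0..<int u}. of_int (\<psi> i) * G i)"
    if "coprime w (int u)" "\<And>c. G (c + int u) = G c" for w and G :: "int \<Rightarrow> real"
  proof -
    have "(\<Sum>i\<in>{0..<int u}. of_int (\<psi> i) * G (w * i)) = of_int (\<psi> w) * (\<Sum>i\<in>{0..<int u}. of_int (\<psi> (w * i)) * G (w * i))"
      unfolding sum_distrib_left by (rule sum.cong[OF refl]) (subst sq[OF that(1)], simp add: mult.assoc)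
    also have "(\<Sum>i\<in>{0..<int u}. of_int (\<psi> (w * i)) * G (w * i)) = (\<Sum>i\<in>{0..<int u}. of_int (\<psi> i) * G i)"
      using sum_periodic_affine[of "int u" w "\<lambda>i. of_int (\<psi> i) * G i" 0] that u_pos by (simp add: psi_per)
    finally show ?thesis .
  qed
  have "(\<Sum>i\<in>{0..<int u}. \<Sum>a\<in>{0..<int u}. of_int (\<psi> i * \<psi> a) * F (i * x + a * y))
     = (\<Sum>i\<in>{0..<int u}. of_int (\<psi> i) * (\<lambda>c. \<Sum>a\<in>{0..<int u}. of_int (\<psi> a) * F (c + y * a)) (x * i))"
    by (simp add: sum_distrib_left mult_ac)
  also have "\<dots> = of_int (\<psi> x) * (\<Sum>i\<in>{0..<int u}. of_int (\<psi> i) * (\<Sum>a\<in>{0..<int u}. of_int (\<psi> a) * F (i + y * a)))"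
    by (rule one[OF assms(1)]) (use per[of _ 1] in \<open>simp add: add_ac\<close>, metis (no_types, opaque_lifting) add.assoc add.commute per mult.right_neutral)
  also have "(\<lambda>i. \<Sum>a\<in>{0..<int u}. of_int (\<psi> a) * F (i + y * a)) = (\<lambda>i. of_int (\<psi> y) * (\<Sum>a\<in>{0..<int u}. of_int (\<psi> a) * F (i + a)))"
  proof
    fix i
    show "(\<Sum>a\<in>{0..<int u}. of_int (\<psi> a) * F (i + y * a)) = of_int (\<psi> y) * (\<Sum>a\<in>{0..<int u}. of_int (\<psi> a) * F (i + a))"
      by (rule one[OF assms(2), of "\<lambda>a. F (i + a)"]) (use per[of _ 1] in \<open>simp add: add.assoc[symmetric]\<close>)
  qed
  also have "of_int (\<psi> x) * (\<Sum>i\<in>{0..<int u}. of_int (\<psi> i) * (of_int (\<psi> y) * (\<Sum>a\<in>{0..<int u}. of_int (\<psi> a) * F (i + a))))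
     = of_int (\<psi> x * \<psi> y) * dsum \<theta>"
    unfolding dsum_def F_def by (simp add: sum_distrib_left mult_ac)
  finally show ?thesis unfolding F_def .
qed

text \<open>The divisors d of u are prime to e, so multiplication by d permutes the units modulo e
  and the inner sum no longer depends on d. The double sum becomes the Euler product of 1 - p^-2
  over the primes of u times the Bernoulli sum over units modulo e.\<close>

lemma sum_coprime_dsum:
  assumes e: "e dvd P" and x: "coprime x (int e)"
  shows "(\<Sum>k\<in>{0..<int e}. of_bool (coprime k (int e)) * dsum (of_int (k * x) / of_nat e)) =
     of_int (\<psi> (-1)) * of_nat u * (\<Prod>p\<in>prime_factors u. 1 - 1 / real p ^ 2) * ((\<Prod>p\<in>prime_factors e. 1 - real p) / (6 * of_nat e))"
proof -
  have e0: "e > 0" using e P_pos by (auto intro: Nat.gr0I)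
  have cop: "coprime u e" using coprime_uP e by (metis coprime_divisors dvd_refl)
  have per: "of_bool (coprime (k + int e) (int e)) = (of_bool (coprime k (int e)) :: real)" for k
    by (simp add: coprime_iff_gcd_eq_1)
  have aff: "(\<Sum>k\<in>{0..<int e}. of_bool (coprime k (int e)) * G (w * k)) = (\<Sum>k\<in>{0..<int e}. of_bool (coprime k (int e)) * G k)"
    if w: "coprime w (int e)" and G: "\<And>k. G (k + int e) = G k" for G :: "int \<Rightarrow> real" and w
  proof -
    have "(\<Sum>k\<in>{0..<int e}. of_bool (coprime k (int e)) * G (w * k)) = (\<Sum>k\<in>{0..<int e}. of_bool (coprime (w * k) (int e)) * G (w * k))"
      using w by simp
    also have "\<dots> = (\<Sum>k\<in>{0..<int e}. of_bool (coprime k (int e)) * G k)"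
      using sum_periodic_affine[of "int e" w "\<lambda>k. of_bool (coprime k (int e)) * G k" 0] e0 w G per by simp
    finally show ?thesis .
  qed
  have "(\<Sum>k\<in>{0..<int e}. of_bool (coprime k (int e)) * dsum (of_int (k * x) / of_nat e)) =
     (\<Sum>k\<in>{0..<int e}. of_bool (coprime k (int e)) * dsum (of_int (x * k) / of_nat e))"
    by (simp only: mult.commute)
  also have "\<dots> = (\<Sum>k\<in>{0..<int e}. of_bool (coprime k (int e)) * dsum (of_int k / of_nat e))"
  proof (rule aff[OF x])
    fix k
    have "of_int (k + int e) / real e = of_int k / of_nat e + of_int 1" using e0 by (simp add: field_simps)
    then show "dsum (of_int (k + int e) / of_nat e) = dsum (of_int k / of_nat e)" by (simp only: dsum_add_int)
  qed
  also have "\<dots> = of_int (\<psi> (-1)) * (\<Sum>D\<in>Pow (prime_factors u). (-1) ^ card D * (of_nat u / of_nat (\<Prod>D)^2 *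
      (\<Sum>k\<in>{0..<int e}. of_bool (coprime k (int e)) * beta2 (of_int (int (\<Prod>D) * k) / of_nat e))))"
    unfolding dsum_eq sum_distrib_left by (subst sum.swap) (simp add: mult_ac)
  also have "\<dots> = of_int (\<psi> (-1)) * (\<Sum>D\<in>Pow (prime_factors u). (-1) ^ card D * (of_nat u / of_nat (\<Prod>D)^2 *
      (\<Sum>k\<in>{0..<int e}. of_bool (coprime k (int e)) * beta2 (of_int k / of_nat e))))"
  proof (rule arg_cong2[of _ _ _ _ "(*)"], rule refl, rule sum.cong[OF refl], rule arg_cong2[of _ _ _ _ "(*)"], rule refl, rule arg_cong2[of _ _ _ _ "(*)"], rule refl)
    fix D assume "D \<in> Pow (prime_factors u)"
    then have "\<Prod>D dvd u" using prod_subset_prime_factors_dvd by auto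
    then have c: "coprime (int (\<Prod>D)) (int e)" unfolding coprime_int_iff using cop by (metis coprime_divisors dvd_refl)
    show "(\<Sum>k\<in>{0..<int e}. of_bool (coprime k (int e)) * beta2 (of_int (int (\<Prod>D) * k) / of_nat e)) =
      (\<Sum>k\<in>{0..<int e}. of_bool (coprime k (int e)) * beta2 (of_int k / of_nat e))"
    proof (rule aff[OF c])
      fix k
      have "of_int (k + int e) / real e = of_int k / of_nat e + of_int 1" using e0 by (simp add: field_simps)
      then show "beta2 (of_int (k + int e) / of_nat e) = beta2 (of_int k / of_nat e)" by (simp only: beta2_add_int)
    qed
  qed
  also have "(\<Sum>k\<in>{0..<int e}. of_bool (coprime k (int e)) * beta2 (of_int k / of_nat e)) = (\<Prod>p\<in>prime_factors e. 1 - real p) / (6 * of_nat e)"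
    unfolding sum_coprime_beta2[OF e0, symmetric] by (rule sum.mono_neutral_cong_right) auto
  also have "(\<Sum>D\<in>Pow (prime_factors u). (-1) ^ card D * (of_nat u / of_nat (\<Prod>D)^2 * ((\<Prod>p\<in>prime_factors e. 1 - real p) / (6 * of_nat e))))
      = (\<Sum>D\<in>Pow (prime_factors u). (-1) ^ card D * (\<Prod>p\<in>D. 1 / real p ^ 2)) * (of_nat u * ((\<Prod>p\<in>prime_factors e. 1 - real p) / (6 * of_nat e)))"
    unfolding sum_distrib_right by (rule sum.cong[OF refl]) (simp add: prod_dividef prod_power_distrib)
  also have "(\<Sum>D\<in>Pow (prime_factors u). (-1) ^ card D * (\<Prod>p\<in>D. 1 / real p ^ 2)) = (\<Prod>p\<in>prime_factors u. 1 - 1 / real p ^ 2)"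
    by (subst prod_one_minus) auto
  finally show ?thesis by (simp only: mult_ac)
qed

text \<open>The surviving case, where the greatest common divisor in the cusp sum is ue. The Chinese
  remainder theorem splits b into i modulo u, k modulo e and l modulo P'. The index l does not enter
  the argument of \<open>beta2\<close> and yields \<phi>(P'), i pairs with a in \<open>dsum\<close>,
  and k runs through the shifts of \<open>dsum\<close>.\<close>

lemma cusp_sum_nonvanishing:
  assumes e: "e dvd P" and x: "coprime \<alpha> (int (u * e))" and y: "coprime \<gamma> (int u)"
  obtains s where "s \<in> {-1, 1::int}"
   "(\<Sum>b\<in>{0..<int (u * P)}. \<Sum>a\<in>{0..<int u}. of_int (chi b * \<psi> a) * beta2 (of_int (b * \<alpha>) / of_nat (u * e) + of_int (a * \<gamma>) / of_nat u))
   = of_int s * real (totient P) * (of_nat u / (6 * of_nat e)) * (\<Prod>p\<in>prime_factors u. 1 - 1 / real p ^ 2)"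
proof -
  define P' where "P' = P div e"
  have P: "P = e * P'" using e by (simp add: P'_def)
  have pos: "e > 0" "P' > 0" using P P_pos by (auto intro: Nat.gr0I)
  have cop: "coprime e P'" using squarefree_P P squarefree_mult_imp_coprime by blast
  have copu: "coprime u e" "coprime u P'" using coprime_uP P by auto
  define F where "F b = (\<Sum>a\<in>{0..<int u}. of_int (chi b * \<psi> a) * beta2 (of_int (b * \<alpha>) / of_nat (u * e) + of_int (a * \<gamma>) / of_nat u))" for b
  \<comment> \<open>With P = e P', the part iP of b contributes i P' \<alpha>/u, and the part k P' u
    contributes k P' \<alpha>/e. So P' \<alpha> is the multiplier in both.\<close>
  define Y where "Y = int P' * \<alpha>"
  have Yu: "coprime Y (int u)" and Ye: "coprime Y (int e)"
    using x cop copu by (auto simp: Y_def coprime_commute)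
  have F_per: "F (b + int u * int P) = F b" for b
  proof -
    have 1: "of_int ((b + int u * int P) * \<alpha>) / of_nat (u * e) + of_int (a * \<gamma>) / of_nat u
        = (of_int (b * \<alpha>) / of_nat (u * e) + of_int (a * \<gamma>) / real u) + of_int Y" for a
      using u_pos pos by (simp add: P Y_def field_simps)
    have 2: "chi (b + int u * int P) = chi b" using chi_per[of b] by simp
    show ?thesis unfolding F_def 1 2 beta2_add_int ..
  qed
  have "(\<Sum>b\<in>{0..<int (u * P)}. F b) = (\<Sum>i\<in>{0..<int u}. \<Sum>j\<in>{0..<int P}. F (i * int P + j * int u))"
    unfolding of_nat_mult by (rule sum_crt) (use F_per u_pos P_pos coprime_uP in auto)
  also have "\<dots> = (\<Sum>i\<in>{0..<int u}. \<Sum>k\<in>{0..<int e}. \<Sum>l\<in>{0..<int P'}. F (i * int P + (k * int P' + l * int e) * int u))"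
  proof (rule sum.cong[OF refl])
    fix i
    show "(\<Sum>j\<in>{0..<int P}. F (i * int P + j * int u)) = (\<Sum>k\<in>{0..<int e}. \<Sum>l\<in>{0..<int P'}. F (i * int P + (k * int P' + l * int e) * int u))"
      unfolding P of_nat_mult
    proof (rule sum_crt)
      fix a
      show "F (i * (int e * int P') + (a + int e * int P') * int u) = F (i * (int e * int P') + a * int u)"
        using F_per[of "i * (int e * int P') + a * int u"] by (simp add: P algebra_simps)
    qed (use pos cop in auto)
  qed
  also have "\<dots> = (\<Sum>i\<in>{0..<int u}. \<Sum>k\<in>{0..<int e}. \<Sum>l\<in>{0..<int P'}. of_int (\<psi> (int P)) * of_bool (coprime l (int P')) * (of_bool (coprime k (int e)) *
     (\<Sum>a\<in>{0..<int u}. of_int (\<psi> i * \<psi> a) * beta2 (of_int (i * Y + a * \<gamma>) / of_nat u + of_int (k * Y) / of_nat e))))"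
  proof (rule sum.cong[OF refl], rule sum.cong[OF refl], rule sum.cong[OF refl])
    fix i k l
    define b where "b = i * int P + (k * int P' + l * int e) * int u"
    have "coprime b (int e) \<longleftrightarrow> coprime (k * int P' * int u) (int e)"
    proof -
      have "b = k * int P' * int u + (i * int P' + l * int u) * int e" by (simp add: b_def P algebra_simps)
      then show ?thesis by (simp only: coprime_iff_gcd_eq_1 gcd_add_mult gcd.commute[of _ "int e"]
          add.commute[of "k * int P' * int u"])
    qed
    then have be: "coprime b (int e) \<longleftrightarrow> coprime k (int e)" using cop copu by (simp add: coprime_commute)
    have "coprime b (int P') \<longleftrightarrow> coprime (l * int e * int u) (int P')"
    proof -
      have "b = l * int e * int u + (i * int e + k * int u) * int P'" by (simp add: b_def P algebra_simps)
      then show ?thesis by (simp only: coprime_iff_gcd_eq_1 gcd_add_mult gcd.commute[of _ "int P'"]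
          add.commute[of "l * int e * int u"])
    qed
    then have bP: "coprime b (int P') \<longleftrightarrow> coprime l (int P')" using cop copu by (simp add: coprime_commute)
    have "\<psi> b = \<psi> (i * int P)"
      using psi_add_mult[of "i * int P" "k * int P' + l * int e"] by (simp add: b_def mult.commute)
    then have chib: "chi b = \<psi> (int P) * of_bool (coprime l (int P')) * of_bool (coprime k (int e)) * \<psi> i"
      unfolding chi_def using be bP by (auto simp: P psi_mult)
    \<comment> \<open>The part l e u of b contributes the integer l \<alpha>, which
      \<open>beta2\<close> ignores.\<close>
    have "of_int (b * \<alpha>) / of_nat (u * e) + of_int (a * \<gamma>) / of_nat u = (of_int (i * Y + a * \<gamma>) / of_nat u + of_int (k * Y) / of_nat e) + real_of_int (l * \<alpha>)" for a
      using u_pos pos by (simp add: P b_def Y_def field_simps)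
    then have "beta2 (of_int (b * \<alpha>) / of_nat (u * e) + of_int (a * \<gamma>) / of_nat u) = beta2 (of_int (i * Y + a * \<gamma>) / of_nat u + of_int (k * Y) / of_nat e)" for a
      by (simp only: beta2_add_int)
    then show "F b = of_int (\<psi> (int P)) * of_bool (coprime l (int P')) * (of_bool (coprime k (int e)) *
     (\<Sum>a\<in>{0..<int u}. of_int (\<psi> i * \<psi> a) * beta2 (of_int (i * Y + a * \<gamma>) / of_nat u + of_int (k * Y) / of_nat e)))"
      unfolding F_def chib by (simp add: sum_distrib_left mult_ac)
  qed
  also have "\<dots> = of_int (\<psi> (int P)) * (\<Sum>l\<in>{0..<int P'}. of_bool (coprime l (int P'))) * (\<Sum>k\<in>{0..<int e}. of_bool (coprime k (int e)) *
     (\<Sum>i\<in>{0..<int u}. \<Sum>a\<in>{0..<int u}. of_int (\<psi> i * \<psi> a) * beta2 (of_int (i * Y + a * \<gamma>) / of_nat u + of_int (k * Y) / of_nat e)))"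
    by (rule sum_separate3)
  also have "\<dots> = of_int (\<psi> (int P)) * real (totient P') * (of_int (\<psi> Y * \<psi> \<gamma>) * (\<Sum>k\<in>{0..<int e}. of_bool (coprime k (int e)) * dsum (of_int (k * Y) / of_nat e)))"
    unfolding sum_psi_affine[OF Yu y] sum_coprime_indicator[OF pos(2)] by (simp only: sum_distrib_left mult_ac)
  also have "\<dots> = of_int (\<psi> (int P) * \<psi> Y * \<psi> \<gamma> * \<psi> (-1) * (-1) ^ card (prime_factors e)) * (real (totient e) * real (totient P')) * (of_nat u / (6 * of_nat e)) * (\<Prod>p\<in>prime_factors u. 1 - 1 / real p ^ 2)"
    unfolding sum_coprime_dsum[OF e Ye] squarefree_prod_one_minus[OF squarefree_mono[OF e squarefree_P]]
    by (simp add: mult_ac)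
  also have "real (totient e) * real (totient P') = real (totient P)"
    using totient_mult_coprime[OF cop] by (simp add: P)
  finally have res: "(\<Sum>b\<in>{0..<int (u * P)}. F b) = of_int (\<psi> (int P) * \<psi> Y * \<psi> \<gamma> * \<psi> (-1) * (-1) ^ card (prime_factors e)) * real (totient P) * (of_nat u / (6 * of_nat e)) * (\<Prod>p\<in>prime_factors u. 1 - 1 / real p ^ 2)" .
  have pm: "\<psi> z = 1 \<or> \<psi> z = -1" if "coprime z (int u)" for z
    using psi_vals[of z] psi_0_iff[of z] that by auto
  have c4: "coprime (int P) (int u)" using coprime_uP by (simp add: coprime_commute)
  have "(-1::int) ^ card (prime_factors e) = 1 \<or> (-1::int) ^ card (prime_factors e) = -1"
    by (metis neg_one_even_power neg_one_odd_power)
  then have "\<psi> (int P) * \<psi> Y * \<psi> \<gamma> * \<psi> (-1) * (-1) ^ card (prime_factors e) \<in> {-1, 1}"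
    using pm[OF c4] pm[OF Yu] pm[OF y] pm[of "-1"] by auto
  then show ?thesis using that res unfolding F_def by blast
qed

text \<open>The next sum is, up to a positive factor, the order of the eta function at the cusp \<open>\<alpha> / \<gamma>\<close>.\<close>

definition cusp_sum :: "int \<Rightarrow> int \<Rightarrow> real" where
  "cusp_sum \<alpha> \<gamma> = (let x = gcd (int (u * P)) \<gamma> in
     (\<Sum>b\<in>{0..<int (u * P)}. \<Sum>a\<in>{0..<int u}. of_int (chi b * \<psi> a) * beta2 (of_int (b * \<alpha>) / of_int x + of_int (a * \<gamma>) / of_int (int u * x))))"

definition jordan2 :: real where
  "jordan2 = real u ^ 2 * (\<Prod>p\<in>prime_factors u. 1 - 1 / real p ^ 2)"

text \<open>The divisibility by u^2 P says that the translation by h at the cusp \<alpha>/\<gamma>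
  lies in the group. The sum vanishes unless u divides x and \<gamma>/x is prime to u; in the
  remaining case it is explicit and h is a multiple of P/e.\<close>

lemma cusp_sum_integrality:
  fixes h :: nat
  assumes "coprime \<alpha> \<gamma>" "int (u^2 * P) dvd \<gamma>^2 * int h"
  obtains z :: int where
    "of_int (gcd (int (u * P)) \<gamma>) ^ 2 / (4 * real (u * P)) * cusp_sum \<alpha> \<gamma> * real h = jordan2 * real (totient P) / 24 * of_int z"
proof -
  define x where "x = nat (gcd (int (u * P)) \<gamma>)"
  have x: "int x = gcd (int (u * P)) \<gamma>" by (simp add: x_def)
  have "int x dvd int (u * P)" unfolding x by (rule gcd_dvd1)
  then have xM: "x dvd u * P" by (simp only: int_dvd_int_iff)
  have x\<gamma>: "int x dvd \<gamma>" unfolding x by simp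
  have x0: "x > 0" using xM uP_gt_1 by (metis dvd_0_left_iff gr0I less_nat_zero_code)
  define S where "S = cusp_sum \<alpha> \<gamma>"
  have S: "S = (\<Sum>b\<in>{0..<int (u * P)}. \<Sum>a\<in>{0..<int u}. of_int (chi b * \<psi> a) * beta2 (of_int (b * \<alpha>) / of_nat x + of_int (a * \<gamma>) / of_nat (u * x)))"
    unfolding S_def cusp_sum_def x[symmetric] Let_def by simp
  have *: "\<exists>z::int. of_int (int x) ^ 2 / (4 * real (u * P)) * S * real h = jordan2 * real (totient P) / 24 * of_int z"
  proof (cases "S = 0")
    case True then show ?thesis by (intro exI[of _ 0]) simp
  next
    case False
    have ux: "u dvd x"
    proof (rule ccontr)
      assume "\<not> u dvd x"
      \<comment> \<open>As a function of b the Bernoulli term has period x, so the imprimitive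
        vanishing lemma applies.\<close>
      have "(\<Sum>b\<in>{0..<int (u * P)}. of_int (chi b) * (\<Sum>a\<in>{0..<int u}. of_int (\<psi> a) * beta2 (of_int (b * \<alpha>) / of_nat x + of_int (a * \<gamma>) / of_nat (u * x)))) = 0"
      proof (rule chi_vanish[OF xM \<open>\<not> u dvd x\<close>])
        fix b
        have "of_int ((b + int x) * \<alpha>) / of_nat x + r = (of_int (b * \<alpha>) / of_nat x + r) + real_of_int \<alpha>" for r
          using x0 by (simp add: field_simps)
        then show "(\<Sum>a\<in>{0..<int u}. of_int (\<psi> a) * beta2 (of_int ((b + int x) * \<alpha>) / of_nat x + of_int (a * \<gamma>) / of_nat (u * x)))
           = (\<Sum>a\<in>{0..<int u}. of_int (\<psi> a) * beta2 (of_int (b * \<alpha>) / of_nat x + of_int (a * \<gamma>) / of_nat (u * x)))"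
          by (simp only: beta2_add_int)
      qed
      then show False using False unfolding S by (simp add: sum_distrib_left mult.assoc)
    qed
    define e where "e = x div u"
    have xe: "x = u * e" using ux by (simp add: e_def)
    have e0: "e > 0" using x0 xe by (auto intro: Nat.gr0I)
    have eP: "e dvd P" using xM u_pos by (simp add: xe)
    obtain g where g: "\<gamma> = int x * g" using x\<gamma> by blast
    define P' where "P' = P div e"
    have P: "P = e * P'" using eP by (simp add: P'_def)
    have P'0: "P' > 0" using P P_pos by (auto intro: Nat.gr0I)
    have gP: "coprime (int P') g"
    proof -
      have "int x * gcd (int P') g = gcd (int x * int P') (int x * g)"
        by (simp add: gcd_mult_distrib_int[symmetric])
      also have "\<dots> = int x" using x g by (simp add: xe P mult_ac)
      finally have "gcd (int P') g = 1" using x0 by simp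
      then show ?thesis by (simp add: coprime_iff_gcd_eq_1)
    qed
    have gu: "coprime g (int u)"
    proof (rule ccontr)
      assume nc: "\<not> coprime g (int u)"
      define v where "v = nat (gcd g (int u))"
      have v: "int v = gcd g (int u)" by (simp add: v_def)
      then have v1: "v > 1" using nc u_pos by (cases "v = 0 \<or> v = 1") (auto simp: coprime_iff_gcd_eq_1)
      have vu: "v dvd u" using v gcd_dvd2[of g "int u"] by (metis int_dvd_int_iff)
      obtain d where d: "u = d * v" using vu by (metis dvd_div_mult_self)
      obtain g' where g': "g = int v * g'" using v gcd_dvd1[of g "int u"] by (metis dvdE)
      have d0: "d > 0" using d u_pos by (auto intro: Nat.gr0I)
      have dlt: "d dvd u" "d < u" using d v1 d0 by auto
      \<comment> \<open>A common factor v of g and u shortens the period in a to d = u/v, a proper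
        divisor of u.\<close>
      have "(\<Sum>a\<in>{0..<int u}. of_int (\<psi> a) * beta2 (of_int (b * \<alpha>) / of_nat x + of_int (a * \<gamma>) / of_nat (u * x))) = 0" for b
      proof (rule psi_vanish[OF dlt])
        fix a
        have "of_int ((a + int d) * \<gamma>) / of_nat (u * x) = of_int (a * \<gamma>) / of_nat (u * x) + real_of_int g'"
          using x0 u_pos v1 d0 by (simp add: g g' d field_simps)
        then show "beta2 (of_int (b * \<alpha>) / of_nat x + of_int ((a + int d) * \<gamma>) / of_nat (u * x)) = beta2 (of_int (b * \<alpha>) / of_nat x + of_int (a * \<gamma>) / of_nat (u * x))"
          by (simp only: add.assoc[symmetric] beta2_add_int)
      qed
      then have "S = 0" unfolding S by (simp add: sum_distrib_left[symmetric] mult.assoc)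
      then show False using False by simp
    qed
    have cop: "coprime \<alpha> (int (u * e))" using assms(1) g xe by (metis coprime_mult_right_iff)
    obtain s where s: "s \<in> {-1, 1::int}" "(\<Sum>b\<in>{0..<int (u * P)}. \<Sum>a\<in>{0..<int u}. of_int (chi b * \<psi> a) * beta2 (of_int (b * \<alpha>) / of_nat (u * e) + of_int (a * g) / of_nat u))
   = of_int s * real (totient P) * (of_nat u / (6 * of_nat e)) * (\<Prod>p\<in>prime_factors u. 1 - 1 / real p ^ 2)"
      using cusp_sum_nonvanishing[OF eP cop gu] by blast
    have "of_int (a * \<gamma>) / of_nat (u * x) = real_of_int (a * g) / of_nat u" for a
      using x0 u_pos by (simp add: g)
    then have S': "S = of_int s * real (totient P) * (of_nat u / (6 * of_nat e)) * (\<Prod>p\<in>prime_factors u. 1 - 1 / real p ^ 2)"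
      unfolding S s(2)[symmetric] xe by (simp only:)
    \<comment> \<open>With \<gamma> = u e g and P = e P' the hypothesis reads: u^2 e P' divides u^2
      e^2 g^2 h. Here P' is prime to e, as P is squarefree, and to g.\<close>
    have "int P' dvd int h"
    proof -
      have "int (u^2 * e) * int P' dvd int (u^2 * e) * (int e * g^2 * int h)"
        using assms(2) by (simp add: g xe P power2_eq_square mult_ac)
      then have "int P' dvd int e * g^2 * int h" using u_pos e0 by (simp only: dvd_mult_cancel_left) auto
      moreover have "coprime (int P') (int e * g^2)"
        using gP squarefree_P P squarefree_mult_imp_coprime[of e P'] by (simp add: coprime_commute)
      ultimately show ?thesis by (simp add: coprime_dvd_mult_right_iff)
    qed
    then obtain m where m: "int h = int P' * m" by blast
    then have hm: "real h = real P' * of_int m" by (metis of_int_mult of_int_of_nat_eq)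
    show ?thesis
    proof (intro exI[of _ "s * m"])
      show "of_int (int x) ^ 2 / (4 * real (u * P)) * S * real h = jordan2 * real (totient P) / 24 * of_int (s * m)"
        using u_pos e0 P'0 by (simp add: S' hm xe P jordan2_def power2_eq_square)
    qed
  qed
  show ?thesis using * that unfolding x S_def by auto
qed

end

section \<open>Lambert series\<close>

lemma summable_on_lambert:
  fixes c :: "nat \<Rightarrow> nat \<Rightarrow> complex"
  assumes q: "norm q < 1" and B: "\<And>n m. norm (c n m) \<le> B"
  shows "(\<lambda>(i, j). c (Suc i) (Suc j) * q ^ (Suc i * Suc j)) summable_on UNIV"
proof (rule abs_summable_summable, rule Infinite_Sum.abs_summable_on_comparison_test')
  have s: "((\<lambda>i. norm q ^ i) has_sum (1 / (1 - norm q))) UNIV"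
    using q by (intro norm_summable_imp_has_sum geometric_sums) (auto simp: summable_geometric)
  have "(\<lambda>(i, j). B * (norm q ^ i * norm q ^ j)) summable_on Sigma UNIV (\<lambda>_. UNIV)"
  proof (rule summable_on_SigmaI)
    show "((\<lambda>j. case (i, j) of (i, j) \<Rightarrow> B * (norm q ^ i * norm q ^ j)) has_sum (B * norm q ^ i * (1 / (1 - norm q)))) UNIV" for i
      using has_sum_cmult_right[OF s, of "B * norm q ^ i"] by (simp add: mult.assoc)
    show "(\<lambda>i. B * norm q ^ i * (1 / (1 - norm q))) summable_on UNIV"
      using s by (intro summable_on_cmult_left summable_on_cmult_right) (auto simp: summable_on_def)
  qed (use order_trans[OF norm_ge_zero B[of 0 0]] in \<open>auto intro!: mult_nonneg_nonneg\<close>)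
  then show "(\<lambda>(i, j). B * (norm q ^ i * norm q ^ j)) summable_on UNIV" by simp
  fix x :: "nat \<times> nat"
  obtain i j where x: "x = (i, j)" by (cases x)
  have B0: "0 \<le> B" using B[of 0 0] norm_ge_zero[of "c 0 0"] by linarith
  have "norm (c (Suc i) (Suc j) * q ^ (Suc i * Suc j)) = norm (c (Suc i) (Suc j)) * norm q ^ (Suc i * Suc j)"
    by (simp only: norm_mult norm_power)
  also have "\<dots> \<le> B * norm q ^ (i + j)"
    using q B B0 by (intro mult_mono power_decreasing) auto
  finally show "norm (case x of (i, j) \<Rightarrow> c (Suc i) (Suc j) * q ^ (Suc i * Suc j)) \<le> (case x of (i, j) \<Rightarrow> B * (norm q ^ i * norm q ^ j))"
    by (simp add: x power_add)
qed

text \<open>Rearrangement of the absolutely convergent double series over q^(n m) by the value k = n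
  m.\<close>

lemma lambert_series:
  fixes c :: "nat \<Rightarrow> nat \<Rightarrow> complex"
  assumes q: "norm q < 1" and B: "\<And>n m. norm (c n m) \<le> B"
    and f: "\<And>i. (\<lambda>j. c (Suc i) (Suc j) * q ^ (Suc i * Suc j)) sums f i"
  obtains S where "f sums S" "(\<lambda>k. (\<Sum>n | n dvd k. c n (k div n)) * q ^ k) sums S"
proof -
  define g where "g = (\<lambda>(i, j). c (Suc i) (Suc j) * q ^ (Suc i * Suc j))"
  have g: "g summable_on UNIV \<times> UNIV" using summable_on_lambert[OF q B] by (simp add: g_def)
  then obtain S where S: "(g has_sum S) (UNIV \<times> UNIV)" by (auto simp: summable_on_def)
  have "((\<lambda>j. g (i, j)) has_sum f i) UNIV" for i
  proof -
    have "(\<lambda>j. g (i, j)) summable_on UNIV"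
    proof -
      have "g summable_on Pair i ` UNIV" using g by (rule summable_on_subset_banach) auto
      then show ?thesis by (subst (asm) summable_on_reindex) (auto simp: inj_on_def o_def)
    qed
    then obtain s where "((\<lambda>j. g (i, j)) has_sum s) UNIV" by (auto simp: summable_on_def)
    moreover from has_sum_imp_sums[OF this] have "s = f i" using f[of i] sums_unique2 by (auto simp: g_def)
    ultimately show ?thesis by simp
  qed
  then have "(f has_sum S) UNIV" using has_sum_SigmaD[OF S] by blast
  then have 1: "f sums S" by (rule has_sum_imp_sums)
  define D where "D k = {n::nat. n dvd k}" for k
  have "((\<lambda>(k, n). c n (k div n) * q ^ k) has_sum S) (Sigma {0<..} D)"
    using S
  proof (rule has_sum_reindex_bij_witness[THEN iffD1, rotated -1])
    show "(\<lambda>(k, n). (n - 1, k div n - 1)) x \<in> UNIV \<times> UNIV" for x :: "nat \<times> nat" by simp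
    show "(\<lambda>(i, j). (Suc i * Suc j, Suc i)) x \<in> Sigma {0<..} D" for x by (auto simp: D_def split: prod.splits simp del: mult_Suc mult_Suc_right)
    show "(\<lambda>(k, n). (n - 1, k div n - 1)) ((\<lambda>(i, j). (Suc i * Suc j, Suc i)) x) = x" for x
      by (cases x) (simp only: split nonzero_mult_div_cancel_left[OF nat.distinct(2)] diff_Suc_1 prod.inject)
    show "(case (\<lambda>(i, j). (Suc i * Suc j, Suc i)) x of (k, n) \<Rightarrow> c n (k div n) * q ^ k) = g x" for x
      by (cases x) (simp only: split g_def nonzero_mult_div_cancel_left[OF nat.distinct(2)])
    show "(\<lambda>(i, j). (Suc i * Suc j, Suc i)) ((\<lambda>(k, n). (n - 1, k div n - 1)) x) = x" if "x \<in> Sigma {0<..} D" for x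
    proof -
      obtain k n where x: "x = (k, n)" by (cases x)
      then have kn: "k > 0" "n dvd k" using that by (auto simp: D_def)
      then obtain m where m: "k = n * m" by blast
      then have "n > 0" "m > 0" using kn by auto
      then show ?thesis by (simp add: x m del: mult_Suc mult_Suc_right)
    qed
  qed (rule refl)
  moreover have "((\<lambda>n. case (k, n) of (k, n) \<Rightarrow> c n (k div n) * q ^ k) has_sum (\<Sum>n | n dvd k. c n (k div n)) * q ^ k) (D k)"
    if "k \<in> {0<..}" for k
    using that unfolding D_def by (intro has_sum_finiteI) (auto simp: sum_distrib_right)
  ultimately have "((\<lambda>k. (\<Sum>n | n dvd k. c n (k div n)) * q ^ k) has_sum S) {0<..}"
    by (rule has_sum_SigmaD)
  \<comment> \<open>At k = 0 every n divides k, and the sum over this infinite set is 0 by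
    convention, so the new term is harmless.\<close>
  then have "((\<lambda>k. (\<Sum>n | n dvd k. c n (k div n)) * q ^ k) has_sum S) UNIV"
    by (rule has_sum_cong_neutral[THEN iffD1, rotated -1]) auto
  then show ?thesis using that[OF 1] has_sum_imp_sums by blast
qed

lemma Ln_one_minus_sums:
  assumes "norm (z::complex) < 1"
  shows "(\<lambda>j. z ^ Suc j / of_nat (Suc j)) sums (- Ln (1 - z))"
proof -
  have "(\<lambda>n. - ((- (- z)) ^ n) / of_nat n) sums Ln (1 + (- z))"
    using assms by (intro Ln_series') simp
  then have "(\<lambda>n. - (- ((- (- z)) ^ n) / of_nat n)) sums (- Ln (1 + (- z)))" by (rule sums_minus)
  then show ?thesis by (subst sums_Suc_iff) simp
qed

lemma norm_zeta_root [simp]: "norm (zeta_root u) = 1"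
  by (simp add: zeta_root_def)

text \<open>The coefficient of q^k in minus the logarithm of the product of 1 - \<zeta>^a q^n to the
  powers e(n, a), from the expansion of log(1 - z) with m = k/n.\<close>

definition eta_coeff :: "nat \<Rightarrow> (nat \<Rightarrow> nat \<Rightarrow> complex) \<Rightarrow> nat \<Rightarrow> complex" where
  "eta_coeff u e k = (\<Sum>n | n dvd k. \<Sum>a=1..u. e n a * zeta_root u ^ (a * (k div n)) / of_nat (k div n))"

text \<open>Each \<zeta>^a q^n has modulus below 1, so its principal logarithm is given by the power
  series, and \<open>powr\<close> is by definition the exponential of the exponent times that
  logarithm. No branch correction arises.\<close>

lemma eta_product_exp:
  assumes q: "norm q < 1" and B: "\<And>n a. norm (e n a) \<le> B"
  shows "(\<lambda>n. \<Sum>a=1..u. e (Suc n) a * Ln (1 - zeta_root u ^ a * q ^ Suc n)) sums (- (\<Sum>k. eta_coeff u e k * q ^ k))"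
    and "summable (\<lambda>k. eta_coeff u e k * q ^ k)"
    and "(\<Prod>n. \<Prod>a=1..u. (1 - zeta_root u ^ a * q ^ Suc n) powr e (Suc n) a) = exp (- (\<Sum>k. eta_coeff u e k * q ^ k))"
proof -
  define c where "c n m = (\<Sum>a=1..u. e n a * zeta_root u ^ (a * m) / of_nat m)" for n m
  define L where "L n = (\<Sum>a=1..u. e (Suc n) a * Ln (1 - zeta_root u ^ a * q ^ Suc n))" for n
  have B0: "0 \<le> B" using B[of 0 0] norm_ge_zero[of "e 0 0"] by linarith
  have "norm (c n m) \<le> of_nat u * B" for n m
  proof -
    have "norm (c n m) \<le> (\<Sum>a=1..u. norm (e n a * zeta_root u ^ (a * m) / of_nat m))"
      unfolding c_def by (rule norm_sum)
    also have "\<dots> \<le> (\<Sum>a=1..u. B)"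
    proof (rule sum_mono)
      fix a
      have "norm (e n a) / real m \<le> norm (e n a)" by (cases "m = 0") (auto simp: divide_le_eq mult_le_cancel_left1)
      then show "norm (e n a * zeta_root u ^ (a * m) / of_nat m) \<le> B"
        using B[of n a] by (simp add: norm_mult norm_divide norm_power)
    qed
    finally show ?thesis by simp
  qed
  moreover have qn: "norm (zeta_root u ^ a * q ^ Suc n) < 1" for a n
    using norm_power_mult_less_1[OF q q, of n] by (simp add: norm_mult norm_power)
  have "(\<lambda>j. c (Suc i) (Suc j) * q ^ (Suc i * Suc j)) sums (- L i)" for i
  proof -
    have "(\<lambda>j. \<Sum>a=1..u. e (Suc i) a * ((zeta_root u ^ a * q ^ Suc i) ^ Suc j / of_nat (Suc j))) sums
        (\<Sum>a=1..u. e (Suc i) a * (- Ln (1 - zeta_root u ^ a * q ^ Suc i)))"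
      by (intro sums_sum sums_mult Ln_one_minus_sums qn)
    moreover have "(\<Sum>a=1..u. e (Suc i) a * (- Ln (1 - zeta_root u ^ a * q ^ Suc i))) = - L i"
      by (simp add: L_def sum_negf)
    moreover have "(\<Sum>a=1..u. e (Suc i) a * ((zeta_root u ^ a * q ^ Suc i) ^ Suc j / of_nat (Suc j))) = c (Suc i) (Suc j) * q ^ (Suc i * Suc j)" for j
      unfolding c_def sum_distrib_right
      by (rule sum.cong[OF refl]) (simp add: power_mult_distrib power_mult[symmetric] del: power_Suc of_nat_Suc mult_Suc mult_Suc_right)
    ultimately show ?thesis by simp
  qed
  ultimately obtain S where S: "(\<lambda>i. - L i) sums S" "(\<lambda>k. (\<Sum>n | n dvd k. c n (k div n)) * q ^ k) sums S"
    using lambert_series[OF q, of c "of_nat u * B" "\<lambda>i. - L i"] by blast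
  have S2: "(\<lambda>k. eta_coeff u e k * q ^ k) sums S" using S(2) by (simp add: eta_coeff_def c_def)
  then show "summable (\<lambda>k. eta_coeff u e k * q ^ k)" by (simp add: sums_iff)
  have Ssum: "S = (\<Sum>k. eta_coeff u e k * q ^ k)" using S2 by (simp add: sums_iff)
  have L: "L sums (- S)" using sums_minus[OF S(1)] by simp
  then show "(\<lambda>n. \<Sum>a=1..u. e (Suc n) a * Ln (1 - zeta_root u ^ a * q ^ Suc n)) sums (- (\<Sum>k. eta_coeff u e k * q ^ k))"
    unfolding L_def Ssum .
  have "(\<Prod>a=1..u. (1 - zeta_root u ^ a * q ^ Suc n) powr e (Suc n) a) = exp (L n)" for n
  proof -
    have "1 - zeta_root u ^ a * q ^ Suc n \<noteq> 0" for a using qn[of a n] by auto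
    then show ?thesis unfolding L_def exp_sum[OF finite_atLeastAtMost] by (simp add: powr_def)
  qed
  then have "(\<Prod>n. \<Prod>a=1..u. (1 - zeta_root u ^ a * q ^ Suc n) powr e (Suc n) a) = (\<Prod>n. exp (L n))" by simp
  also have "\<dots> = exp (suminf L)" by (rule prodinf_exp) (use L in \<open>simp add: sums_iff\<close>)
  finally show "(\<Prod>n. \<Prod>a=1..u. (1 - zeta_root u ^ a * q ^ Suc n) powr e (Suc n) a) = exp (- (\<Sum>k. eta_coeff u e k * q ^ k))"
    using L by (simp add: sums_iff Ssum)
qed

lemma eta_series_holomorphic:
  assumes B: "\<And>n a. norm (e n a) \<le> B"
  shows "(\<lambda>q. \<Sum>k. eta_coeff u e k * q ^ k) holomorphic_on ball 0 1"
  by (rule power_series_holomorphic[where a = "eta_coeff u e"])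
     (use eta_product_exp(2)[of _ e B u, OF _ B] in \<open>auto simp: summable_sums\<close>)

lemma eta_product_holomorphic:
  assumes B: "\<And>n a. norm (e n a) \<le> B"
  shows "(\<lambda>\<tau>. \<Sum>k. eta_coeff u e k * q_of \<tau> ^ k) holomorphic_on upper_half_plane"
proof -
  have "((\<lambda>q. \<Sum>k. eta_coeff u e k * q ^ k) \<circ> q_of) holomorphic_on upper_half_plane"
    by (rule holomorphic_on_compose_gen[OF _ eta_series_holomorphic[OF B]])
       (auto intro!: holomorphic_intros simp: upper_half_plane_def norm_q_of_less_1)
  then show ?thesis by (simp add: o_def)
qed

text \<open>Regrouping by residues is done for the convergent series of logarithms. Starting at n =
  0 aligns the blocks; the exponents there are 0, which also covers b = 0, where
  \<open>qpoch\<close> may vanish.\<close>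

lemma eta_product_blocks:
  fixes e :: "nat \<Rightarrow> nat \<Rightarrow> int"
  assumes q: "norm q < 1" "q \<noteq> 0" and M: "M > 0" and e0: "\<And>a. e 0 a = 0" and per: "\<And>k b a. e (k * M + b) a = e b a"
    and B: "\<And>n a. e n a \<in> {-1, 0, 1}"
  shows "(\<Prod>n. \<Prod>a=1..u. (1 - zeta_root u ^ a * q ^ Suc n) powr of_int (e (Suc n) a))
       = (\<Prod>b<M. \<Prod>a=1..u. qpoch (zeta_root u ^ a * q ^ b) (q ^ M) powi e b a)"
proof -
  define L where "L n = (\<Sum>a=1..u. of_int (e n a) * Ln (1 - zeta_root u ^ a * q ^ n))" for n
  have B': "norm (of_int (e n a) :: complex) \<le> 1" for n a using B[of n a] by auto
  define S where "S = - (\<Sum>k. eta_coeff u (\<lambda>n a. of_int (e n a)) k * q ^ k)"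
  have "(\<lambda>n. L (Suc n)) sums S"
    unfolding L_def S_def using eta_product_exp(1)[OF q(1), of "\<lambda>n a. of_int (e n a)" 1, OF B'] .
  then have "L sums S" by (subst (asm) sums_Suc_iff) (simp add: L_def e0)
  then have G: "(\<lambda>k. sum L {k * M..<k * M + M}) sums S" by (rule sums_group[OF _ M])
  have qM: "norm (q ^ M) < 1" using q M by (simp add: norm_power power_less_one_iff)
  have LL: "(\<lambda>k. of_int (e b a) * Ln (1 - zeta_root u ^ a * q ^ (k * M + b))) sums
      (of_int (e b a) * (\<Sum>k. Ln (1 - zeta_root u ^ a * q ^ b * (q ^ M) ^ k)))" for a b
  proof (cases "b = 0")
    case False
    then have n: "norm (zeta_root u ^ a * q ^ b) < 1"
      using q by (simp add: norm_mult norm_power power_less_one_iff)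
    have "(\<lambda>k. Ln (1 - zeta_root u ^ a * q ^ b * (q ^ M) ^ k)) sums (\<Sum>k. Ln (1 - zeta_root u ^ a * q ^ b * (q ^ M) ^ k))"
      using sums_Ln_qpoch(1)[OF qM n] by (rule summable_sums)
    from sums_mult[OF this, of "of_int (e b a)"] show ?thesis
      by (simp add: power_add power_mult[symmetric] mult_ac)
  qed (simp add: e0)
  have "sum L {k * M..<k * M + M} = (\<Sum>b<M. \<Sum>a=1..u. of_int (e b a) * Ln (1 - zeta_root u ^ a * q ^ (k * M + b)))" for k
  proof -
    have "sum L {k * M..<k * M + M} = (\<Sum>b<M. L (k * M + b))"
      by (rule sum.reindex_bij_witness[of _ "\<lambda>b. k * M + b" "\<lambda>n. n - k * M"]) auto
    then show ?thesis by (simp add: L_def per)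
  qed
  then have G': "(\<lambda>k. \<Sum>b<M. \<Sum>a=1..u. of_int (e b a) * Ln (1 - zeta_root u ^ a * q ^ (k * M + b))) sums S" using G by simp
  have "(\<lambda>k. \<Sum>b<M. \<Sum>a=1..u. of_int (e b a) * Ln (1 - zeta_root u ^ a * q ^ (k * M + b))) sums
      (\<Sum>b<M. \<Sum>a=1..u. of_int (e b a) * (\<Sum>k. Ln (1 - zeta_root u ^ a * q ^ b * (q ^ M) ^ k)))"
    by (intro sums_sum LL)
  with G' have S: "S = (\<Sum>b<M. \<Sum>a=1..u. of_int (e b a) * (\<Sum>k. Ln (1 - zeta_root u ^ a * q ^ b * (q ^ M) ^ k)))"
    by (rule sums_unique2)
  have "(\<Prod>n. \<Prod>a=1..u. (1 - zeta_root u ^ a * q ^ Suc n) powr of_int (e (Suc n) a)) = exp S"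
    using eta_product_exp(3)[OF q(1), of "\<lambda>n a. of_int (e n a)" 1, OF B'] by (simp add: S_def)
  also have "\<dots> = (\<Prod>b<M. \<Prod>a=1..u. exp (of_int (e b a) * (\<Sum>k. Ln (1 - zeta_root u ^ a * q ^ b * (q ^ M) ^ k))))"
    unfolding S by (simp add: exp_sum)
  also have "\<dots> = (\<Prod>b<M. \<Prod>a=1..u. qpoch (zeta_root u ^ a * q ^ b) (q ^ M) powi e b a)"
  proof (rule prod.cong[OF refl], rule prod.cong[OF refl])
    fix b a
    show "exp (of_int (e b a) * (\<Sum>k. Ln (1 - zeta_root u ^ a * q ^ b * (q ^ M) ^ k))) = qpoch (zeta_root u ^ a * q ^ b) (q ^ M) powi e b a"
    proof (cases "b = 0")
      case False
      then have n: "norm (zeta_root u ^ a * q ^ b) < 1"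
        using q by (simp add: norm_mult norm_power power_less_one_iff)
      show ?thesis unfolding sums_Ln_qpoch(2)[OF qM n, symmetric] exp_power_int ..
    qed (simp add: e0)
  qed
  finally show ?thesis .
qed

section \<open>The eta function as a product of Siegel functions\<close>

lemma filterlim_affine_at_ioo:
  assumes "x > 0" "w > (0::real)"
  shows "filterlim (\<lambda>\<tau>. (of_real x * \<tau> + of_real y) / of_real w) at_ioo at_ioo"
proof -
  have "filterlim (\<lambda>\<tau>. x / w * Im \<tau>) at_top at_ioo"
    using assms by (intro filterlim_tendsto_pos_mult_at_top[OF tendsto_const] filterlim_filtercomap) auto
  then show ?thesis
    by (simp add: filterlim_filtercomap_iff o_def)
qed

lemma prod_powi_exp_sum:
  assumes "finite A"
  shows "(\<Prod>x\<in>A. exp (f x :: real) powi e x) = exp (\<Sum>x\<in>A. of_int (e x) * f x)"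
  using assms by (induction A rule: finite_induct) (auto simp: exp_add exp_power_int)

context real_primitive_character begin

definition M :: nat where "M = u * P"

text \<open>The exponent of the leading power of q. The set of primes dividing P equals that
  dividing N when u = 1.\<close>

definition kappa :: real where
  "kappa = (if u = 1 then (\<Prod>p\<in>prime_factors P. 1 - real p) / 24 else 0)"

definition weight :: "int \<Rightarrow> int \<Rightarrow> int" where
  "weight b a = chi b * \<psi> a"

definition eta :: "complex \<Rightarrow> complex" where
  "eta \<tau> = q_of (of_real kappa * \<tau>) *
     (\<Prod>n. \<Prod>a=1..u. (1 - zeta_root u ^ a * q_of \<tau> ^ Suc n) powr of_int (weight (int (Suc n)) (int a)))"

lemma M_gt_1: "M > 1" using uP_gt_1 by (simp add: M_def)

lemma weight_vals: "weight b a \<in> {-1, 0, 1}"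
  using chi_vals[of b] psi_vals[of a] by (auto simp: weight_def)

lemma weight_per: "weight (b + int M) a = weight b a" "weight b (a + int u) = weight b a"
  by (simp_all only: weight_def chi_per psi_per M_def)

lemma weight_0 [simp]: "weight 0 a = 0"
  by (simp add: weight_def)

lemma weight_minus: "weight (- b) (- a) = weight b a"
proof -
  have 1: "\<psi> (- a) = \<psi> (-1) * \<psi> a" for a using psi_mult[of "-1" a] by simp
  have 2: "chi (- b) = \<psi> (-1) * chi b" by (simp add: chi_def 1[of b])
  have "weight (- b) (- a) = (\<psi> (-1) * \<psi> (-1)) * weight b a"
    unfolding weight_def 2 1[of a] by (simp only: mult_ac)
  then show ?thesis unfolding psi_minus_1 by simp
qed

lemma norm_weight: "norm (of_int (weight b a) :: complex) \<le> 1"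
  using weight_vals[of b a] by auto

lemma eta_exp:
  assumes "Im \<tau> > 0"
  shows "eta \<tau> = q_of (of_real kappa * \<tau>) * exp (- (\<Sum>k. eta_coeff u (\<lambda>n a. of_int (weight (int n) (int a))) k * q_of \<tau> ^ k))"
  unfolding eta_def
  using eta_product_exp(3)[OF norm_q_of_less_1[OF assms], of "\<lambda>n a. of_int (weight (int n) (int a))" 1 u] norm_weight
  by simp

lemma eta_nonzero: "Im \<tau> > 0 \<Longrightarrow> eta \<tau> \<noteq> 0"
  by (simp add: eta_exp)

lemma eta_holomorphic: "eta holomorphic_on upper_half_plane"
proof -
  have "(\<lambda>\<tau>. q_of (of_real kappa * \<tau>) * exp (- (\<Sum>k. eta_coeff u (\<lambda>n a. of_int (weight (int n) (int a))) k * q_of \<tau> ^ k)))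
     holomorphic_on upper_half_plane"
    by (intro holomorphic_intros eta_product_holomorphic[of _ 1] norm_weight)
  then show ?thesis
    by (rule holomorphic_transform) (simp add: eta_exp upper_half_plane_def)
qed

text \<open>Identifies the Bernoulli powers of all the Siegel functions together with the leading
  power of q. For u > 1 the values of \<open>\<psi>\<close> sum to 0, which is why no such power
  occurs there.\<close>

lemma sum_weight_beta2:
  "(\<Sum>b\<in>{0..<int M}. \<Sum>a\<in>{0..<int u}. of_int (weight b a) * beta2 (of_int b / of_nat M)) = 4 * kappa / of_nat M"
proof (cases "u = 1")
  case True
  have psi: "\<psi> b = 1" for b using psi_add_mult[of 1 "b - 1"] by (simp add: True)
  have "(\<Sum>b\<in>{0..<int M}. \<Sum>a\<in>{0..<int u}. of_int (weight b a) * beta2 (of_int b / of_nat M))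
     = (\<Sum>b\<in>{0..<int P}. if coprime b (int P) then beta2 (of_int b / of_nat P) else 0)"
  proof (rule sum.cong)
    show "{0..<int M} = {0..<int P}" unfolding M_def using True by simp
    fix b
    have "real M = real P" unfolding M_def using True by simp
    then show "(\<Sum>a\<in>{0..<int u}. of_int (weight b a) * beta2 (of_int b / of_nat M)) = (if coprime b (int P) then beta2 (of_int b / of_nat P) else 0)"
      using True by (simp add: weight_def chi_def psi)
  qed
  also have "\<dots> = (\<Sum>k | k \<in> {0..<int P} \<and> coprime k (int P). beta2 (of_int k / of_nat P))"
    by (simp only: sum.inter_filter finite_atLeastLessThan_int)
  also have "\<dots> = (\<Prod>p\<in>prime_factors P. 1 - real p) / (6 * of_nat P)"
    by (rule sum_coprime_beta2[OF P_pos])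
  finally show ?thesis unfolding kappa_def M_def using True by simp
next
  case False
  have "(\<Sum>a\<in>{0..<int u}. of_int (\<psi> a) * (1::real)) = 0"
    by (rule psi_vanish[of 1]) (use False u_pos in auto)
  then have "(\<Sum>a\<in>{0..<int u}. of_int (weight b a) * r) = 0" for b and r :: real
    by (simp add: weight_def sum_distrib_left[symmetric] sum_distrib_right[symmetric] mult.assoc)
  then show ?thesis using False by (simp add: kappa_def)
qed

text \<open>The two Pochhammer factors of theta at (b/M, a/u) are those at (b, a) and (M - b, -a).
  Since \<open>weight\<close> is even, each of the two families multiplies to the modulus of the
  whole product.\<close>

lemma norm_eta_square:
  assumes \<tau>: "Im \<tau> > 0"
  shows "norm (eta \<tau>) ^ 2 = (\<Prod>b\<in>{0..<int M}. \<Prod>a\<in>{0..<int u}.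
     siegel_norm (of_int b / of_nat M) (of_int a / of_nat u) (of_nat M * \<tau>) powi weight b a)"
proof -
  define q where "q = q_of \<tau>"
  have q: "norm q < 1" "q \<noteq> 0" using norm_q_of_less_1[OF \<tau>] by (auto simp: q_def)
  have M0: "M > 0" using M_gt_1 by simp
  define g where "g b a = norm (qpoch (q_of (of_int b * \<tau> + of_int a / of_nat u)) (q ^ M))" for b a :: int
  have g_per: "g b (a + int u) = g b a" for b a
    using u_pos by (simp add: g_def add_divide_distrib q_of_add)
  define e where "e n a = weight (int n) (int a)" for n a
  define prd where "prd = (\<Prod>n. \<Prod>a=1..u. (1 - zeta_root u ^ a * q ^ Suc n) powr of_int (weight (int (Suc n)) (int a)))"
  have "prd = (\<Prod>b<M. \<Prod>a=1..u. qpoch (zeta_root u ^ a * q ^ b) (q ^ M) powi e b a)"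
    unfolding prd_def e_def[symmetric]
  proof (rule eta_product_blocks[OF q M0])
    show "e (k * M + b) a = e b a" for k b a
      using periodic_mod(2)[of "\<lambda>b. weight b (int a)" "int M" "int b" "int k"] weight_per(1)
      by (simp add: e_def algebra_simps)
  qed (use weight_vals in \<open>auto simp: e_def\<close>)
  also have "norm \<dots> = (\<Prod>b<M. \<Prod>a=1..u. g (int b) (int a) powi weight (int b) (int a))"
  proof -
    have "zeta_root u ^ a * q ^ b = q_of (of_int (int b) * \<tau> + of_int (int a) / of_nat u)" for a b
    proof -
      have "zeta_root u = q_of (1 / of_nat u)" by (simp add: zeta_root_def q_of_def)
      then show ?thesis by (simp add: q_def q_of_power q_of_add)
    qed
    then show ?thesis by (simp add: prod_norm[symmetric] norm_power_int g_def e_def)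
  qed
  also have "\<dots> = (\<Prod>b\<in>{0..<int M}. \<Prod>a\<in>{0..<int u}. g b a powi weight b a)"
  proof (rule prod.reindex_bij_witness[of _ nat int])
    fix b assume "b \<in> {..<M}"
    have "(\<Prod>a=1..u. g (int b) (int a) powi weight (int b) (int a)) = (\<Prod>k\<in>{0..<int u}. g (int b) (1 * k + 1) powi weight (int b) (1 * k + 1))"
      by (rule prod.reindex_bij_witness[of _ "\<lambda>k. nat (k + 1)" "\<lambda>a. int a - 1"]) auto
    also have "\<dots> = (\<Prod>a\<in>{0..<int u}. g (int b) a powi weight (int b) a)"
      by (rule prod_periodic_affine[of "int u" 1 "\<lambda>a. g (int b) a powi weight (int b) a"]) (use u_pos in \<open>auto simp: g_per weight_per\<close>)
    finally show "(\<Prod>a\<in>{0..<int u}. g (int b) a powi weight (int b) a) = (\<Prod>a=1..u. g (int b) (int a) powi weight (int b) (int a))" ..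
  qed auto
  finally have N1: "norm prd = (\<Prod>b\<in>{0..<int M}. \<Prod>a\<in>{0..<int u}. g b a powi weight b a)" .
  \<comment> \<open>The reflection b \<mapsto> M - b preserves 1, ..., M - 1 but not the range
    starting at 0. The terms with b = 0 have exponent 0.\<close>
  have drop0: "(\<Prod>b\<in>{0..<int M}. \<Prod>a\<in>{0..<int u}. f b a powi weight b a) = (\<Prod>b\<in>{1..<int M}. \<Prod>a\<in>{0..<int u}. f b a powi weight b a)" for f :: "int \<Rightarrow> int \<Rightarrow> real"
  proof -
    have "{0..<int M} = insert 0 {1..<int M}" using M0 by auto
    then show ?thesis by simp
  qed
  have N2: "norm prd = (\<Prod>b\<in>{0..<int M}. \<Prod>a\<in>{0..<int u}. g (int M - b) (- a) powi weight b a)"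
    unfolding N1 drop0
  proof (rule prod.reindex_bij_witness[of _ "\<lambda>b. int M - b" "\<lambda>b. int M - b"])
    fix b
    have w: "weight (int M - b) (- a) = weight b a" for a
      using weight_per(1)[of "- b" "- a"] weight_minus[of b a] by (simp add: algebra_simps)
    have "(\<Prod>a\<in>{0..<int u}. g b (- a) powi weight b (- a)) = (\<Prod>a\<in>{0..<int u}. g b a powi weight b a)"
      using prod_periodic_affine[of "int u" "-1" "\<lambda>a. g b a powi weight b a" 0] u_pos by (simp add: g_per weight_per)
    then show "(\<Prod>a\<in>{0..<int u}. g (int M - (int M - b)) (- a) powi weight (int M - b) a) = (\<Prod>a\<in>{0..<int u}. g b a powi weight b a)"
      using w[of "- a" for a] by simp
  qed auto
  have S: "siegel_norm (of_int b / of_nat M) (of_int a / of_nat u) (of_nat M * \<tau>) powi weight b a =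
     exp (- pi * (of_nat M * Im \<tau>) * beta2 (of_int b / of_nat M)) powi weight b a * (g b a powi weight b a * g (int M - b) (- a) powi weight b a)"
    if "b \<in> {0..<int M}" for a b
  proof -
    have fr: "frac (of_int b / real M) = of_int b / of_nat M" using that by (subst frac_eq) (auto simp: field_simps)
    have 1: "of_real (of_int b / of_nat M) * (of_nat M * \<tau>) + of_real (of_int a / of_nat u) = of_int b * \<tau> + of_int a / of_nat u"
      using M0 by simp
    have 2: "q ^ M / q_of (of_int b * \<tau> + of_int a / of_nat u) = q_of (of_int (int M - b) * \<tau> + of_int (- a) / of_nat u)"
      by (simp add: q_def q_of_power q_of_diff[symmetric] algebra_simps)
    have 3: "q_of (of_nat M * \<tau>) = q ^ M" by (simp add: q_def q_of_power)
    have "siegel_norm (of_int b / of_nat M) (of_int a / of_nat u) (of_nat M * \<tau>) =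
      exp (- pi * (of_nat M * Im \<tau>) * beta2 (of_int b / of_nat M)) * (g b a * g (int M - b) (- a))"
      unfolding siegel_norm_def theta_def 1 2 3 beta2_def fr g_def norm_mult by simp
    then show ?thesis by (simp add: power_int_mult_distrib)
  qed
  have "(\<Prod>b\<in>{0..<int M}. \<Prod>a\<in>{0..<int u}. siegel_norm (of_int b / of_nat M) (of_int a / of_nat u) (of_nat M * \<tau>) powi weight b a)
     = (\<Prod>b\<in>{0..<int M}. \<Prod>a\<in>{0..<int u}. exp (- pi * (of_nat M * Im \<tau>) * beta2 (of_int b / of_nat M)) powi weight b a) * (norm prd * norm prd)"
    unfolding arg_cong2[OF N1 N2, of "(*)"] prod.distrib[symmetric]
    by (rule prod.cong[OF refl], rule prod.cong[OF refl]) (simp add: S)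
  also have "(\<Prod>b\<in>{0..<int M}. \<Prod>a\<in>{0..<int u}. exp (- pi * (of_nat M * Im \<tau>) * beta2 (of_int b / of_nat M)) powi weight b a)
      = exp (- pi * (of_nat M * Im \<tau>) * (4 * kappa / of_nat M))"
    unfolding sum_weight_beta2[symmetric] sum_distrib_left
    by (simp add: prod_powi_exp_sum exp_sum mult_ac)
  also have "\<dots> = norm (q_of (of_real kappa * \<tau>)) ^ 2"
    using M0 by (simp add: norm_q_of exp_add[symmetric] power2_eq_square)
  finally show ?thesis
    unfolding eta_def q_def[symmetric] prd_def[symmetric] by (simp add: norm_mult power2_eq_square)
qed

text \<open>Modulo 1 the conjugated matrix sends (x/M, y/u) to (ax/M, dy/u), since u divides c/M.
  Multiplication by a and by d permutes residues, and ad is 1 modulo u, so \<psi>(a) \<psi>(d) = 1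
  and the exponent is preserved.\<close>

lemma norm_eta_invariant:
  assumes det: "a * d - b * c = (1::int)" and c: "int (u ^ 2 * P) dvd c" and \<tau>: "Im \<tau> > 0"
    and A\<tau>: "Im ((of_int a * \<tau> + of_int b) / (of_int c * \<tau> + of_int d)) > 0"
  shows "norm (eta ((of_int a * \<tau> + of_int b) / (of_int c * \<tau> + of_int d))) = norm (eta \<tau>)"
proof -
  have M0: "M > 0" using M_gt_1 by simp
  obtain c2 where "c = int (u ^ 2 * P) * c2" using c by blast
  then have c2: "c = int M * (int u * c2)" by (simp add: M_def power2_eq_square mult_ac)
  define B where "B = int M * b"
  define C where "C = int u * c2"
  have det': "a * d - B * C = 1" using det by (simp add: B_def C_def c2 mult_ac)
  have "coprime a (int M)"
  proof (rule coprimeI)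
    fix k assume "k dvd a" "k dvd int M"
    then have "k dvd a * d - B * C" by (auto simp: B_def)
    then show "is_unit k" using det' by simp
  qed
  then have ca: "coprime a (int u)" "coprime a (int P)" by (auto simp: M_def)
  have "coprime d (int u)"
  proof (rule coprimeI)
    fix k assume "k dvd d" "k dvd int u"
    then have "k dvd a * d - B * C" by (auto simp: C_def)
    then show "is_unit k" using det' by simp
  qed
  note cd = this
  have "\<psi> (a * d) = \<psi> (1 + int u * (B * c2))"
    using det' by (intro arg_cong[of _ _ \<psi>]) (simp add: C_def algebra_simps)
  then have "\<psi> a * \<psi> d = 1" by (simp add: psi_mult psi_add_mult)
  then have w: "weight (a * x) (d * y) = weight x y" for x y
    using ca by (simp add: weight_def chi_def psi_mult mult_ac)
  define H where "H x y = siegel_norm (of_int x / of_nat M) (of_int y / of_nat u) (of_nat M * \<tau>) powi weight x y" for x y :: int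
  have M\<tau>: "Im (of_nat M * \<tau>) > 0" using \<tau> M0 by simp
  have H1: "H (x + int M) y = H x y" for x y
    using siegel_norm_add_int[OF M\<tau>, of "of_int x / of_nat M" 1 "of_int y / of_nat u" 0] M0
    by (simp add: H_def weight_per add_divide_distrib)
  have H2: "H x (y + int u) = H x y" for x y
    using siegel_norm_add_int[OF M\<tau>, of "of_int x / of_nat M" 0 "of_int y / of_nat u" 1] u_pos
    by (simp add: H_def weight_per add_divide_distrib)
  have eq: "of_nat M * ((of_int a * \<tau> + of_int b) / (of_int c * \<tau> + of_int d)) =
     (of_int a * (of_nat M * \<tau>) + of_int B) / (of_int C * (of_nat M * \<tau>) + of_int d)"
    by (simp add: B_def C_def c2 algebra_simps)
  have "norm (eta ((of_int a * \<tau> + of_int b) / (of_int c * \<tau> + of_int d))) ^ 2 = (\<Prod>x\<in>{0..<int M}. \<Prod>y\<in>{0..<int u}. H (a * x) (d * y))"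
    unfolding norm_eta_square[OF A\<tau>]
  proof (rule prod.cong[OF refl], rule prod.cong[OF refl])
    fix x y
    have "siegel_norm (of_int x / of_nat M) (of_int y / of_nat u) (of_nat M * ((of_int a * \<tau> + of_int b) / (of_int c * \<tau> + of_int d)))
       = siegel_norm (of_int x / of_nat M * of_int a + of_int y / of_nat u * of_int C) (of_int x / of_nat M * of_int B + of_int y / of_nat u * of_int d) (of_nat M * \<tau>)"
      unfolding eq by (rule siegel_norm_modular[OF det' M\<tau>])
    also have "\<dots> = siegel_norm (of_int (a * x) / of_nat M + of_int (y * c2)) (of_int (d * y) / of_nat u + of_int (x * b)) (of_nat M * \<tau>)"
      using M0 u_pos by (intro arg_cong3[of _ _ _ _ _ _ siegel_norm]) (simp_all add: B_def C_def field_simps)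
    also have "\<dots> = siegel_norm (of_int (a * x) / of_nat M) (of_int (d * y) / of_nat u) (of_nat M * \<tau>)"
      by (rule siegel_norm_add_int[OF M\<tau>])
    finally show "siegel_norm (of_int x / of_nat M) (of_int y / of_nat u) (of_nat M * ((of_int a * \<tau> + of_int b) / (of_int c * \<tau> + of_int d))) powi weight x y = H (a * x) (d * y)"
      by (simp add: H_def w)
  qed
  also have "\<dots> = (\<Prod>x\<in>{0..<int M}. \<Prod>y\<in>{0..<int u}. H (a * x) y)"
    using prod_periodic_affine[of "int u" d "\<lambda>y. H x y" 0 for x] u_pos cd H2 by simp
  also have "\<dots> = (\<Prod>x\<in>{0..<int M}. \<Prod>y\<in>{0..<int u}. H x y)"
    using prod_periodic_affine[of "int M" a "\<lambda>x. \<Prod>y\<in>{0..<int u}. H x y" 0] M0 \<open>coprime a (int M)\<close> H1 by simp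
  also have "\<dots> = norm (eta \<tau>) ^ 2" unfolding norm_eta_square[OF \<tau>] H_def ..
  finally show ?thesis by simp
qed

text \<open>The order measured in exp(2 \<pi> i \<tau>) after the cusp is moved to infinity;
  multiplying by the width gives the order in the local parameter. The factor comes from Im \<sigma>
  = (x^2/M) Im \<tau>, halved because the Siegel product is the squared modulus and halved again
  because a Siegel function has exponent one half of the Bernoulli value.\<close>

definition cusp_order :: "int \<Rightarrow> int \<Rightarrow> real" where
  "cusp_order \<alpha> \<gamma> = of_int (gcd (int (u * P)) \<gamma>) ^ 2 / (4 * real (u * P)) * cusp_sum \<alpha> \<gamma>"

lemma eta_cusp_asymp:
  assumes det: "\<alpha> * \<delta> - \<beta> * \<gamma> = (1::int)"
    and up: "\<And>\<tau>. Im \<tau> > 0 \<Longrightarrow> Im ((of_int \<alpha> * \<tau> + of_int \<beta>) / (of_int \<gamma> * \<tau> + of_int \<delta>)) > 0"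
  obtains L where "L > 0"
    "((\<lambda>\<tau>. norm (eta ((of_int \<alpha> * \<tau> + of_int \<beta>) / (of_int \<gamma> * \<tau> + of_int \<delta>))) * exp (2 * pi * cusp_order \<alpha> \<gamma> * Im \<tau>)) \<longlongrightarrow> L) at_ioo"
proof -
  have M0: "M > 0" using M_gt_1 by simp
  define A where "A \<tau> = (of_int \<alpha> * \<tau> + of_int \<beta>) / (of_int \<gamma> * \<tau> + of_int \<delta>)" for \<tau> :: complex
  \<comment> \<open>The matrix with rows \<open>(M \<alpha>, M \<beta>)\<close>, \<open>(\<gamma>, \<delta>)\<close> is the unimodular matrix with rows \<open>(\<alpha>', \<beta>')\<close>, \<open>(\<gamma>', \<delta>')\<close>
      times the triangular one with rows \<open>(x, y)\<close>, \<open>(0, w)\<close>.\<close>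
  define x where "x = gcd (int M) \<gamma>"
  have x0: "x > 0" using M0 by (simp add: x_def)
  have "coprime \<alpha> \<gamma>"
  proof (rule coprimeI)
    fix k assume "k dvd \<alpha>" "k dvd \<gamma>"
    then have "k dvd \<alpha> * \<delta> - \<beta> * \<gamma>" by auto
    then show "is_unit k" using det by simp
  qed
  obtain m where m: "int M = x * m" using x_def by (metis dvdE gcd_dvd1)
  obtain \<gamma>' where \<gamma>': "\<gamma> = x * \<gamma>'" using x_def by (metis dvdE gcd_dvd2)
  define \<alpha>' where "\<alpha>' = m * \<alpha>"
  have "x * gcd m \<gamma>' = x"
    using x0 unfolding gcd_mult_distrib_int[symmetric] x_def[symmetric] by (metis abs_of_pos gcd_mult_distrib_int m \<gamma>' x_def)
  then have "coprime m \<gamma>'" using x0 by (simp add: coprime_iff_gcd_eq_1)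
  moreover have "coprime \<alpha> \<gamma>'" using \<open>coprime \<alpha> \<gamma>\<close> \<gamma>' by simp
  ultimately have "coprime \<alpha>' \<gamma>'" by (simp add: \<alpha>'_def)
  then obtain \<delta>' \<beta>'' where bez: "\<delta>' * \<alpha>' + \<beta>'' * \<gamma>' = 1" using bezout_int[of \<alpha>' \<gamma>'] by (auto simp: coprime_iff_gcd_eq_1)
  define \<beta>' where "\<beta>' = - \<beta>''"
  have det': "\<alpha>' * \<delta>' - \<beta>' * \<gamma>' = 1" using bez by (simp add: \<beta>'_def mult_ac)
  define y where "y = \<delta>' * int M * \<beta> - \<beta>' * \<delta>"
  define w where "w = \<alpha>' * \<delta> - \<gamma>' * int M * \<beta>"
  have xw: "x * w = int M"
  proof -
    have "x * w = int M * (\<alpha> * \<delta> - \<beta> * \<gamma>)" by (simp add: w_def \<alpha>'_def \<gamma>' m algebra_simps)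
    then show ?thesis using det by simp
  qed
  have w0: "w > 0" using xw x0 M0 by (metis of_nat_0_less_iff zero_less_mult_pos)
  define \<sigma> where "\<sigma> \<tau> = (of_real (of_int x) * \<tau> + of_real (of_int y)) / of_real (of_int w)" for \<tau> :: complex
  have Im\<sigma>: "Im (\<sigma> \<tau>) = of_int x / of_int w * Im \<tau>" for \<tau> by (simp add: \<sigma>_def)
  have MA: "of_nat M * A \<tau> = (of_int \<alpha>' * \<sigma> \<tau> + of_int \<beta>') / (of_int \<gamma>' * \<sigma> \<tau> + of_int \<delta>')" for \<tau>
  proof -
    have i1: "\<alpha>' * y + \<beta>' * w = int M * \<beta>"
    proof -
      have "\<alpha>' * y + \<beta>' * w = int M * \<beta> * (\<alpha>' * \<delta>' - \<beta>' * \<gamma>')" by (simp add: y_def w_def algebra_simps)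
      then show ?thesis unfolding det' by simp
    qed
    have i2: "\<gamma>' * y + \<delta>' * w = \<delta>"
    proof -
      have "\<gamma>' * y + \<delta>' * w = \<delta> * (\<alpha>' * \<delta>' - \<beta>' * \<gamma>')" by (simp add: y_def w_def algebra_simps)
      then show ?thesis unfolding det' by simp
    qed
    have w0': "(of_int w :: complex) \<noteq> 0" using w0 by simp
    have n1: "of_int \<alpha>' * \<sigma> \<tau> + of_int \<beta>' = (of_nat M * (of_int \<alpha> * \<tau> + of_int \<beta>)) / of_int w"
    proof -
      have "of_int \<alpha>' * \<sigma> \<tau> + of_int \<beta>' = (of_int (\<alpha>' * x) * \<tau> + of_int (\<alpha>' * y + \<beta>' * w)) / of_int w"
        using w0' by (simp add: \<sigma>_def field_simps)
      also have "\<alpha>' * x = int M * \<alpha>" by (simp add: \<alpha>'_def m)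
      finally show ?thesis unfolding i1 by (simp add: algebra_simps)
    qed
    have n2: "of_int \<gamma>' * \<sigma> \<tau> + of_int \<delta>' = (of_int \<gamma> * \<tau> + of_int \<delta>) / of_int w"
    proof -
      have "of_int \<gamma>' * \<sigma> \<tau> + of_int \<delta>' = (of_int (\<gamma>' * x) * \<tau> + of_int (\<gamma>' * y + \<delta>' * w)) / of_int w"
        using w0' by (simp add: \<sigma>_def field_simps)
      also have "\<gamma>' * x = \<gamma>" by (simp add: \<gamma>')
      finally show ?thesis unfolding i2 .
    qed
    show ?thesis unfolding n1 n2 A_def using w0' by simp
  qed
  define r where "r b a = of_int b / of_nat M * of_int \<alpha>' + of_int a / of_nat u * real_of_int \<gamma>'" for b a :: int
  define s where "s b a = of_int b / of_nat M * of_int \<beta>' + of_int a / of_nat u * real_of_int \<delta>'" for b a :: int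
  have r: "r b a = of_int (b * \<alpha>) / of_int x + of_int (a * \<gamma>) / of_int (int u * x)" for b a
  proof -
    have "real M = of_int x * of_int m" using m by (metis of_int_mult of_int_of_nat_eq)
    moreover have "m > 0" using m x0 M0 by (metis of_nat_0_less_iff zero_less_mult_pos)
    ultimately show ?thesis using x0 u_pos by (simp add: r_def \<alpha>'_def \<gamma>')
  qed
  \<comment> \<open>Undoing the unimodular matrix recovers b/M from r and s, so integral coordinates
    would force M to divide b, where \<open>chi\<close> vanishes.\<close>
  have nonint: "\<not> (r b a \<in> \<int> \<and> s b a \<in> \<int>)" if "weight b a \<noteq> 0" for b a
  proof
    assume "r b a \<in> \<int> \<and> s b a \<in> \<int>"
    then have "r b a * of_int \<delta>' - s b a * of_int \<gamma>' \<in> \<int>" by auto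
    moreover have "r b a * of_int \<delta>' - s b a * of_int \<gamma>' = of_int b / of_nat M * of_int (\<alpha>' * \<delta>' - \<beta>' * \<gamma>')"
      by (simp add: r_def s_def algebra_simps)
    ultimately obtain k where "of_int b / real M = of_int k" unfolding det' by (auto elim: Ints_cases)
    then have "real_of_int b = of_int (0 + int M * k)" using M0 by (simp add: field_simps)
    then have "b = 0 + int M * k" by (simp only: of_int_eq_iff)
    then have "chi b = chi 0" using periodic_mod(2)[of chi "int M" 0 k] chi_per by (simp add: M_def)
    then show False using that by (simp add: weight_def)
  qed
  have "\<exists>L. L > 0 \<and> ((\<lambda>\<tau>. (siegel_norm (r b a) (s b a) (\<sigma> \<tau>) * exp (pi * Im (\<sigma> \<tau>) * beta2 (r b a))) powi weight b a) \<longlongrightarrow> L) at_ioo" for b a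
  proof (cases "weight b a = 0")
    case True then show ?thesis by (intro exI[of _ 1]) auto
  next
    case False
    obtain L where L: "L > 0" "((\<lambda>\<tau>. siegel_norm (r b a) (s b a) \<tau> * exp (pi * Im \<tau> * beta2 (r b a))) \<longlongrightarrow> L) at_ioo"
      using siegel_norm_asymp[OF nonint[OF False]] by blast
    have "filterlim \<sigma> at_ioo at_ioo" unfolding \<sigma>_def using x0 w0 by (intro filterlim_affine_at_ioo) auto
    from filterlim_compose[OF L(2) this] L(1) show ?thesis
      by (intro exI[of _ "L powi weight b a"]) (auto intro!: tendsto_power_int zero_less_power_int)
  qed
  then have "\<exists>Lf. \<forall>b a. Lf b a > 0 \<and> ((\<lambda>\<tau>. (siegel_norm (r b a) (s b a) (\<sigma> \<tau>) * exp (pi * Im (\<sigma> \<tau>) * beta2 (r b a))) powi weight b a) \<longlongrightarrow> Lf b a) at_ioo"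
    by - (rule choice, rule allI, rule choice, rule allI)
  then obtain Lf where Lf: "\<And>b a. Lf b a > 0" "\<And>b a. ((\<lambda>\<tau>. (siegel_norm (r b a) (s b a) (\<sigma> \<tau>) * exp (pi * Im (\<sigma> \<tau>) * beta2 (r b a))) powi weight b a) \<longlongrightarrow> Lf b a) at_ioo"
    by blast
  define L where "L = (\<Prod>b\<in>{0..<int M}. \<Prod>a\<in>{0..<int u}. Lf b a)"
  have L0: "L > 0" unfolding L_def by (intro prod_pos ballI Lf)
  have lim: "((\<lambda>\<tau>. \<Prod>b\<in>{0..<int M}. \<Prod>a\<in>{0..<int u}. (siegel_norm (r b a) (s b a) (\<sigma> \<tau>) * exp (pi * Im (\<sigma> \<tau>) * beta2 (r b a))) powi weight b a) \<longlongrightarrow> L) at_ioo"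
    unfolding L_def by (intro tendsto_prod Lf)
  have "((\<lambda>\<tau>. (norm (eta (A \<tau>)) * exp (2 * pi * cusp_order \<alpha> \<gamma> * Im \<tau>)) ^ 2) \<longlongrightarrow> L) at_ioo"
    using lim
  proof (rule Lim_transform_eventually)
    show "\<forall>\<^sub>F \<tau> in at_ioo. (\<Prod>b\<in>{0..<int M}. \<Prod>a\<in>{0..<int u}. (siegel_norm (r b a) (s b a) (\<sigma> \<tau>) * exp (pi * Im (\<sigma> \<tau>) * beta2 (r b a))) powi weight b a)
       = (norm (eta (A \<tau>)) * exp (2 * pi * cusp_order \<alpha> \<gamma> * Im \<tau>)) ^ 2"
      using eventually_Im_gt[of 0]
    proof eventually_elim
      case (elim \<tau>)
      have \<sigma>0: "Im (\<sigma> \<tau>) > 0" using elim x0 w0 by (simp add: Im\<sigma>)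
      have "norm (eta (A \<tau>)) ^ 2 = (\<Prod>b\<in>{0..<int M}. \<Prod>a\<in>{0..<int u}. siegel_norm (r b a) (s b a) (\<sigma> \<tau>) powi weight b a)"
        unfolding norm_eta_square[OF up[OF elim], folded A_def] MA r_def s_def siegel_norm_modular[OF det' \<sigma>0] ..
      moreover have "(\<Prod>b\<in>{0..<int M}. \<Prod>a\<in>{0..<int u}. exp (pi * Im (\<sigma> \<tau>) * beta2 (r b a)) powi weight b a)
          = exp (2 * pi * cusp_order \<alpha> \<gamma> * Im \<tau>) ^ 2"
      proof -
        have cs: "cusp_sum \<alpha> \<gamma> = (\<Sum>b\<in>{0..<int M}. \<Sum>a\<in>{0..<int u}. of_int (weight b a) * beta2 (r b a))"
          unfolding cusp_sum_def M_def[symmetric] x_def[symmetric] Let_def r weight_def ..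
        have "(\<Prod>b\<in>{0..<int M}. \<Prod>a\<in>{0..<int u}. exp (pi * Im (\<sigma> \<tau>) * beta2 (r b a)) powi weight b a)
           = exp (pi * Im (\<sigma> \<tau>) * cusp_sum \<alpha> \<gamma>)"
          unfolding cs sum_distrib_left by (simp add: prod_powi_exp_sum exp_sum mult_ac)
        also have "pi * Im (\<sigma> \<tau>) * cusp_sum \<alpha> \<gamma> = 2 * pi * cusp_order \<alpha> \<gamma> * Im \<tau> + 2 * pi * cusp_order \<alpha> \<gamma> * Im \<tau>"
        proof -
          have "real (u * P) = of_int x * of_int w" using xw by (metis M_def of_int_mult of_int_of_nat_eq)
          then have "cusp_order \<alpha> \<gamma> = of_int x ^ 2 / (4 * (of_int x * of_int w)) * cusp_sum \<alpha> \<gamma>"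
            unfolding cusp_order_def M_def[symmetric] x_def[symmetric] by (simp add: M_def)
          then show ?thesis using x0 w0 by (simp add: Im\<sigma> field_simps power2_eq_square)
        qed
        finally show ?thesis by (simp only: exp_add power2_eq_square)
      qed
      ultimately show ?case by (simp add: power_int_mult_distrib prod.distrib power_mult_distrib)
    qed
  qed
  from tendsto_real_sqrt[OF this] have "((\<lambda>\<tau>. norm (eta (A \<tau>)) * exp (2 * pi * cusp_order \<alpha> \<gamma> * Im \<tau>)) \<longlongrightarrow> sqrt L) at_ioo"
    by (simp add: real_sqrt_abs abs_mult)
  then show ?thesis using that[of "sqrt L"] L0 by (simp add: A_def)
qed

end

section \<open>The modular group\<close>

definition mat2 :: "int \<Rightarrow> int \<Rightarrow> int \<Rightarrow> int \<Rightarrow> int^2^2" where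
  "mat2 a b c d = vector [vector [a, b], vector [c, d]]"

lemma mat2_nth [simp]:
  "mat2 a b c d $ 1 $ 1 = a" "mat2 a b c d $ 1 $ 2 = b" "mat2 a b c d $ 2 $ 1 = c" "mat2 a b c d $ 2 $ 2 = d"
  by (simp_all add: mat2_def)

lemma mat2_eta: "A = mat2 (A $ 1 $ 1) (A $ 1 $ 2) (A $ 2 $ 1) (A $ 2 $ 2)"
  by (simp add: vec_eq_iff forall_2)

lemma mat2_eq_iff: "A = B \<longleftrightarrow> A $ 1 $ 1 = B $ 1 $ 1 \<and> A $ 1 $ 2 = B $ 1 $ 2 \<and> A $ 2 $ 1 = B $ 2 $ 1 \<and> A $ 2 $ 2 = B $ 2 $ 2"
  for A B :: "int^2^2"
  by (auto simp: vec_eq_iff forall_2)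

lemma matmul_nth: "(A ** B) $ i $ j = A $ i $ 1 * B $ 1 $ j + A $ i $ 2 * B $ 2 $ j" for A B :: "int^2^2"
  by (simp add: matrix_matrix_mult_def sum_2)

lemma translation_eq: "translation h = mat2 1 h 0 1"
  by (simp add: translation_def mat2_def)

lemma mat_1_eq: "(mat 1 :: int^2^2) = mat2 1 0 0 1"
  by (simp add: mat2_eq_iff mat_def)

lemma SL2Z_carrier: "A \<in> carrier SL2Z \<longleftrightarrow> A $ 1 $ 1 * A $ 2 $ 2 - A $ 1 $ 2 * A $ 2 $ 1 = 1"
  by (simp add: SL2Z_def det_2)

lemma SL2Z_mult [simp]: "A \<otimes>\<^bsub>SL2Z\<^esub> B = A ** B"
  by (simp add: SL2Z_def)

lemma SL2Z_one [simp]: "\<one>\<^bsub>SL2Z\<^esub> = mat 1"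
  by (simp add: SL2Z_def)

text \<open>The adjugate, an explicit inverse for determinant 1.\<close>

definition adj2 :: "int^2^2 \<Rightarrow> int^2^2" where
  "adj2 A = mat2 (A $ 2 $ 2) (- (A $ 1 $ 2)) (- (A $ 2 $ 1)) (A $ 1 $ 1)"

lemma adj2_carrier: "A \<in> carrier SL2Z \<Longrightarrow> adj2 A \<in> carrier SL2Z"
  by (simp add: SL2Z_carrier adj2_def algebra_simps)

lemma adj2_mult: "A \<in> carrier SL2Z \<Longrightarrow> adj2 A ** A = mat 1"
  by (simp add: SL2Z_carrier adj2_def mat_1_eq mat2_eq_iff matmul_nth algebra_simps)

lemma SL2Z_mult_closed: "A \<in> carrier SL2Z \<Longrightarrow> B \<in> carrier SL2Z \<Longrightarrow> A ** B \<in> carrier SL2Z"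
  by (simp add: SL2Z_def det_mul)

lemma group_SL2Z: "group SL2Z"
proof (rule groupI)
  fix A assume "A \<in> carrier SL2Z"
  then show "\<exists>B\<in>carrier SL2Z. B \<otimes>\<^bsub>SL2Z\<^esub> A = \<one>\<^bsub>SL2Z\<^esub>"
    using adj2_carrier adj2_mult by auto
next
  show "\<one>\<^bsub>SL2Z\<^esub> \<in> carrier SL2Z" by (simp add: SL2Z_carrier mat_1_eq)
qed (simp_all add: SL2Z_mult_closed matrix_mul_assoc)

lemma inv_SL2Z: "A \<in> carrier SL2Z \<Longrightarrow> inv\<^bsub>SL2Z\<^esub> A = adj2 A"
  using group.inv_equality[OF group_SL2Z, of "adj2 A" A] adj2_mult adj2_carrier by simp

lemma mult_adj2: "A \<in> carrier SL2Z \<Longrightarrow> A ** adj2 A = mat 1"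
  by (simp add: SL2Z_carrier adj2_def mat_1_eq mat2_eq_iff matmul_nth algebra_simps)

lemma Gamma0_iff: "A \<in> Gamma0 Q \<longleftrightarrow> A \<in> carrier SL2Z \<and> int Q dvd A $ 2 $ 1"
  by (simp add: Gamma0_def)

lemma Gamma0_mult: "A \<in> Gamma0 Q \<Longrightarrow> B \<in> Gamma0 Q \<Longrightarrow> A ** B \<in> Gamma0 Q"
  by (auto simp: Gamma0_iff SL2Z_mult_closed matmul_nth)

lemma Gamma0_adj2: "A \<in> Gamma0 Q \<Longrightarrow> adj2 A \<in> Gamma0 Q"
  by (auto simp: Gamma0_iff adj2_carrier) (simp add: adj2_def)

lemma Gamma0_mat_1: "mat 1 \<in> Gamma0 Q"
  by (simp add: Gamma0_iff mat_1_eq SL2Z_carrier)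

lemma subgroup_Gamma0: "subgroup (Gamma0 Q) SL2Z"
  by (rule subgroup.intro)
     (auto simp: Gamma0_mult Gamma0_mat_1 Gamma0_adj2 inv_SL2Z Gamma0_iff[THEN iffD1])

text \<open>A coset of \<open>\<Gamma>\<^sub>0(Q)\<close> depends only on the entries of a representative modulo \<open>Q\<close>.\<close>

lemma finite_index_Gamma0:
  assumes "Q > 0"
  shows "finite_index (Gamma0 Q)"
proof -
  interpret group SL2Z by (rule group_SL2Z)
  define \<phi> where "\<phi> A = (A $ 1 $ 1 mod int Q, A $ 1 $ 2 mod int Q, A $ 2 $ 1 mod int Q, A $ 2 $ 2 mod int Q)" for A :: "int^2^2"
  define F where "F A = Gamma0 Q #>\<^bsub>SL2Z\<^esub> A" for A
  have eq: "F A = F B" if A: "A \<in> carrier SL2Z" and B: "B \<in> carrier SL2Z" and "\<phi> A = \<phi> B" for A B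
  proof -
    have 1: "[A $ 2 $ 1 = B $ 2 $ 1] (mod int Q)" "[A $ 2 $ 2 = B $ 2 $ 2] (mod int Q)"
      using that by (auto simp: \<phi>_def cong_def)
    have "[A $ 2 $ 1 * B $ 2 $ 2 - A $ 2 $ 2 * B $ 2 $ 1 = B $ 2 $ 1 * B $ 2 $ 2 - B $ 2 $ 2 * B $ 2 $ 1] (mod int Q)"
      by (intro cong_diff cong_mult 1 cong_refl)
    then have "int Q dvd (A ** adj2 B) $ 2 $ 1"
      by (simp add: matmul_nth adj2_def cong_iff_dvd_diff mult.commute)
    then have m: "A ** adj2 B \<in> Gamma0 Q"
      using A B by (simp add: Gamma0_iff SL2Z_mult_closed adj2_carrier)
    have "A = (A ** adj2 B) ** B"
      using B by (simp add: matrix_mul_assoc[symmetric] adj2_mult)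
    then have "A \<in> F B" unfolding F_def r_coset_def using m by auto
    then show ?thesis unfolding F_def using repr_independence[OF _ B subgroup_Gamma0] by simp
  qed
  have "F ` carrier SL2Z = (\<lambda>t. F (inv_into (carrier SL2Z) \<phi> t)) ` (\<phi> ` carrier SL2Z)"
    unfolding image_image
    by (rule image_cong[OF refl], rule eq) (auto simp: inv_into_into f_inv_into_f)
  moreover have "finite (\<phi> ` carrier SL2Z)"
  proof (rule finite_subset)
    show "\<phi> ` carrier SL2Z \<subseteq> {0..<int Q} \<times> {0..<int Q} \<times> {0..<int Q} \<times> {0..<int Q}"
      using assms by (auto simp: \<phi>_def)
  qed auto
  ultimately have "finite (F ` carrier SL2Z)" by simp
  moreover have "rcosets\<^bsub>SL2Z\<^esub> (Gamma0 Q) = F ` carrier SL2Z"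
    unfolding RCOSETS_def F_def by auto
  ultimately show ?thesis by (simp add: finite_index_def subgroup_Gamma0)
qed

section \<open>The action on the upper half-plane and its parabolic elements\<close>

lemma moeb_denom_nonzero:
  assumes "A \<in> carrier SL2Z" "Im \<tau> > 0"
  shows "of_int (A $ 2 $ 1) * \<tau> + of_int (A $ 2 $ 2) \<noteq> 0"
proof
  assume 0: "of_int (A $ 2 $ 1) * \<tau> + of_int (A $ 2 $ 2) = 0"
  from arg_cong[OF 0, of Im] assms(2) have c: "A $ 2 $ 1 = 0" by simp
  with arg_cong[OF 0, of Re] have "A $ 2 $ 2 = 0" by simp
  with c assms(1) show False by (simp add: SL2Z_carrier)
qed

lemma Im_moeb_pos:
  assumes "A \<in> carrier SL2Z" "Im \<tau> > 0"
  shows "Im (moeb A \<tau>) > 0"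
proof -
  define a b c d where "a = A $ 1 $ 1" "b = A $ 1 $ 2" "c = A $ 2 $ 1" "d = A $ 2 $ 2"
  define z where "z = of_int c * \<tau> + of_int d"
  have z: "z \<noteq> 0" using moeb_denom_nonzero[OF assms] by (simp add: z_def a_b_c_d_def)
  have det: "real_of_int a * of_int d - of_int b * of_int c = 1"
    using assms(1) unfolding SL2Z_carrier a_b_c_d_def[symmetric] by (metis of_int_1 of_int_diff of_int_mult)
  have "Im (moeb A \<tau>) = Im ((of_int a * \<tau> + of_int b) * cnj z) / (norm z)\<^sup>2"
    unfolding moeb_def a_b_c_d_def[symmetric] z_def[symmetric]
    by (subst complex_div_cnj) (simp only: Im_divide_of_real of_real_power[symmetric])
  also have "Im ((of_int a * \<tau> + of_int b) * cnj z) = (real_of_int a * of_int d - of_int b * of_int c) * Im \<tau>"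
    by (simp add: z_def algebra_simps)
  finally show ?thesis using det assms(2) z by simp
qed

lemma moeb_mult:
  assumes "A \<in> carrier SL2Z" "B \<in> carrier SL2Z" "Im \<tau> > 0"
  shows "moeb (A ** B) \<tau> = moeb A (moeb B \<tau>)"
proof -
  define z where "z = of_int (B $ 2 $ 1) * \<tau> + of_int (B $ 2 $ 2)"
  define n where "n = of_int (B $ 1 $ 1) * \<tau> + of_int (B $ 1 $ 2)"
  have z: "z \<noteq> 0" using moeb_denom_nonzero[OF assms(2,3)] by (simp add: z_def)
  have B: "moeb B \<tau> = n / z" by (simp add: moeb_def n_def z_def)
  have "moeb A (moeb B \<tau>) = ((of_int (A $ 1 $ 1) * n + of_int (A $ 1 $ 2) * z) / z) / ((of_int (A $ 2 $ 1) * n + of_int (A $ 2 $ 2) * z) / z)"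
    unfolding B unfolding moeb_def using z by (simp add: add_divide_distrib)
  also have "\<dots> = (of_int (A $ 1 $ 1) * n + of_int (A $ 1 $ 2) * z) / (of_int (A $ 2 $ 1) * n + of_int (A $ 2 $ 2) * z)"
    using z by simp
  also have "\<dots> = moeb (A ** B) \<tau>" by (simp add: moeb_def matmul_nth n_def z_def algebra_simps)
  finally show ?thesis ..
qed

lemma moeb_mat_1 [simp]: "moeb (mat 1) \<tau> = \<tau>"
  by (simp add: moeb_def mat_1_eq)

lemma moeb_translation [simp]: "moeb (translation h) \<tau> = \<tau> + of_int h"
  by (simp add: moeb_def translation_eq)

lemma translation_carrier: "translation h \<in> carrier SL2Z"
  by (simp add: SL2Z_carrier translation_eq)

definition conj_translation :: "int^2^2 \<Rightarrow> int \<Rightarrow> int^2^2" where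
  "conj_translation A h = A ** translation h ** adj2 A"

lemma conj_translation_carrier: "A \<in> carrier SL2Z \<Longrightarrow> conj_translation A h \<in> carrier SL2Z"
  by (simp add: conj_translation_def SL2Z_mult_closed translation_carrier adj2_carrier)

lemma conj_translation_nth: "conj_translation A h $ 2 $ 1 = - (A $ 2 $ 1 ^ 2 * h)"
  by (simp add: conj_translation_def matmul_nth translation_eq adj2_def algebra_simps power2_eq_square)

lemma moeb_conj_translation:
  assumes "A \<in> carrier SL2Z" "Im \<tau> > 0"
  shows "moeb (conj_translation A h) (moeb A \<tau>) = moeb A (\<tau> + of_int h)"
proof -
  have "moeb (conj_translation A h) (moeb A \<tau>) = moeb (A ** translation h ** adj2 A ** A) \<tau>"
    unfolding conj_translation_def using assms
    by (subst moeb_mult[symmetric]) (auto intro!: SL2Z_mult_closed translation_carrier adj2_carrier)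
  also have "A ** translation h ** adj2 A ** A = A ** translation h"
    by (simp add: matrix_mul_assoc[symmetric] adj2_mult[OF assms(1)])
  finally show ?thesis using assms by (simp add: moeb_mult translation_carrier)
qed

text \<open>Trace 2 and determinant 1 make (B - 1)^2 = 0. A primitive integer vector fixed by B
  completes to a unimodular A by Bezout, and conjugation by A turns B into a unipotent upper
  triangular matrix.\<close>

lemma trace_2_conj_translation:
  assumes B: "B \<in> carrier SL2Z" and tr: "trace B = 2"
  obtains A h where "A \<in> carrier SL2Z" "B = conj_translation A h"
proof -
  define a b c d where "a = B $ 1 $ 1" "b = B $ 1 $ 2" "c = B $ 2 $ 1" "d = B $ 2 $ 2"
  have B_eq: "B = mat2 a b c d" using mat2_eta[of B] by (simp add: a_b_c_d_def)
  have d: "d = 2 - a" using tr by (simp add: trace_def sum_2 a_b_c_d_def)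
  have "a * d - b * c = 1" using B by (simp add: SL2Z_carrier a_b_c_d_def)
  then have bc: "b * c = - ((a - 1) ^ 2)" by (simp add: d algebra_simps power2_eq_square)
  obtain \<alpha> \<gamma> where fp: "a * \<alpha> + b * \<gamma> = \<alpha>" "c * \<alpha> + d * \<gamma> = \<gamma>" "coprime \<alpha> \<gamma>"
  proof (cases "c = 0")
    case True
    then show ?thesis using that[of 1 0] bc by simp
  next
    case False
    \<comment> \<open>The first column (a - 1, c) of B - 1 is killed by B - 1, so dividing it by g
      gives a primitive fixed vector.\<close>
    define g where "g = gcd (a - 1) c"
    have g: "g \<noteq> 0" using False by (simp add: g_def)
    obtain \<alpha> \<gamma> where ag: "a - 1 = \<alpha> * g" "c = \<gamma> * g" "coprime \<alpha> \<gamma>"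
      using gcd_coprime_exists[of "a - 1" c] g unfolding g_def by auto
    have "g * (a * \<alpha> + b * \<gamma>) = a * (\<alpha> * g) + b * (\<gamma> * g)" by (simp add: algebra_simps)
    also have "\<dots> = a * (a - 1) + b * c" by (simp only: ag(1,2))
    also have "\<dots> = a - 1" unfolding bc by (simp add: power2_eq_square algebra_simps)
    also have "\<dots> = g * \<alpha>" by (simp only: ag(1) mult.commute)
    finally have 1: "a * \<alpha> + b * \<gamma> = \<alpha>" using g by simp
    have "g * (c * \<alpha> + d * \<gamma>) = c * (\<alpha> * g) + d * (\<gamma> * g)" by (simp add: algebra_simps)
    also have "\<dots> = c * (a - 1) + d * c" by (simp only: ag(1,2))
    also have "\<dots> = c" by (simp add: d algebra_simps)
    also have "\<dots> = g * \<gamma>" by (simp only: ag(2) mult.commute)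
    finally have 2: "c * \<alpha> + d * \<gamma> = \<gamma>" using g by simp
    show ?thesis using that 1 2 ag(3) by blast
  qed
  obtain \<delta> \<beta> where bez: "\<delta> * \<alpha> + \<beta> * \<gamma> = 1" using bezout_int[of \<alpha> \<gamma>] fp(3) by (auto simp: coprime_iff_gcd_eq_1)
  define A where "A = mat2 \<alpha> (- \<beta>) \<gamma> \<delta>"
  have A: "A \<in> carrier SL2Z" using bez by (simp add: A_def SL2Z_carrier algebra_simps)
  define C where "C = adj2 A ** (B ** A)"
  have C: "C \<in> carrier SL2Z" using A B by (simp add: C_def SL2Z_mult_closed adj2_carrier)
  have C1: "C $ 1 $ 1 = 1" "C $ 2 $ 1 = 0"
    using bez fp by (simp_all add: C_def A_def B_eq matmul_nth adj2_def mult.commute)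
  then have "C = translation (C $ 1 $ 2)" using C by (simp add: SL2Z_carrier mat2_eq_iff translation_eq)
  moreover have "B = A ** C ** adj2 A"
  proof -
    have "A ** C ** adj2 A = (A ** adj2 A) ** B ** (A ** adj2 A)"
      by (simp add: C_def matrix_mul_assoc)
    then show ?thesis by (simp add: mult_adj2[OF A])
  qed
  ultimately show ?thesis using that[of A "C $ 1 $ 2"] A by (metis conj_translation_def)
qed

lemma upper_half_plane_iff: "\<tau> \<in> upper_half_plane \<longleftrightarrow> Im \<tau> > 0"
  by (simp add: upper_half_plane_def)

lemma open_upper_half_plane: "open upper_half_plane"
  by (simp add: upper_half_plane_def open_halfspace_Im_gt)

lemma connected_upper_half_plane: "connected upper_half_plane"
  by (simp add: upper_half_plane_def convex_connected convex_halfspace_Im_gt)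

lemma moeb_holomorphic:
  assumes "A \<in> carrier SL2Z"
  shows "moeb A holomorphic_on upper_half_plane"
  unfolding moeb_def[abs_def] using moeb_denom_nonzero[OF assms]
  by (intro holomorphic_intros) (auto simp: upper_half_plane_iff)

lemma holomorphic_compose_moeb:
  assumes "F holomorphic_on upper_half_plane" "A \<in> carrier SL2Z"
  shows "(\<lambda>\<tau>. F (moeb A \<tau>)) holomorphic_on upper_half_plane"
proof -
  have "moeb A ` upper_half_plane \<subseteq> upper_half_plane"
    using Im_moeb_pos[OF assms(2)] by (auto simp: upper_half_plane_iff)
  from holomorphic_on_compose_gen[OF moeb_holomorphic[OF assms(2)] assms(1) this]
  show ?thesis by (simp add: o_def)
qed

section \<open>Periodic functions and expansions at cusps\<close>

lemma at_ioo_neq_bot: "at_ioo \<noteq> bot"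
proof (rule filtercomap_neq_bot_surj)
  show "surj Im" by (rule surjI[of _ "\<lambda>y. Complex 0 y"]) simp
qed simp

text \<open>Two logarithms of q differ by a whole number of periods of H, so g is well defined from
  the principal logarithm in spite of its cut.\<close>

lemma periodic_function_of_q:
  assumes h: "h > (0::real)" and H: "H holomorphic_on upper_half_plane"
    and per: "\<And>\<tau>. Im \<tau> > 0 \<Longrightarrow> H (\<tau> + of_real h) = H \<tau>"
  obtains g where "g holomorphic_on ball 0 1 - {0}" "\<And>\<tau>. Im \<tau> > 0 \<Longrightarrow> H \<tau> = g (q_of (\<tau> / of_real h))"
proof -
  define T where "T w = of_real h * w / (2 * of_real pi * \<i>)" for w :: complex
  have qT: "q_of (T w / of_real h) = exp w" for w using h by (simp add: T_def q_of_def)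
  have perZ: "H (\<tau> + of_real h * of_int n) = H \<tau>" if "Im \<tau> > 0" for \<tau> n
  proof (induction n rule: int_induct[where k = 0])
    case (step1 i) then show ?case using per[of "\<tau> + of_real h * of_int i"] that by (simp add: algebra_simps)
  next
    case (step2 i) then show ?case using per[of "\<tau> + of_real h * of_int i - of_real h"] that by (simp add: algebra_simps)
  qed simp
  have eq: "H \<tau> = H \<tau>'" if "Im \<tau> > 0" "Im \<tau>' > 0" "q_of (\<tau> / of_real h) = q_of (\<tau>' / of_real h)" for \<tau> \<tau>'
  proof -
    have "q_of ((\<tau>' - \<tau>) / of_real h) = 1" using that(3) by (simp add: diff_divide_distrib q_of_diff)
    then obtain n where "(\<tau>' - \<tau>) / of_real h = of_int n" unfolding q_of_eq_1_iff by (auto elim: Ints_cases)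
    then have "\<tau>' = \<tau> + of_real h * of_int n" using h by (simp add: field_simps)
    then show ?thesis using perZ[OF that(1)] by simp
  qed
  have ImT: "Im (T w) > 0" if "norm (exp w) < 1" for w
  proof -
    have "Re w < 0" using that by (simp add: norm_exp_eq_Re)
    then have "h * Re w / (2 * pi) < 0" using h by (intro divide_neg_pos mult_pos_neg) auto
    then show ?thesis by (simp add: T_def Im_divide power2_eq_square)
  qed
  define g where "g w = H (T (Ln w))" for w
  have g: "H \<tau> = g (q_of (\<tau> / of_real h))" if "Im \<tau> > 0" for \<tau>
    unfolding g_def
  proof (rule eq[OF that])
    have "norm (q_of (\<tau> / of_real h)) < 1" using that h by (intro norm_q_of_less_1) simp
    then show "Im (T (Ln (q_of (\<tau> / of_real h)))) > 0" by (intro ImT) simp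
  qed (simp add: qT)
  have "g holomorphic_on ball 0 1 - {0}"
    unfolding holomorphic_on_def
  proof
    fix w0 :: complex assume w0: "w0 \<in> ball 0 1 - {0}"
    \<comment> \<open>Near w0 the logarithm Ln (w/w0) + Ln w0 is holomorphic, as w/w0 stays in the
      right half-plane. Using it changes nothing by periodicity, so g is holomorphic across the cut
      too.\<close>
    define U where "U = (ball 0 1 - {0}) \<inter> {w. 0 < Re (w / w0)}"
    have U: "open U" "w0 \<in> U"
      using w0 unfolding U_def
      by (auto intro!: open_Int open_Diff continuous_open_preimage[of UNIV, simplified, unfolded vimage_def] open_Collect_less continuous_intros)
    have nn: "w / w0 \<notin> \<real>\<^sub>\<le>\<^sub>0" if "w \<in> U" for w
      using that unfolding U_def complex_nonpos_Reals_iff by simp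
    have gU: "g w = H (T (Ln (w / w0) + Ln w0))" if "w \<in> U" for w
    proof -
      have w: "w \<noteq> 0" "norm w < 1" "w0 \<noteq> 0" using that w0 by (auto simp: U_def)
      have e: "exp (Ln (w / w0) + Ln w0) = w" using w by (simp add: exp_add)
      show ?thesis unfolding g_def
        by (rule eq) (use w e in \<open>auto simp: qT intro!: ImT\<close>)
    qed
    have "(\<lambda>w. H (T (Ln (w / w0) + Ln w0))) holomorphic_on U"
    proof -
      have "(H \<circ> (\<lambda>w. T (Ln (w / w0) + Ln w0))) holomorphic_on U"
      proof (rule holomorphic_on_compose_gen[OF _ H])
        show "(\<lambda>w. T (Ln (w / w0) + Ln w0)) holomorphic_on U"
          unfolding T_def using w0 nn by (intro holomorphic_intros) auto
        show "(\<lambda>w. T (Ln (w / w0) + Ln w0)) ` U \<subseteq> upper_half_plane"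
        proof (clarify, unfold upper_half_plane_iff, rule ImT)
          fix w assume "w \<in> U"
          then have "w \<noteq> 0" "norm w < 1" by (auto simp: U_def)
          then show "norm (exp (Ln (w / w0) + Ln w0)) < 1" using w0 by (simp add: exp_add)
        qed
      qed
      then show ?thesis by (simp add: o_def)
    qed
    then have "g holomorphic_on U" by (rule holomorphic_transform) (simp add: gU)
    then show "g field_differentiable at w0 within ball 0 1 - {0}"
      using U holomorphic_on_imp_differentiable_at field_differentiable_at_within by blast
  qed
  with g show ?thesis using that by blast
qed

text \<open>
  The multiplier is forced: with any other exponent of \<open>q\<close> the modulus would tend to 0 or \<open>\<infinity>\<close>.
\<close>

lemma cusp_expansion:
  fixes k :: real and h :: nat
  assumes h: "h > 0" and F: "F holomorphic_on upper_half_plane"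
    and per: "\<And>\<tau>. Im \<tau> > 0 \<Longrightarrow> F (\<tau> + of_nat h) = \<mu> * F \<tau>" and \<mu>: "norm \<mu> = 1"
    and L: "L > 0" "((\<lambda>\<tau>. norm (F \<tau>) * exp (2 * pi * k * Im \<tau>)) \<longlongrightarrow> L) at_ioo"
  shows "\<mu> = q_of (of_real (k * h))"
    and "\<exists>c. \<forall>\<tau>\<in>upper_half_plane. (\<lambda>n. c n * q_of ((of_real (k * h) + of_nat n) * \<tau> / of_nat h)) sums F \<tau>"
proof -
  define \<mu>' where "\<mu>' = \<mu> * q_of (- of_real (k * h))"
  have "norm \<mu>' = 1" using \<mu> by (simp add: \<mu>'_def norm_mult norm_q_of)
  \<comment> \<open>After removing exp(2 \<pi> i k \<tau>), a unitary multiplier remains. It is the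
    one of exp(2 \<pi> i \<kappa> \<tau>/h) with \<kappa> chosen in [0, 1).\<close>
  define \<kappa> where "\<kappa> = frac (Arg \<mu>' / (2 * pi))"
  have \<kappa>: "0 \<le> \<kappa>" "\<kappa> < 1" by (auto simp: \<kappa>_def frac_lt_1)
  have "\<mu>' = q_of (of_real (Arg \<mu>' / (2 * pi)))"
  proof -
    have "\<mu>' = exp (\<i> * of_real (Arg \<mu>'))" using \<open>norm \<mu>' = 1\<close> Arg_eq[of \<mu>'] by (metis mult_1 norm_zero of_real_1 zero_neq_one)
    also have "\<dots> = q_of (of_real (Arg \<mu>' / (2 * pi)))"
      unfolding q_of_def by (rule arg_cong[of _ _ exp]) simp
    finally show ?thesis .
  qed
  also have "complex_of_real (Arg \<mu>' / (2 * pi)) = of_real \<kappa> + of_int \<lfloor>Arg \<mu>' / (2 * pi)\<rfloor>"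
  proof -
    have "Arg \<mu>' / (2 * pi) = \<kappa> + of_int \<lfloor>Arg \<mu>' / (2 * pi)\<rfloor>" by (simp add: \<kappa>_def frac_def)
    then show ?thesis by (metis of_real_add of_real_of_int_eq)
  qed
  finally have \<mu>'_eq: "\<mu>' = q_of (of_real \<kappa>)" by (simp add: q_of_add)
  define H where "H \<tau> = F \<tau> * q_of (- (of_real k * \<tau>)) * q_of (- (of_real \<kappa> * \<tau> / of_nat h))" for \<tau>
  have H: "H holomorphic_on upper_half_plane" unfolding H_def by (intro holomorphic_intros F) (use h in auto)
  have "H (\<tau> + of_real (real h)) = H \<tau>" if "Im \<tau> > 0" for \<tau>
  proof -
    have 1: "q_of (- (of_real k * (\<tau> + of_nat h))) = q_of (- (of_real k * \<tau>)) * q_of (- of_real (k * h))"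
      by (simp add: q_of_add[symmetric] algebra_simps)
    have 2: "q_of (- (of_real \<kappa> * (\<tau> + of_nat h) / of_nat h)) = q_of (- (of_real \<kappa> * \<tau> / of_nat h)) / \<mu>'"
      unfolding \<mu>'_eq q_of_diff[symmetric] using h by (intro arg_cong[of _ _ q_of]) (simp add: field_simps)
    have "H (\<tau> + of_nat h) = (\<mu> * F \<tau>) * (q_of (- (of_real k * \<tau>)) * q_of (- of_real (k * h))) * (q_of (- (of_real \<kappa> * \<tau> / of_nat h)) / \<mu>')"
      unfolding H_def per[OF that] 1 2 ..
    also have "\<dots> = (\<mu>' / \<mu>') * H \<tau>" unfolding H_def \<mu>'_def by simp
    also have "\<dots> = H \<tau>" using \<open>norm \<mu>' = 1\<close> by auto
    finally show ?thesis by simp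
  qed
  then obtain g where g: "g holomorphic_on ball 0 1 - {0}" "\<And>\<tau>. Im \<tau> > 0 \<Longrightarrow> H \<tau> = g (q_of (\<tau> / of_real (real h)))"
    using periodic_function_of_q[OF _ H, of "real h"] h by auto
  \<comment> \<open>The limit L bounds g by a multiple of |w| to the power -\<kappa>. As \<kappa> <
    1, multiplying by w gives limit 0 and a removable singularity.\<close>
  define p where "p w = w * g w" for w
  have normH: "norm (H \<tau>) = (norm (F \<tau>) * exp (2 * pi * k * Im \<tau>)) * exp (2 * pi * \<kappa> * Im \<tau> / h)" for \<tau>
    by (simp add: H_def norm_mult norm_q_of mult_ac)
  define y where "y w = - real h * ln (norm w) / (2 * pi)" for w :: complex
  have wy: "\<exists>\<tau>. Im \<tau> = y w \<and> q_of (\<tau> / of_nat h) = w" if "w \<noteq> 0" for w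
  proof (intro exI conjI)
    let ?\<tau> = "of_nat h * Ln w / (2 * of_real pi * \<i>)"
    show "q_of (?\<tau> / of_nat h) = w" using h that by (simp add: q_of_def)
    show "Im ?\<tau> = y w" using that by (simp add: y_def Im_divide power2_eq_square)
  qed
  have y_lim: "filterlim y at_top (at 0)"
  proof -
    have "filterlim (\<lambda>w::complex. norm w) (at_right 0) (at 0)"
      by (auto simp: filterlim_at intro!: tendsto_norm_zero tendsto_ident_at simp: eventually_at_filter)
    from filterlim_compose[OF ln_at_0 this] have "filterlim (\<lambda>w::complex. - ln (norm w)) at_top (at 0)"
      by (simp add: filterlim_uminus_at_bot)
    from filterlim_tendsto_pos_mult_at_top[OF tendsto_const _ this, of "real h / (2 * pi)"] h
    show ?thesis by (simp add: y_def[abs_def])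
  qed
  have p0: "(p \<longlongrightarrow> 0) (at 0)"
  proof (rule Lim_null_comparison)
    obtain Y where Y: "\<And>\<tau>. Im \<tau> \<ge> Y \<Longrightarrow> norm (F \<tau>) * exp (2 * pi * k * Im \<tau>) < 2 * L"
    proof -
      have "\<forall>\<^sub>F \<tau> in at_ioo. norm (F \<tau>) * exp (2 * pi * k * Im \<tau>) < 2 * L"
        using order_tendstoD(2)[OF L(2)] L(1) by simp
      then obtain Pr where Pr: "eventually Pr at_top" "\<And>\<tau>. Pr (Im \<tau>) \<Longrightarrow> norm (F \<tau>) * exp (2 * pi * k * Im \<tau>) < 2 * L"
        unfolding eventually_filtercomap by blast
      then show ?thesis using that unfolding eventually_at_top_linorder by blast
    qed
    have "\<forall>\<^sub>F w in at 0. y w \<ge> max Y 1" using y_lim unfolding filterlim_at_top by blast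
    moreover have "\<forall>\<^sub>F w in at 0. w \<noteq> (0::complex)" by (simp add: eventually_at_filter)
    ultimately show "\<forall>\<^sub>F w in at 0. norm (p w) \<le> 2 * L * exp ((2 * pi * (\<kappa> - 1) / h) * y w)"
    proof eventually_elim
      case (elim w)
      obtain \<tau> where \<tau>: "Im \<tau> = y w" "q_of (\<tau> / of_nat h) = w" using wy[OF elim(2)] by blast
      have "norm w = exp (- 2 * pi * y w / h)" using norm_q_of[of "\<tau> / of_nat h"] unfolding \<tau>(2) by (simp add: \<tau>(1))
      moreover have "norm (g w) = (norm (F \<tau>) * exp (2 * pi * k * Im \<tau>)) * exp (2 * pi * \<kappa> * y w / h)"
        using g(2)[of \<tau>] normH[of \<tau>] elim \<tau> by simp
      ultimately have "norm (p w) = (norm (F \<tau>) * exp (2 * pi * k * Im \<tau>)) * (exp (- 2 * pi * y w / h) * exp (2 * pi * \<kappa> * y w / h))"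
        by (simp add: p_def norm_mult)
      also have "exp (- 2 * pi * y w / h) * exp (2 * pi * \<kappa> * y w / h) = exp ((2 * pi * (\<kappa> - 1) / h) * y w)"
        unfolding exp_add[symmetric] using h by (intro arg_cong[of _ _ exp]) (simp add: field_simps)
      also have "norm (F \<tau>) * exp (2 * pi * k * Im \<tau>) * exp ((2 * pi * (\<kappa> - 1) / h) * y w) \<le> 2 * L * exp ((2 * pi * (\<kappa> - 1) / h) * y w)"
        using Y[of \<tau>] \<tau> elim by (intro mult_right_mono) auto
      finally show ?case .
    qed
    have "filterlim (\<lambda>w. (2 * pi * (\<kappa> - 1) / h) * y w) at_bot (at 0)"
      using \<kappa> h by (intro filterlim_tendsto_neg_mult_at_bot[OF tendsto_const _ y_lim]) (auto simp: divide_neg_pos mult_pos_neg)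
    then have "((\<lambda>w. exp ((2 * pi * (\<kappa> - 1) / h) * y w)) \<longlongrightarrow> 0) (at 0)"
      by (rule filterlim_compose[OF exp_at_bot])
    from tendsto_mult_right_zero[OF this, of "2 * L"]
    show "((\<lambda>w. 2 * L * exp ((2 * pi * (\<kappa> - 1) / h) * y w)) \<longlongrightarrow> 0) (at 0)" .
  qed
  have p_hol: "p holomorphic_on ball 0 1"
  proof (rule no_isolated_singularity'[of "{0}"])
    show "(p \<longlongrightarrow> p z) (at z within ball 0 1)" if "z \<in> {0}" for z
      using p0 that by (auto simp: p_def intro: tendsto_within_subset)
    show "p holomorphic_on ball 0 1 - {0}" unfolding p_def by (intro holomorphic_intros g)
  qed auto
  \<comment> \<open>Dividing p by w again extends g itself over 0, with value p'(0), because p(0) =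
    0.\<close>
  define r where "r w = (if w = 0 then deriv p 0 else (p w - p 0) / (w - 0))" for w
  have r: "r holomorphic_on ball 0 1"
    unfolding r_def by (rule pole_lemma[OF p_hol]) simp
  have rg: "r w = g w" if "w \<noteq> 0" for w using that by (simp add: r_def p_def)
  have Hr: "H \<tau> = r (q_of (\<tau> / of_nat h))" if "Im \<tau> > 0" for \<tau>
    using g(2)[OF that] by (simp add: rg)
  have "\<kappa> = 0"
  \<comment> \<open>For \<kappa> > 0 the normalised modulus of F would be a bounded function times a
    decaying exponential, contradicting L > 0.\<close>
  proof (rule ccontr)
    assume "\<kappa> \<noteq> 0"
    then have k0: "\<kappa> > 0" using \<kappa> by simp
    have q0: "((\<lambda>\<tau>. q_of (\<tau> / of_nat h)) \<longlongrightarrow> 0) at_ioo"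
      using tendsto_q_of_0[of "1 / real h" 0] h by simp
    have "isCont r 0" using holomorphic_on_imp_continuous_on[OF r]
      by (rule continuous_on_interior) simp
    then have "((\<lambda>\<tau>. r (q_of (\<tau> / of_nat h))) \<longlongrightarrow> r 0) at_ioo"
      by (rule isCont_tendsto_compose[OF _ q0])
    moreover have "((\<lambda>\<tau>. exp (- (2 * pi * \<kappa> / h) * Im \<tau>)) \<longlongrightarrow> 0) at_ioo"
    proof (rule filterlim_compose[OF exp_at_bot])
      show "filterlim (\<lambda>\<tau>. - (2 * pi * \<kappa> / h) * Im \<tau>) at_bot at_ioo"
        using k0 h by (intro filterlim_tendsto_neg_mult_at_bot[OF tendsto_const] filterlim_filtercomap) auto
    qed
    ultimately have "((\<lambda>\<tau>. norm (r (q_of (\<tau> / of_nat h))) * exp (- (2 * pi * \<kappa> / h) * Im \<tau>)) \<longlongrightarrow> norm (r 0) * 0) at_ioo"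
      by (intro tendsto_mult tendsto_norm)
    moreover have "\<forall>\<^sub>F \<tau> in at_ioo. norm (r (q_of (\<tau> / of_nat h))) * exp (- (2 * pi * \<kappa> / h) * Im \<tau>) = norm (F \<tau>) * exp (2 * pi * k * Im \<tau>)"
      using eventually_Im_gt[of 0]
    proof eventually_elim
      case (elim \<tau>)
      have e: "exp (2 * pi * \<kappa> * Im \<tau> / h) * exp (- (2 * pi * \<kappa> / h) * Im \<tau>) = 1"
        unfolding exp_add[symmetric] by simp
      show ?case unfolding Hr[OF elim, symmetric] normH mult.assoc e[unfolded mult.assoc] by simp
    qed
    ultimately have "((\<lambda>\<tau>. norm (F \<tau>) * exp (2 * pi * k * Im \<tau>)) \<longlongrightarrow> 0) at_ioo"
      using Lim_transform_eventually by fastforce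
    then have "L = 0" using tendsto_unique[OF at_ioo_neq_bot L(2)] by simp
    then show False using L(1) by simp
  qed
  then have "\<mu>' = 1" using \<mu>'_eq by simp
  then show "\<mu> = q_of (of_real (k * h))" by (simp add: \<mu>'_def q_of_minus)
  define c where "c n = (deriv ^^ n) r 0 / fact n" for n
  have "(\<lambda>n. c n * q_of ((of_real (k * h) + of_nat n) * \<tau> / of_nat h)) sums F \<tau>" if "\<tau> \<in> upper_half_plane" for \<tau>
  proof -
    have \<tau>: "Im \<tau> > 0" using that by (simp add: upper_half_plane_iff)
    have "q_of (\<tau> / of_nat h) \<in> ball 0 1" using \<tau> h norm_q_of_less_1[of "\<tau> / of_nat h"] by simp
    from holomorphic_power_series[OF r this] have "(\<lambda>n. c n * q_of (\<tau> / of_nat h) ^ n) sums H \<tau>"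
      by (simp add: c_def Hr[OF \<tau>])
    from sums_mult[OF this, of "q_of (of_real k * \<tau>)"]
    have "(\<lambda>n. q_of (of_real k * \<tau>) * (c n * q_of (\<tau> / of_nat h) ^ n)) sums (q_of (of_real k * \<tau>) * H \<tau>)" .
    moreover have "q_of (of_real k * \<tau>) * H \<tau> = F \<tau>"
      by (simp add: H_def \<open>\<kappa> = 0\<close> q_of_minus)
    moreover have "q_of (of_real k * \<tau>) * (c n * q_of (\<tau> / of_nat h) ^ n) = c n * q_of ((of_real (k * h) + of_nat n) * \<tau> / of_nat h)" for n
    proof -
      have "(of_real (k * h) + of_nat n) * \<tau> / of_nat h = of_real k * \<tau> + of_nat n * (\<tau> / of_nat h)"
        using h by (simp add: field_simps)
      then show ?thesis by (simp add: q_of_add q_of_power)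
    qed
    ultimately show ?thesis by simp
  qed
  then show "\<exists>c. \<forall>\<tau>\<in>upper_half_plane. (\<lambda>n. c n * q_of ((of_real (k * h) + of_nat n) * \<tau> / of_nat h)) sums F \<tau>" by blast
qed

text \<open>The quotient of F(A \<tau>) by F(\<tau>) is holomorphic of modulus 1, hence constant by
  the maximum principle; this defines the character. The order function is a parameter so that the
  result serves both for eta and for its 24th power.\<close>

lemma gmf_of_norm_invariant:
  fixes ord :: "int \<Rightarrow> int \<Rightarrow> real"
  assumes Q: "Q > 0" and F: "F holomorphic_on upper_half_plane" and nz: "\<And>\<tau>. Im \<tau> > 0 \<Longrightarrow> F \<tau> \<noteq> 0"
    and inv: "\<And>A \<tau>. A \<in> Gamma0 Q \<Longrightarrow> Im \<tau> > 0 \<Longrightarrow> norm (F (moeb A \<tau>)) = norm (F \<tau>)"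
    and asymp: "\<And>A. A \<in> carrier SL2Z \<Longrightarrow> \<exists>L>0. ((\<lambda>\<tau>. norm (F (moeb A \<tau>)) * exp (2 * pi * ord (A $ 1 $ 1) (A $ 2 $ 1) * Im \<tau>)) \<longlongrightarrow> L) at_ioo"
  shows "gmf (Gamma0 Q) F"
    and "(\<And>\<alpha> \<gamma> h. coprime \<alpha> \<gamma> \<Longrightarrow> h > 0 \<Longrightarrow> int Q dvd \<gamma> ^ 2 * int h \<Longrightarrow> ord \<alpha> \<gamma> * of_nat h \<in> \<int>) \<Longrightarrow> parabolic_gmf (Gamma0 Q) F"
proof -
  define \<nu> where "\<nu> A = F (moeb A \<i>) / F \<i>" for A
  have carr: "A \<in> carrier SL2Z" if "A \<in> Gamma0 Q" for A using that by (simp add: Gamma0_iff)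
  have i0: "F \<i> \<noteq> 0" using nz[of \<i>] by simp
  have trans: "F (moeb A \<tau>) = \<nu> A * F \<tau>" if A: "A \<in> Gamma0 Q" and \<tau>: "Im \<tau> > 0" for A \<tau>
  proof -
    define R where "R \<tau> = F (moeb A \<tau>) / F \<tau>" for \<tau>
    have "R holomorphic_on upper_half_plane"
      unfolding R_def using nz by (intro holomorphic_intros holomorphic_compose_moeb F carr A) (auto simp: upper_half_plane_iff)
    moreover have "norm (R \<tau>) = 1" if "Im \<tau> > 0" for \<tau>
      using inv[OF A that] nz[OF that] by (simp add: R_def norm_divide)
    ultimately have "R constant_on upper_half_plane"
      by (intro maximum_modulus_principle[of R upper_half_plane upper_half_plane \<i>])
         (auto simp: open_upper_half_plane connected_upper_half_plane upper_half_plane_iff)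
    then obtain c where c: "\<And>\<tau>. Im \<tau> > 0 \<Longrightarrow> R \<tau> = c" by (auto simp: constant_on_def upper_half_plane_iff)
    have "R \<tau> = \<nu> A" using c[OF \<tau>] c[of \<i>] by (simp add: R_def \<nu>_def)
    then show ?thesis using nz[OF \<tau>] by (simp add: R_def field_simps)
  qed
  have norm_\<nu>: "norm (\<nu> A) = 1" if "A \<in> Gamma0 Q" for A
    using inv[OF that, of \<i>] i0 by (simp add: \<nu>_def norm_divide)
  have \<nu>_mult: "\<nu> (A ** B) = \<nu> A * \<nu> B" if A: "A \<in> Gamma0 Q" and B: "B \<in> Gamma0 Q" for A B
  proof -
    have "F (moeb (A ** B) \<i>) = \<nu> A * F (moeb B \<i>)"
      using trans[OF A, of "moeb B \<i>"] Im_moeb_pos[OF carr[OF B], of \<i>] moeb_mult[OF carr[OF A] carr[OF B], of \<i>] by simp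
    then show ?thesis by (simp add: \<nu>_def)
  qed
  have cusp: "\<nu> (conj_translation A (int h)) = q_of (of_real (ord (A $ 1 $ 1) (A $ 2 $ 1) * h))"
    "\<exists>\<kappa> c. \<forall>\<tau>\<in>upper_half_plane. (\<lambda>n. c n * q_of ((\<kappa> + of_nat n) * \<tau> / of_nat h)) sums F (moeb A \<tau>)"
    if A: "A \<in> carrier SL2Z" and h: "h > 0" and G: "conj_translation A (int h) \<in> Gamma0 Q" for A h
  proof -
    obtain L where L: "L > 0" "((\<lambda>\<tau>. norm (F (moeb A \<tau>)) * exp (2 * pi * ord (A $ 1 $ 1) (A $ 2 $ 1) * Im \<tau>)) \<longlongrightarrow> L) at_ioo"
      using asymp[OF A] by blast
    have per: "F (moeb A (\<tau> + of_nat h)) = \<nu> (conj_translation A (int h)) * F (moeb A \<tau>)" if "Im \<tau> > 0" for \<tau>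
      using trans[OF G Im_moeb_pos[OF A that]] moeb_conj_translation[OF A that, of "int h"] by simp
    note ce = cusp_expansion[OF h holomorphic_compose_moeb[OF F A] per norm_\<nu>[OF G] L]
    show "\<nu> (conj_translation A (int h)) = q_of (of_real (ord (A $ 1 $ 1) (A $ 2 $ 1) * h))" by (rule ce(1))
    show "\<exists>\<kappa> c. \<forall>\<tau>\<in>upper_half_plane. (\<lambda>n. c n * q_of ((\<kappa> + of_nat n) * \<tau> / of_nat h)) sums F (moeb A \<tau>)"
      using ce(2) by (intro exI[of _ "of_real (ord (A $ 1 $ 1) (A $ 2 $ 1) * h)"])
  qed
  have mero: "meromorphic_at_cusps (Gamma0 Q) F"
    unfolding meromorphic_at_cusps_def
  proof
    fix A assume A: "A \<in> carrier SL2Z"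
    have "conj_translation A (int Q) \<in> Gamma0 Q"
      by (simp add: Gamma0_iff conj_translation_carrier[OF A] conj_translation_nth)
    then show "\<exists>h \<kappa> c. 0 < h \<and> A ** translation (int h) ** inv\<^bsub>SL2Z\<^esub> A \<in> Gamma0 Q \<and>
       (\<forall>\<tau>\<in>upper_half_plane. (\<lambda>n. c n * q_of ((\<kappa> + of_nat n) * \<tau> / of_nat h)) sums F (moeb A \<tau>))"
      using cusp(2)[OF A Q] Q by (intro exI[of _ Q]) (simp add: inv_SL2Z[OF A] conj_translation_def)
  qed
  have gmfc: "gmf_with_character (Gamma0 Q) \<nu> F"
    unfolding gmf_with_character_def
    using finite_index_Gamma0[OF Q] norm_\<nu> \<nu>_mult F trans mero by (force simp: upper_half_plane_iff)
  then show "gmf (Gamma0 Q) F" unfolding gmf_def by blast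
  assume int: "\<And>\<alpha> \<gamma> h. coprime \<alpha> \<gamma> \<Longrightarrow> h > 0 \<Longrightarrow> int Q dvd \<gamma> ^ 2 * int h \<Longrightarrow> ord \<alpha> \<gamma> * of_nat h \<in> \<int>"
  have pos: "\<nu> (conj_translation A (int h)) = 1"
    if A: "A \<in> carrier SL2Z" and h: "h > 0" and G: "conj_translation A (int h) \<in> Gamma0 Q" for A h
  proof -
    have "coprime (A $ 1 $ 1) (A $ 2 $ 1)"
    proof (rule coprimeI)
      fix k assume "k dvd A $ 1 $ 1" "k dvd A $ 2 $ 1"
      then have "k dvd A $ 1 $ 1 * A $ 2 $ 2 - A $ 1 $ 2 * A $ 2 $ 1" by auto
      then show "is_unit k" using A by (simp add: SL2Z_carrier)
    qed
    moreover have "int Q dvd (A $ 2 $ 1) ^ 2 * int h" using G by (simp add: Gamma0_iff conj_translation_nth)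
    ultimately have "ord (A $ 1 $ 1) (A $ 2 $ 1) * of_nat h \<in> \<int>" using int h by blast
    then show ?thesis unfolding cusp(1)[OF A h G] q_of_eq_1_iff of_real_in_Ints_iff .
  qed
  have "\<nu> B = 1" if B: "B \<in> Gamma0 Q" and tr: "trace B = 2" for B
  proof -
    obtain A h where A: "A \<in> carrier SL2Z" and Bh: "B = conj_translation A h"
      using trace_2_conj_translation[OF carr[OF B] tr] by blast
    have one: "\<nu> (mat 1) = 1" using i0 by (simp add: \<nu>_def)
    \<comment> \<open>Cusp expansions cover positive translations only; a negative one is the
      inverse of a positive one, and the character is multiplicative.\<close>
    consider "h > 0" | "h = 0" | "h < 0" by linarith
    then show ?thesis
    proof cases
      case 1
      then show ?thesis using pos[OF A, of "nat h"] B Bh by simp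
    next
      case 2
      have "translation 0 = mat 1" by (simp add: translation_eq mat_1_eq)
      then have "B = mat 1" unfolding Bh conj_translation_def 2 using mult_adj2[OF A] by simp
      then show ?thesis using one by simp
    next
      case 3
      have "conj_translation A (- h) ** conj_translation A h = A ** translation (- h) ** (adj2 A ** A) ** translation h ** adj2 A"
        by (simp add: conj_translation_def matrix_mul_assoc)
      also have "\<dots> = A ** (translation (- h) ** translation h) ** adj2 A"
        by (simp add: adj2_mult[OF A] matrix_mul_assoc)
      also have "translation (- h) ** translation h = mat 1" by (simp add: translation_eq mat_1_eq mat2_eq_iff matmul_nth)
      finally have prod: "conj_translation A (- h) ** B = mat 1" by (simp add: Bh mult_adj2[OF A])
      have G: "conj_translation A (- h) \<in> Gamma0 Q"
        using B A by (simp add: Bh Gamma0_iff conj_translation_carrier conj_translation_nth)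
      have "\<nu> (conj_translation A (- h)) = 1" using pos[OF A, of "nat (- h)"] 3 G by simp
      then show ?thesis using \<nu>_mult[OF G B] prod one by simp
    qed
  qed
  then show "parabolic_gmf (Gamma0 Q) F" unfolding parabolic_gmf_def using gmfc by blast
qed

section \<open>Integrality of the cusp orders\<close>

text \<open>Every unit modulo 24 has square 1, which is checked on all residues.\<close>

lemma dvd_24_prime_square_minus_1:
  assumes "prime (p::nat)" "p \<ge> 5"
  shows "24 dvd p ^ 2 - 1"
proof -
  have "\<not> 2 dvd p" "\<not> 3 dvd p" using assms by (auto simp: primes_dvd_imp_eq dest: primes_dvd_imp_eq[rotated 2])
  then have r: "p mod 24 mod 2 \<noteq> 0" "p mod 24 mod 3 \<noteq> 0" by (simp_all add: mod_mod_cancel dvd_eq_mod_eq_0)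
  define r where "r = p mod 24"
  have "r < 24" by (simp add: r_def)
  have "\<forall>r\<in>set [0..<24]. r mod 2 \<noteq> (0::nat) \<longrightarrow> r mod 3 \<noteq> 0 \<longrightarrow> r ^ 2 mod 24 = 1" by code_simp
  then have "r ^ 2 mod 24 = 1" using \<open>r < 24\<close> r unfolding r_def[symmetric] by simp
  then have "p ^ 2 mod 24 = 1" by (simp add: r_def power_mod)
  then show ?thesis by (metis dvd_minus_mod)
qed

context real_primitive_character begin

text \<open>Jordan's totient of order 2 in the form that shows it to be a natural number.\<close>

definition jordan_nat :: nat where
  "jordan_nat = (\<Prod>p\<in>prime_factors u. p ^ (2 * (multiplicity p u - 1)) * (p ^ 2 - 1))"

lemma jordan2_eq: "jordan2 = real jordan_nat"
proof -
  have "real u = (\<Prod>p\<in>prime_factors u. real p ^ multiplicity p u)"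
    by (subst prime_factorization_nat[OF u_pos]) simp
  then have "jordan2 = (\<Prod>p\<in>prime_factors u. (real p ^ multiplicity p u) ^ 2 * (1 - 1 / real p ^ 2))"
    unfolding jordan2_def by (simp add: prod.distrib prod_power_distrib)
  also have "\<dots> = (\<Prod>p\<in>prime_factors u. real (p ^ (2 * (multiplicity p u - 1)) * (p ^ 2 - 1)))"
  proof (rule prod.cong[OF refl])
    fix p assume p: "p \<in> prime_factors u"
    then have p2: "p \<ge> 2" and m: "multiplicity p u > 0"
      using prime_ge_2_nat by (auto simp: prime_factors_multiplicity)
    then obtain k where k: "multiplicity p u = Suc k" using gr0_implies_Suc by blast
    have "p ^ 2 \<ge> 1" using p2 by (simp add: Suc_leI)
    then have "real (p ^ 2 - 1) = real p ^ 2 - 1" by (simp add: of_nat_diff)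
    then show "(real p ^ multiplicity p u) ^ 2 * (1 - 1 / real p ^ 2) = real (p ^ (2 * (multiplicity p u - 1)) * (p ^ 2 - 1))"
    proof -
      have "(real p ^ Suc k) ^ 2 = real p ^ (2 * k) * real p ^ 2"
        by (simp add: power_mult_distrib power_even_eq)
      then show ?thesis using p2 \<open>real (p ^ 2 - 1) = real p ^ 2 - 1\<close> unfolding k
        by (simp add: right_diff_distrib)
    qed
  qed
  finally show ?thesis by (simp add: jordan_nat_def)
qed

lemma u_neq_2: "u \<noteq> 2"
proof
  assume "u = 2"
  then obtain t where t: "coprime t 2" "\<psi> t \<noteq> 1" using psi_prim[of 1] by auto
  then have "odd t" by (simp add: coprime_right_2_iff_odd)
  then have "[t = 1] (mod int u)" using \<open>u = 2\<close> by (simp add: cong_def odd_iff_mod_2_eq_one)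
  then show False using psi_cong t by fastforce
qed

text \<open>A prime p \<ge> 5 contributes p^2 - 1. Otherwise u has only the primes 2 and 3: both
  together give 3 times 8, a single prime to a high enough power gives 24 as well, and the totient
  is 1, 8 and 12 at u = 1, 3, 4. The value u = 2 is no conductor.\<close>

lemma dvd_24_jordan_nat:
  assumes "u = 1 \<Longrightarrow> 24 dvd n" "u = 3 \<Longrightarrow> 3 dvd n" "u = 4 \<Longrightarrow> 2 dvd n"
  shows "24 dvd jordan_nat * n"
proof -
  define f where "f p = p ^ (2 * (multiplicity p u - 1)) * (p ^ 2 - 1)" for p
  have J: "jordan_nat = prod f (prime_factors u)" by (simp add: jordan_nat_def f_def)
  have fac: "f p dvd jordan_nat" if "p \<in> prime_factors u" for p unfolding J using that by (intro dvd_prodI) auto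
  have u: "u = (\<Prod>p\<in>prime_factors u. p ^ multiplicity p u)" by (rule prime_factorization_nat[OF u_pos])
  show ?thesis
  proof (cases "\<exists>p\<in>prime_factors u. p \<ge> 5")
    case True
    then obtain p where p: "p \<in> prime_factors u" "p \<ge> 5" by blast
    then have "24 dvd p ^ 2 - 1" by (intro dvd_24_prime_square_minus_1) (auto simp: in_prime_factors_iff)
    then have "24 dvd f p" by (simp add: f_def)
    then show ?thesis using fac[OF p(1)] by (meson dvd_mult2 dvd_trans)
  next
    case False
    have "prime_factors u \<subseteq> {2, 3}"
    proof
      fix p assume p: "p \<in> prime_factors u"
      then have "prime p" "p < 5" using False by (auto simp: in_prime_factors_iff not_le)
      moreover have "\<not> prime (4::nat)" using primes_dvd_imp_eq[of 2 4] by auto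
      moreover have "p \<ge> 2" using \<open>prime p\<close> by (rule prime_ge_2_nat)
      ultimately have "p \<noteq> 4" "p < 5" "p \<ge> 2" by auto
      then show "p \<in> {2, 3}" by auto
    qed
    then consider "prime_factors u = {}" | "prime_factors u = {2}" | "prime_factors u = {3}" | "prime_factors u = {2, 3}"
      by blast
    then show ?thesis
    proof cases
      case 1
      then have "u = 1" using u by simp
      then show ?thesis using assms(1) by simp
    next
      case 2
      define i where "i = multiplicity 2 u"
      have ui: "u = 2 ^ i" using u unfolding 2 by (simp add: i_def)
      have Ji: "jordan_nat = 2 ^ (2 * (i - 1)) * 3" unfolding J 2 by (simp add: f_def i_def)
      have "2 \<in> prime_factors u" using 2 by simp
      then have "i > 0" by (simp add: i_def prime_factors_multiplicity)
      moreover have "i \<noteq> 1" using ui u_neq_2 by auto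
      ultimately consider "i = 2" | "i \<ge> 3" by linarith
      then show ?thesis
      proof cases
        case 1
        then have "2 dvd n" using assms(3) ui by simp
        then have "12 * 2 dvd jordan_nat * n" unfolding Ji 1 by (intro mult_dvd_mono) auto
        then show ?thesis by simp
      next
        case 2
        have "(2::nat) ^ 3 dvd 2 ^ (2 * (i - 1))" by (rule le_imp_power_dvd) (use 2 in simp)
        then have "8 * 3 dvd jordan_nat" unfolding Ji by (intro mult_dvd_mono) auto
        then show ?thesis by simp
      qed
    next
      case 3
      define j where "j = multiplicity 3 u"
      have uj: "u = 3 ^ j" using u unfolding 3 by (simp add: j_def)
      have Jj: "jordan_nat = 3 ^ (2 * (j - 1)) * 8" unfolding J 3 by (simp add: f_def j_def)
      have "3 \<in> prime_factors u" using 3 by simp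
      then have "j > 0" by (simp add: j_def prime_factors_multiplicity)
      then consider "j = 1" | "j \<ge> 2" by linarith
      then show ?thesis
      proof cases
        case 1
        then have "3 dvd n" using assms(2) uj by simp
        then have "8 * 3 dvd jordan_nat * n" unfolding Jj 1 by (intro mult_dvd_mono) auto
        then show ?thesis by simp
      next
        case 2
        have "(3::nat) ^ 1 dvd 3 ^ (2 * (j - 1))" by (rule le_imp_power_dvd) (use 2 in simp)
        then have "3 * 8 dvd jordan_nat" unfolding Jj by (intro mult_dvd_mono) auto
        then show ?thesis by simp
      qed
    next
      case 4
      have "jordan_nat = 2 ^ (2 * (multiplicity 2 u - 1)) * 3 * (3 ^ (2 * (multiplicity 3 u - 1)) * 8)"
        unfolding J 4 by (simp add: f_def)
      also have "\<dots> = 24 * (2 ^ (2 * (multiplicity 2 u - 1)) * 3 ^ (2 * (multiplicity 3 u - 1)))" by simp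
      finally show ?thesis by simp
    qed
  qed
qed

lemma cusp_order_integrality:
  assumes "coprime \<alpha> \<gamma>" "int (u ^ 2 * P) dvd \<gamma> ^ 2 * int h"
  obtains z :: int where "cusp_order \<alpha> \<gamma> * real h = real (jordan_nat * totient P) / 24 * of_int z"
  using cusp_sum_integrality[OF assms] unfolding cusp_order_def jordan2_eq by auto

lemma level_pos: "u ^ 2 * P > 0"
  using u_pos P_pos by simp

lemma norm_eta_moeb:
  assumes "A \<in> Gamma0 (u ^ 2 * P)" "Im \<tau> > 0"
  shows "norm (eta (moeb A \<tau>)) = norm (eta \<tau>)"
  using norm_eta_invariant[OF _ _ assms(2), of "A $ 1 $ 1" "A $ 2 $ 2" "A $ 1 $ 2" "A $ 2 $ 1"] assms
    Im_moeb_pos[of A \<tau>]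
  unfolding moeb_def Gamma0_iff SL2Z_carrier by (simp add: SL2Z_carrier moeb_def)

lemma eta_moeb_asymp:
  assumes "A \<in> carrier SL2Z"
  shows "\<exists>L>0. ((\<lambda>\<tau>. norm (eta (moeb A \<tau>)) * exp (2 * pi * cusp_order (A $ 1 $ 1) (A $ 2 $ 1) * Im \<tau>)) \<longlongrightarrow> L) at_ioo"
proof -
  have det: "A $ 1 $ 1 * A $ 2 $ 2 - A $ 1 $ 2 * A $ 2 $ 1 = 1" using assms by (simp add: SL2Z_carrier)
  obtain L where "L > 0" "((\<lambda>\<tau>. norm (eta (moeb A \<tau>)) * exp (2 * pi * cusp_order (A $ 1 $ 1) (A $ 2 $ 1) * Im \<tau>)) \<longlongrightarrow> L) at_ioo"
    using eta_cusp_asymp[OF det] Im_moeb_pos[OF assms] unfolding moeb_def by blast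
  then show ?thesis by blast
qed

lemma gmf_eta: "gmf (Gamma0 (u ^ 2 * P)) eta"
  by (rule gmf_of_norm_invariant(1)[OF level_pos eta_holomorphic eta_nonzero norm_eta_moeb eta_moeb_asymp])

lemma parabolic_gmf_eta:
  assumes "24 dvd jordan_nat * totient P"
  shows "parabolic_gmf (Gamma0 (u ^ 2 * P)) eta"
proof (rule gmf_of_norm_invariant(2)[OF level_pos eta_holomorphic eta_nonzero norm_eta_moeb eta_moeb_asymp])
  fix \<alpha> \<gamma> :: int and h :: nat
  assume "coprime \<alpha> \<gamma>" "int (u ^ 2 * P) dvd \<gamma> ^ 2 * int h"
  then obtain z :: int where z: "cusp_order \<alpha> \<gamma> * real h = real (jordan_nat * totient P) / 24 * of_int z"
    using cusp_order_integrality by blast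
  obtain m where "jordan_nat * totient P = 24 * m" using assms by blast
  then have "cusp_order \<alpha> \<gamma> * real h = of_int (int m * z)" unfolding z by simp
  then show "cusp_order \<alpha> \<gamma> * real h \<in> \<int>" by (metis Ints_of_int)
qed

lemma parabolic_gmf_eta_24: "parabolic_gmf (Gamma0 (u ^ 2 * P)) (\<lambda>\<tau>. eta \<tau> ^ 24)"
proof (rule gmf_of_norm_invariant(2)[OF level_pos, where ord = "\<lambda>\<alpha> \<gamma>. 24 * cusp_order \<alpha> \<gamma>"])
  show "(\<lambda>\<tau>. eta \<tau> ^ 24) holomorphic_on upper_half_plane" by (intro holomorphic_intros eta_holomorphic)
  show "eta \<tau> ^ 24 \<noteq> 0" if "Im \<tau> > 0" for \<tau> using eta_nonzero[OF that] by simp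
  show "norm (eta (moeb A \<tau>) ^ 24) = norm (eta \<tau> ^ 24)" if "A \<in> Gamma0 (u ^ 2 * P)" "Im \<tau> > 0" for A \<tau>
    using norm_eta_moeb[OF that] by (simp add: norm_power)
  fix A assume "A \<in> carrier SL2Z"
  then obtain L where L: "L > 0" "((\<lambda>\<tau>. norm (eta (moeb A \<tau>)) * exp (2 * pi * cusp_order (A $ 1 $ 1) (A $ 2 $ 1) * Im \<tau>)) \<longlongrightarrow> L) at_ioo"
    using eta_moeb_asymp by blast
  have "((\<lambda>\<tau>. (norm (eta (moeb A \<tau>)) * exp (2 * pi * cusp_order (A $ 1 $ 1) (A $ 2 $ 1) * Im \<tau>)) ^ 24) \<longlongrightarrow> L ^ 24) at_ioo"
    by (intro tendsto_power L)
  moreover have "(norm (eta (moeb A \<tau>)) * exp (2 * pi * cusp_order (A $ 1 $ 1) (A $ 2 $ 1) * Im \<tau>)) ^ 24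
      = norm (eta (moeb A \<tau>) ^ 24) * exp (2 * pi * (24 * cusp_order (A $ 1 $ 1) (A $ 2 $ 1)) * Im \<tau>)" for \<tau>
    unfolding power_mult_distrib norm_power exp_of_nat_mult[symmetric] by (simp add: mult_ac)
  ultimately show "\<exists>L>0. ((\<lambda>\<tau>. norm (eta (moeb A \<tau>) ^ 24) * exp (2 * pi * (24 * cusp_order (A $ 1 $ 1) (A $ 2 $ 1)) * Im \<tau>)) \<longlongrightarrow> L) at_ioo"
    using L(1) by (intro exI[of _ "L ^ 24"]) simp
next
  fix \<alpha> \<gamma> :: int and h :: nat
  assume "coprime \<alpha> \<gamma>" "int (u ^ 2 * P) dvd \<gamma> ^ 2 * int h"
  then obtain z :: int where z: "cusp_order \<alpha> \<gamma> * real h = real (jordan_nat * totient P) / 24 * of_int z"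
    using cusp_order_integrality by blast
  have "24 * cusp_order \<alpha> \<gamma> * real h = 24 * (cusp_order \<alpha> \<gamma> * real h)" by simp
  also have "\<dots> = of_int (int (jordan_nat * totient P) * z)" unfolding z by simp
  finally show "24 * cusp_order \<alpha> \<gamma> * real h \<in> \<int>" by (metis Ints_of_int)
qed

end

section \<open>Eta quotients\<close>

text \<open>An elementary substitute for Dirichlet's theorem on primes in progressions. With j the
  product of the primes of n that do not divide b, each prime of n divides exactly one of b and
  jM.\<close>

lemma coprime_shift:
  fixes b :: int and M n :: nat
  assumes "coprime b (int M)" "n > 0"
  obtains j :: nat where "j > 0" "coprime (b + int j * int M) (int n)"
proof -
  define S where "S = {p \<in> prime_factors n. \<not> int p dvd b}"
  have S: "finite S" "\<And>p. p \<in> S \<Longrightarrow> prime p" by (auto simp: S_def in_prime_factors_iff)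
  define j where "j = \<Prod>S"
  have "j > 0" unfolding j_def using S prime_gt_0_nat by (intro prod_pos) auto
  moreover have "coprime (b + int j * int M) (int n)"
    unfolding coprime_int_iff_prime_factors[OF assms(2)]
  proof (intro ballI notI)
    fix p assume p: "p \<in> prime_factors n" "int p dvd b + int j * int M"
    have pp: "prime p" using p by (simp add: in_prime_factors_iff)
    show False
    proof (cases "int p dvd b")
      case False
      then have "p \<in> S" using p by (simp add: S_def)
      then have "p dvd j" unfolding j_def using S by (intro dvd_prodI) auto
      then have "int p dvd int j * int M" by simp
      then show False using p(2) False by (metis dvd_add_left_iff)
    next
      case True
      then have "int p dvd int j * int M" using p(2) by (simp add: dvd_add_right_iff)
      then have "p dvd j * M" by (metis int_dvd_int_iff of_nat_mult)
      then have "p dvd j \<or> p dvd M" using pp prime_dvd_mult_iff by blast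
      then show False
      proof
        assume "p dvd M"
        then have "int p dvd int M" by simp
        then have "is_unit (int p)" using coprime_common_divisor[OF assms(1) True] by blast
        then show False using pp by simp
      next
        assume "p dvd j"
        then obtain q where q: "q \<in> S" "p dvd q" unfolding j_def using prime_dvd_prod_iff[OF S(1) pp] by auto
        then have "p = q" using S(2) pp primes_dvd_imp_eq by blast
        then show False using q True by (simp add: S_def)
      qed
    qed
  qed
  ultimately show ?thesis using that by blast
qed

section \<open>Logarithmic coefficients of eta quotients\<close>

definition sigma_coeff :: "nat \<Rightarrow> complex" where
  "sigma_coeff = eta_coeff 1 (\<lambda>n a. 1)"

lemma sigma_coeff_eq: "sigma_coeff k = (\<Sum>n | n dvd k. 1 / of_nat (k div n))"
  by (simp add: sigma_coeff_def eta_coeff_def zeta_root_def)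

lemma sigma_coeff_0 [simp]: "sigma_coeff 0 = 0"
  by (simp add: sigma_coeff_eq)

lemma sigma_coeff_mult: "k > 0 \<Longrightarrow> of_nat k * sigma_coeff k = of_nat (\<Sum>n | n dvd k. n)"
  unfolding sigma_coeff_eq sum_distrib_left of_nat_sum
  by (rule sum.cong[OF refl]) (auto elim!: dvdE)

definition sigma_series :: "complex \<Rightarrow> complex" where
  "sigma_series q = (\<Sum>k. sigma_coeff k * q ^ k)"

lemma sigma_series_sums:
  assumes "norm q < 1"
  shows "(\<lambda>k. sigma_coeff k * q ^ k) sums sigma_series q"
  using eta_product_exp(2)[OF assms, of "\<lambda>n a. 1" 1 1]
  by (simp add: sigma_series_def sigma_coeff_def summable_sums)

lemma sums_dvd_shift:
  fixes f :: "nat \<Rightarrow> 'a::{topological_comm_monoid_add, t2_space}"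
  assumes "t > 0" "f sums s"
  shows "(\<lambda>k. if t dvd k then f (k div t) else 0) sums s"
proof -
  have "strict_mono (\<lambda>k. t * k)" using assms(1) by (simp add: strict_mono_def)
  moreover have "(if t dvd n then f (n div t) else 0) = 0" if "n \<notin> range (\<lambda>k. t * k)" for n
    using that by auto
  ultimately have "(\<lambda>n. if t dvd t * n then f (t * n div t) else 0) sums s \<longleftrightarrow> (\<lambda>k. if t dvd k then f (k div t) else 0) sums s"
    by (rule sums_mono_reindex)
  then show ?thesis using assms by simp
qed

lemma dedekind_eta_exp:
  assumes "Im \<tau> > 0"
  shows "dedekind_eta \<tau> = q_of (\<tau> / 24) * exp (- sigma_series (q_of \<tau>))"
proof -
  have q: "norm (q_of \<tau>) < 1" by (rule norm_q_of_less_1[OF assms])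
  have "1 - q_of \<tau> ^ Suc n \<noteq> 0" for n
    using norm_power_mult_less_1[OF q q, of n] by auto
  then have "(\<Prod>a=1..1. (1 - zeta_root 1 ^ a * q_of \<tau> ^ Suc n) powr 1) = 1 - q_of \<tau> ^ Suc n" for n
    by (simp add: zeta_root_def)
  then show ?thesis
    using eta_product_exp(3)[OF q, of "\<lambda>n a. 1" 1 1]
    unfolding dedekind_eta_def sigma_series_def sigma_coeff_def by simp
qed

lemma dedekind_eta_nonzero: "Im \<tau> > 0 \<Longrightarrow> dedekind_eta \<tau> \<noteq> 0"
  by (simp add: dedekind_eta_exp)

lemma sigma_coeff_real: "sigma_coeff k = of_real (Re (sigma_coeff k))"
  unfolding sigma_coeff_eq by simp

lemma sigma_series_real:
  assumes "0 < x" "x < (1::real)"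
  shows "sigma_series (of_real x) = of_real (Re (sigma_series (of_real x)))"
proof -
  have "norm (of_real x :: complex) < 1" using assms by simp
  from sigma_series_sums[OF this] have s: "(\<lambda>k. of_real (Re (sigma_coeff k) * x ^ k)) sums sigma_series (of_real x)"
    by (subst (asm) sigma_coeff_real) simp
  have "(\<lambda>k. of_real (Re (sigma_coeff k) * x ^ k) :: complex) sums of_real (Re (sigma_series (of_real x)))"
    using sums_Re[OF s] by (intro sums_of_real) simp
  then show ?thesis using s sums_unique2 by blast
qed

lemma exp_of_real_powr: "exp (of_real r) powr a = exp (a * of_real r :: complex)"
proof -
  have "Ln (exp (of_real r)) = of_real (ln (exp r))" unfolding exp_of_real by (rule Ln_of_real) simp
  then show ?thesis by (simp add: powr_def)
qed

text \<open>On the imaginary axis eta is positive, so the principal branch is additive in the exponents.\<close>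

lemma dedekind_eta_imaginary_powr:
  assumes x: "0 < x" "x < (1::real)" and t: "t > 0"
  shows "dedekind_eta (of_nat t * (\<i> * of_real (- ln x / (2 * pi)))) powr a
       = exp (a * (of_nat t / 24 * of_real (ln x) - sigma_series (of_real x ^ t)))"
proof -
  define \<tau> where "\<tau> = of_nat t * (\<i> * of_real (- ln x / (2 * pi)))"
  have lnx: "ln x < 0" using x by simp
  have Im: "Im \<tau> > 0" using lnx t by (simp add: \<tau>_def mult_pos_neg divide_neg_pos)
  have e: "2 * of_real pi * \<i> * \<tau> = of_nat t * of_real (ln x)"
    by (simp add: \<tau>_def complex_eq_iff)
  have q: "q_of \<tau> = of_real x ^ t"
    unfolding q_of_def e using x by (simp add: exp_of_nat_mult exp_of_real)
  have "2 * of_real pi * \<i> * (\<tau> / 24) = of_nat t / 24 * of_real (ln x)"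
    using e by simp
  then have q24: "q_of (\<tau> / 24) = exp (of_real (of_nat t / 24 * ln x))"
    by (simp only: q_of_def) simp
  have xt: "0 < x ^ t" "x ^ t < 1" using x t by (auto simp: power_less_one_iff)
  define r where "r = of_nat t / 24 * ln x - Re (sigma_series (of_real (x ^ t)))"
  have r: "of_real r = of_nat t / 24 * of_real (ln x) - sigma_series (of_real x ^ t)"
    using sigma_series_real[OF xt] by (simp add: r_def)
  have "dedekind_eta \<tau> = exp (of_real (of_nat t / 24 * ln x)) * exp (- sigma_series (of_real x ^ t))"
    by (simp only: dedekind_eta_exp[OF Im] q q24)
  also have "\<dots> = exp (of_real r)"
    unfolding exp_add[symmetric] by (rule arg_cong[of _ _ exp]) (simp add: r)
  finally have "dedekind_eta \<tau> powr a = exp (a * of_real r)"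
    by (simp only: exp_of_real_powr)
  then show ?thesis unfolding \<tau>_def[symmetric] by (simp only: r)
qed

text \<open>The identity is known only on (0, 1), where the principal branch is additive. It extends
  to the right half of the disc, where Ln is holomorphic, and differentiation gives K = z
  e'(z).\<close>

lemma power_series_log_constant:
  fixes E :: "nat \<Rightarrow> complex"
  assumes E: "\<And>z. norm z < 1 \<Longrightarrow> (\<lambda>k. E k * z ^ k) sums e z"
    and W: "\<And>x. 0 < x \<Longrightarrow> x < 1 \<Longrightarrow> exp (K * of_real (ln x) - e (of_real x)) = c"
    and k: "k > 0"
  shows "E k = 0"
proof -
  define R where "R = {z. 0 < Re z} \<inter> ball (0::complex) 1"
  have R: "open R" "connected R"
    unfolding R_def by (auto intro!: open_Int open_halfspace_Re_gt convex_connected convex_Int convex_halfspace_Re_gt)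
  have e_hol: "e holomorphic_on ball 0 1"
    by (rule power_series_holomorphic[where a = E]) (use E in auto)
  define Wf where "Wf z = K * Ln z - e z" for z
  have Wf_hol: "Wf holomorphic_on R"
    unfolding Wf_def[abs_def]
    by (intro holomorphic_intros holomorphic_on_subset[OF e_hol]) (auto simp: R_def complex_nonpos_Reals_iff)
  define U :: "complex set" where "U = of_real ` {0<..<1::real}"
  have UR: "U \<subseteq> R" by (auto simp: U_def R_def)
  have half: "(1/2 :: complex) \<in> R" by (auto simp: R_def)
  have lim: "(1/2 :: complex) islimpt U"
  proof -
    have "(1/2 :: real) islimpt {0<..<1}" by (simp add: islimpt_greaterThanLessThan1 open_imp_islimpt)
    then obtain f where f: "\<And>n. f n \<in> {0<..<1::real} - {1/2}" "f \<longlonglongrightarrow> 1/2" by (auto simp: islimpt_sequential)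
    show ?thesis unfolding islimpt_sequential
    proof (intro exI conjI allI)
      show "of_real (f n) \<in> U - {1/2}" for n
      proof -
        have "f n \<noteq> 1/2" using f(1)[of n] by simp
        then have "complex_of_real (f n) \<noteq> of_real (1/2)" by (simp only: of_real_eq_iff not_False_eq_True)
        then show ?thesis using f(1)[of n] by (auto simp: U_def)
      qed
      show "(\<lambda>n. of_real (f n)) \<longlonglongrightarrow> (1/2::complex)"
        using tendsto_of_real[OF f(2), where ?'a = complex] by simp
    qed
  qed
  have "exp (Wf z) - c = 0" if "z \<in> R" for z
  proof (rule analytic_continuation[where f = "\<lambda>z. exp (Wf z) - c", OF _ R UR half lim _ that])
    show "(\<lambda>z. exp (Wf z) - c) holomorphic_on R" by (intro holomorphic_intros Wf_hol)
    show "exp (Wf z) - c = 0" if "z \<in> U" for z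
      using that W by (auto simp: U_def Wf_def Ln_of_real)
  qed
  then have expW: "exp (Wf z) = c" if "z \<in> R" for z using that by simp
  have c0: "c \<noteq> 0" using expW[OF half] by (metis exp_not_eq_zero)
  have dW: "deriv Wf z = 0" if z: "z \<in> R" for z
  proof -
    have dz: "(Wf has_field_derivative deriv Wf z) (at z)"
      using Wf_hol R(1) z holomorphic_derivI by blast
    have "((\<lambda>z. exp (Wf z)) has_field_derivative exp (Wf z) * deriv Wf z) (at z)"
      by (rule DERIV_chain2[OF DERIV_exp dz])
    moreover have "((\<lambda>z. exp (Wf z)) has_field_derivative 0) (at z)"
    proof (rule DERIV_cong_ev[THEN iffD1, OF refl _ refl DERIV_const])
      show "\<forall>\<^sub>F x in nhds z. c = exp (Wf x)"
        using eventually_nhds_in_open[OF R(1) z] by eventually_elim (simp add: expW)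
    qed
    ultimately have "exp (Wf z) * deriv Wf z = 0" by (rule DERIV_unique)
    then show ?thesis by simp
  qed
  have e_deriv: "K - z * deriv e z = 0" if z: "z \<in> R" for z
  proof -
    have zz: "z \<in> ball 0 1" "z \<notin> \<real>\<^sub>\<le>\<^sub>0" "z \<noteq> 0" using z by (auto simp: R_def complex_nonpos_Reals_iff)
    have "(e has_field_derivative deriv e z) (at z)"
      using e_hol zz holomorphic_derivI open_ball by blast
    then have "(Wf has_field_derivative K * (1 / z) - deriv e z) (at z)"
      unfolding Wf_def[abs_def] using zz by (auto intro!: derivative_eq_intros simp: divide_inverse)
    then have "deriv Wf z = K * (1 / z) - deriv e z" by (rule DERIV_imp_deriv)
    then have "K * (1 / z) - deriv e z = 0" using dW[OF z] by simp
    then show ?thesis using zz by (simp add: field_simps)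
  qed
  \<comment> \<open>No logarithm is left in this equation, so it continues to the whole disc. Its
    value at z = 0 is K = 0, and then e' = 0.\<close>
  have all: "K - z * deriv e z = 0" if "z \<in> ball 0 1" for z
  proof (rule analytic_continuation[where f = "\<lambda>z. K - z * deriv e z" and w = z and S = "ball 0 1" and U = R and \<xi> = "1/2"])
    show "(\<lambda>z. K - z * deriv e z) holomorphic_on ball 0 1"
      by (intro holomorphic_intros holomorphic_deriv e_hol) auto
    show "(1/2::complex) islimpt R" by (rule islimpt_subset[OF lim UR])
  qed (use that e_deriv in \<open>auto simp: R_def\<close>)
  have K0: "K = 0" using all[of 0] by simp
  have de0: "deriv e z = 0" if "z \<in> ball 0 1" for z
  proof (cases "z = 0")
    case False then show ?thesis using all[OF that] K0 by simp
  next
    case True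
    have "isCont (deriv e) 0"
      using holomorphic_on_imp_continuous_on[OF holomorphic_deriv[OF e_hol open_ball]]
      by (rule continuous_on_interior) simp
    then have "(deriv e \<longlongrightarrow> deriv e 0) (at 0)" by (simp add: isCont_def)
    moreover have "(deriv e \<longlongrightarrow> 0) (at 0)"
    proof (rule tendsto_eventually, rule eventually_mono)
      show "\<forall>\<^sub>F x in at (0::complex). x \<in> ball 0 1 - {0}" by (intro eventually_at_in_open) auto
    qed (use all K0 in auto)
    ultimately have "deriv e 0 = 0" using tendsto_unique[of "at (0::complex)" "deriv e"] by simp
    then show ?thesis using True by simp
  qed
  obtain ec where ec: "\<And>z. z \<in> ball 0 1 \<Longrightarrow> e z = ec"
  proof (rule DERIV_zero_connected_constant[of "ball 0 1" "{}" e])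
    show "\<forall>x\<in>ball 0 1 - {}. (e has_field_derivative 0) (at x)"
    proof
      fix x :: complex assume "x \<in> ball 0 1 - {}"
      then have "x \<in> ball 0 1" by simp
      from holomorphic_derivI[OF e_hol open_ball this] show "(e has_field_derivative 0) (at x)"
        unfolding de0[OF \<open>x \<in> ball 0 1\<close>] .
    qed
    show "continuous_on (ball 0 1) e" using e_hol holomorphic_on_imp_continuous_on by blast
  qed auto
  have e_const: "e z = e 0" if "z \<in> ball 0 1" for z
    using ec[OF that] ec[of 0] by simp
  show ?thesis
  proof (rule ccontr)
    assume Ek: "E k \<noteq> 0"
    define E' where "E' n = (if n = 0 then 0 else E n)" for n
    have "(\<lambda>n. E' n * (z - 0) ^ n) sums (e z - e 0)" if "norm (z - 0) < 1" for z
    proof -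
      have "(\<lambda>k. E k * 0 ^ k) sums e 0" by (rule E) simp
      then have "e 0 = E 0" by (rule sums_unique2[OF _ powser_sums_zero])
      have "(\<lambda>n. E n * z ^ n - (if n = 0 then E 0 else 0)) sums (e z - E 0)"
        using E[of z] that by (intro sums_diff) (auto intro: sums_single)
      moreover have "E n * z ^ n - (if n = 0 then E 0 else 0) = E' n * (z - 0) ^ n" for n by (simp add: E'_def)
      ultimately show ?thesis using \<open>e 0 = E 0\<close> by simp
    qed
    then obtain s where s: "s > 0" "\<And>z. z \<in> cball 0 s - {0} \<Longrightarrow> e z - e 0 \<noteq> 0"
      using powser_0_nonzero[of 1 0 E' "\<lambda>z. e z - e 0" k] Ek k by (auto simp: E'_def)
    define z where "z = complex_of_real (min s (1/2))"
    have zz: "z \<in> cball 0 s - {0}" "z \<in> ball 0 1" using s(1) by (auto simp: z_def)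
    then show False using s(2)[OF zz(1)] e_const[OF zz(2)] by simp
  qed
qed

context real_primitive_character begin

text \<open>For n m = k the sum over a is the Gauss sum twisted by m, equal to \<psi>(m) times
  \<open>gauss\<close>. With the factor \<psi>(n) this is \<psi>(k) for every divisor, and 1/m times
  k leaves n.\<close>

lemma eta_coeff_coprime:
  assumes k: "k > 0" "coprime (int k) (int M)"
  shows "of_nat k * eta_coeff u (\<lambda>n a. of_int (weight (int n) (int a))) k = of_int (\<psi> (int k)) * gauss * of_nat (\<Sum>n | n dvd k. n)"
proof -
  have "of_nat k * eta_coeff u (\<lambda>n a. of_int (weight (int n) (int a))) k = (\<Sum>n | n dvd k. of_int (\<psi> (int k)) * gauss * of_nat n)"
    unfolding eta_coeff_def sum_distrib_left
  proof (rule sum.cong[OF refl])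
    fix n assume "n \<in> {n. n dvd k}"
    then obtain m where m: "k = n * m" by auto
    then have nm: "n > 0" "m > 0" using k by auto
    have cn: "coprime (int n) (int P)" using k by (simp add: m M_def)
    have z: "zeta_root u ^ (a * m) = ee (int a * int m)" for a
      by (simp add: ee_def zeta_root_def q_of_def exp_of_nat_mult[symmetric] mult_ac)
    have "(\<Sum>a=1..u. of_int (\<psi> (int a)) * ee (int a * int m)) = (\<Sum>j\<in>{0..<int u}. of_int (\<psi> (1 * j + 1)) * ee ((1 * j + 1) * int m))"
      by (rule sum.reindex_bij_witness[of _ "\<lambda>j. nat (j + 1)" "\<lambda>a. int a - 1"]) auto
    also have "\<dots> = (\<Sum>a\<in>{0..<int u}. of_int (\<psi> a) * ee (a * int m))"
      by (rule sum_periodic_affine[of "int u" 1 "\<lambda>a. of_int (\<psi> a) * ee (a * int m)"])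
         (use u_pos in \<open>auto simp: psi_per distrib_right ee_add\<close>)
    also have "\<dots> = of_int (\<psi> (int m)) * gauss" by (rule gauss_separable)
    finally have g: "(\<Sum>a=1..u. of_int (\<psi> (int a)) * ee (int a * int m)) = of_int (\<psi> (int m)) * gauss" .
    have "(\<Sum>a=1..u. of_nat k * (of_int (weight (int n) (int a)) * zeta_root u ^ (a * (k div n)) / of_nat (k div n)))
       = of_nat n * of_int (\<psi> (int n)) * (\<Sum>a=1..u. of_int (\<psi> (int a)) * ee (int a * int m))"
      unfolding sum_distrib_left
      by (rule sum.cong[OF refl]) (use nm cn in \<open>simp add: m weight_def chi_def z\<close>)
    also have "\<dots> = of_int (\<psi> (int k)) * gauss * of_nat n"
      unfolding g by (simp add: m psi_mult)
    finally show "(\<Sum>a=1..u. of_nat k * (of_int (weight (int n) (int a)) * zeta_root u ^ (a * (k div n)) / of_nat (k div n)))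
       = of_int (\<psi> (int k)) * gauss * of_nat n" .
  qed
  then show ?thesis by (simp add: sum_distrib_left)
qed

lemma psi_trivial_of_eta_quotient:
  assumes eq: "eta_quotient eta" and b: "coprime b (int M)"
  shows "\<psi> b = 1"
proof -
  obtain m c a where m: "m > 0" and f: "\<And>\<tau>. Im \<tau> > 0 \<Longrightarrow> eta \<tau> = c * (\<Prod>t | t dvd m. dedekind_eta (of_nat t * \<tau>) powr a t)"
  proof -
    obtain m c a where *: "m > 0" "\<forall>\<tau>\<in>upper_half_plane. eta \<tau> = c * (\<Prod>t | t dvd m. dedekind_eta (of_nat t * \<tau>) powr a t)"
      using eq unfolding eta_quotient_def by blast
    show ?thesis by (rule that[OF *(1) bspec[OF *(2)]]) (simp add: upper_half_plane_iff)
  qed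
  have fin: "finite {t. t dvd m}" using m by simp
  define C where "C = eta_coeff u (\<lambda>n a. of_int (weight (int n) (int a)))"
  define Cs where "Cs z = (\<Sum>k. C k * z ^ k)" for z
  define E where "E k = C k - (\<Sum>t | t dvd m. a t * (if t dvd k then sigma_coeff (k div t) else 0))" for k
  define e where "e z = Cs z - (\<Sum>t | t dvd m. a t * sigma_series (z ^ t))" for z
  \<comment> \<open>The difference of the exponents of the leading powers of q on the two sides; on
    the imaginary axis such a power is the exponential of its exponent times ln x.\<close>
  define K where "K = of_real kappa - (\<Sum>t | t dvd m. a t * (of_nat t / 24))"
  have Esums: "(\<lambda>k. E k * z ^ k) sums e z" if z: "norm z < 1" for z
  proof -
    have "(\<lambda>k. C k * z ^ k) sums Cs z"
      unfolding Cs_def C_def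
      by (intro summable_sums eta_product_exp(2)[of z "\<lambda>n a. of_int (weight (int n) (int a))" 1 u, OF z norm_weight])
    moreover have "(\<lambda>k. \<Sum>t | t dvd m. a t * (if t dvd k then sigma_coeff (k div t) * z ^ k else 0)) sums (\<Sum>t | t dvd m. a t * sigma_series (z ^ t))"
    proof (intro sums_sum sums_mult)
      fix t assume "t \<in> {t. t dvd m}"
      then have t: "t > 0" using m by (auto intro: Nat.gr0I)
      have "norm (z ^ t) < 1" using z t by (simp add: norm_power power_less_one_iff)
      from sums_dvd_shift[OF t sigma_series_sums[OF this]]
      show "(\<lambda>k. if t dvd k then sigma_coeff (k div t) * z ^ k else 0) sums sigma_series (z ^ t)"
        by (rule sums_cong[THEN iffD1, rotated]) (auto simp: power_mult[symmetric])
    qed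
    ultimately have "(\<lambda>k. C k * z ^ k - (\<Sum>t | t dvd m. a t * (if t dvd k then sigma_coeff (k div t) * z ^ k else 0))) sums e z"
      unfolding e_def by (rule sums_diff)
    moreover have "C k * z ^ k - (\<Sum>t | t dvd m. a t * (if t dvd k then sigma_coeff (k div t) * z ^ k else 0)) = E k * z ^ k" for k
      unfolding E_def left_diff_distrib sum_distrib_right
      by (rule arg_cong2[of _ _ _ _ minus], rule refl, rule sum.cong[OF refl]) simp
    ultimately show ?thesis by simp
  qed
  have W: "exp (K * of_real (ln x) - e (of_real x)) = c" if x: "0 < x" "x < 1" for x
  proof -
    define \<tau> where "\<tau> = \<i> * complex_of_real (- ln x / (2 * pi))"
    have Im: "Im \<tau> > 0" using x by (simp add: \<tau>_def divide_neg_pos)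
    have arg: "2 * of_real pi * \<i> * \<tau> = of_real (ln x)" by (simp add: \<tau>_def)
    have q: "q_of \<tau> = of_real x" unfolding q_of_def arg using x by (simp add: exp_of_real)
    have "2 * of_real pi * \<i> * (of_real kappa * \<tau>) = of_real kappa * (2 * of_real pi * \<i> * \<tau>)" by simp
    then have qk: "q_of (of_real kappa * \<tau>) = exp (of_real kappa * of_real (ln x))"
      by (simp only: q_of_def arg)
    have "eta \<tau> = exp (of_real kappa * of_real (ln x) - Cs (of_real x))"
      unfolding eta_exp[OF Im] q qk Cs_def C_def by (simp add: exp_diff exp_minus divide_inverse)
    moreover have "(\<Prod>t | t dvd m. dedekind_eta (of_nat t * \<tau>) powr a t) = exp (\<Sum>t | t dvd m. a t * (of_nat t / 24 * of_real (ln x) - sigma_series (of_real x ^ t)))"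
      unfolding exp_sum[OF fin]
    proof (rule prod.cong[OF refl])
      fix t assume "t \<in> {t. t dvd m}"
      then have t: "t > 0" using m by (auto intro: Nat.gr0I)
      show "dedekind_eta (of_nat t * \<tau>) powr a t = exp (a t * (of_nat t / 24 * of_real (ln x) - sigma_series (of_real x ^ t)))"
        unfolding \<tau>_def by (rule dedekind_eta_imaginary_powr[OF x t])
    qed
    moreover have "K * of_real (ln x) - e (of_real x) = (of_real kappa * of_real (ln x) - Cs (of_real x))
        - (\<Sum>t | t dvd m. a t * (of_nat t / 24 * of_real (ln x) - sigma_series (of_real x ^ t)))"
      unfolding K_def e_def by (simp add: algebra_simps sum_subtractf sum_distrib_left sum_distrib_right)
    ultimately have "exp (K * of_real (ln x) - e (of_real x)) * (\<Prod>t | t dvd m. dedekind_eta (of_nat t * \<tau>) powr a t) = eta \<tau>"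
      by (simp only: exp_diff) simp
    moreover have "(\<Prod>t | t dvd m. dedekind_eta (of_nat t * \<tau>) powr a t) \<noteq> 0"
      using f[OF Im] eta_nonzero[OF Im] by (metis mult_zero_right)
    ultimately show ?thesis unfolding f[OF Im] by (rule mult_right_cancel[THEN iffD1, rotated])
  qed
  have E0: "E k = 0" if "k > 0" for k
    using power_series_log_constant[OF Esums W that] .
  have main: "of_int (\<psi> (int k)) * gauss = a 1" if k: "k > 0" "coprime (int k) (int M)" "coprime (int k) (int m)" for k
  proof -
    have "(\<Sum>t | t dvd m. a t * (if t dvd k then sigma_coeff (k div t) else 0)) = (\<Sum>t\<in>{1}. a t * sigma_coeff (k div t))"
    proof (rule sum.mono_neutral_cong_right)
      show "\<forall>t\<in>{t. t dvd m} - {1}. a t * (if t dvd k then sigma_coeff (k div t) else 0) = 0"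
        using k(3) by (auto simp: coprime_int_iff dest: coprime_common_divisor_nat)
    qed (use fin in auto)
    then have "C k = a 1 * sigma_coeff k" using E0[OF k(1)] by (simp add: E_def)
    then have "of_nat k * C k = a 1 * (of_nat k * sigma_coeff k)" by simp
    then have "of_int (\<psi> (int k)) * gauss * of_nat (\<Sum>n | n dvd k. n) = a 1 * of_nat (\<Sum>n | n dvd k. n)"
      unfolding C_def eta_coeff_coprime[OF k(1,2)] sigma_coeff_mult[OF k(1)] .
    moreover have "(\<Sum>n | n dvd k. n) \<ge> k"
      using k(1) by (intro member_le_sum) auto
    then have "(of_nat (\<Sum>n | n dvd k. n) :: complex) \<noteq> 0"
      using k(1) by (simp only: of_nat_eq_0_iff)
    ultimately show ?thesis by simp
  qed
  \<comment> \<open>The case k = 1 identifies the constant, so \<psi>(k) = 1 for all admissible k.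
    It remains to find an admissible k in the class of b modulo M.\<close>
  have "a 1 = gauss" using main[of 1] by simp
  define b0 where "b0 = b mod int M"
  have "coprime b0 (int M)" using b M_gt_1 by (simp add: b0_def coprime_mod_left_iff del: of_nat_mult)
  then obtain j where j: "j > 0" "coprime (b0 + int j * int M) (int m)"
    using coprime_shift[OF _ m] by blast
  define k where "k = nat (b0 + int j * int M)"
  have M0: "M > 0" using M_gt_1 by simp
  have b0: "b0 \<ge> 0" using M0 by (simp add: b0_def)
  have "int j * int M > 0" using j(1) M0 by simp
  then have k: "int k = b0 + int j * int M" "k > 0" using b0 by (auto simp: k_def)
  have "coprime (int k) (int M)" unfolding k(1) using \<open>coprime b0 (int M)\<close>
    by (metis coprime_iff_gcd_eq_1 gcd_add_mult gcd.commute add.commute)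
  then have "of_int (\<psi> (int k)) * gauss = gauss" using main[OF k(2)] j(2) k(1) \<open>a 1 = gauss\<close> by simp
  then have "(of_int (\<psi> (int k)) :: complex) = 1" using gauss_nonzero by simp
  then have "\<psi> (int k) = 1" by (simp only: of_int_eq_1_iff)
  moreover have "[int k = b] (mod int u)"
  proof -
    have "[int k = b] (mod int M)" unfolding k(1) b0_def by (simp add: cong_def)
    then show ?thesis by (rule cong_dvd_modulus) (simp add: M_def)
  qed
  ultimately show ?thesis using psi_cong[of "int k" b] by simp
qed

end

text \<open>The coefficient of q^k in minus the logarithm of the product of 1 - q^n over the n
  divisible by no prime in S.\<close>

definition sieved_coeff :: "nat set \<Rightarrow> nat \<Rightarrow> complex" where
  "sieved_coeff S k = (\<Sum>n | n dvd k \<and> (\<forall>p\<in>S. \<not> p dvd n). 1 / of_nat (k div n))"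

lemma sieved_coeff_insert:
  assumes p: "prime p" "p \<notin> S" "\<And>r. r \<in> S \<Longrightarrow> prime r"
  shows "sieved_coeff (insert p S) k = sieved_coeff S k - (if p dvd k then sieved_coeff S (k div p) else 0)"
proof (cases "k = 0")
  case True
  then show ?thesis using True by (simp add: sieved_coeff_def)
next
  case False
  define A where "A = {n. n dvd k \<and> (\<forall>r\<in>S. \<not> r dvd n)}"
  have fin: "finite A" using False by (auto simp: A_def intro: finite_subset[of _ "{n. n dvd k}"])
  have p0: "p > 0" using p(1) prime_gt_0_nat by blast
  have "sieved_coeff S k = (\<Sum>n\<in>A \<inter> {n. \<not> p dvd n}. 1 / of_nat (k div n)) + (\<Sum>n\<in>A \<inter> {n. p dvd n}. 1 / of_nat (k div n))"
    unfolding sieved_coeff_def A_def[symmetric]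
    by (subst sum.union_disjoint[symmetric]) (use fin in \<open>auto intro!: sum.cong\<close>)
  also have "A \<inter> {n. \<not> p dvd n} = {n. n dvd k \<and> (\<forall>r\<in>insert p S. \<not> r dvd n)}" by (auto simp: A_def)
  also have "(\<Sum>n\<in>A \<inter> {n. p dvd n}. 1 / of_nat (k div n)) = (if p dvd k then sieved_coeff S (k div p) else 0)"
  proof (cases "p dvd k")
    case pk: True
    then obtain l where l: "k = p * l" by blast
    have rp: "r dvd p * n \<longleftrightarrow> r dvd n" if "r \<in> S" for r n
    proof -
      have "\<not> r dvd p" using primes_dvd_imp_eq[of r p] p that by auto
      then show ?thesis using prime_dvd_mult_iff[OF p(3)[OF that]] by simp
    qed
    have "(\<Sum>n\<in>A \<inter> {n. p dvd n}. 1 / of_nat (k div n)) = (\<Sum>n | n dvd l \<and> (\<forall>r\<in>S. \<not> r dvd n). 1 / (of_nat (l div n) :: complex))"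
      by (rule sum.reindex_bij_witness[of _ "\<lambda>n. p * n" "\<lambda>n. n div p"])
         (use p0 rp in \<open>auto simp: A_def l elim!: dvdE\<close>)
    then show ?thesis using pk p0 by (simp add: sieved_coeff_def l)
  next
    case pk: False
    then have "A \<inter> {n. p dvd n} = {}" using dvd_trans by (auto simp: A_def)
    then show ?thesis using pk by simp
  qed
  finally show ?thesis by (simp add: sieved_coeff_def)
qed

lemma divisors_prime_mult:
  assumes "prime (p::nat)" "\<not> p dvd D"
  shows "{t. t dvd p * D} = {t. t dvd D} \<union> (\<lambda>t. p * t) ` {t. t dvd D}" "{t. t dvd D} \<inter> (\<lambda>t. p * t) ` {t. t dvd D} = {}"
proof -
  show "{t. t dvd p * D} = {t. t dvd D} \<union> (\<lambda>t. p * t) ` {t. t dvd D}"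
  proof (intro equalityI subsetI)
    fix t assume t: "t \<in> {t. t dvd p * D}"
    show "t \<in> {t. t dvd D} \<union> (\<lambda>t. p * t) ` {t. t dvd D}"
    proof (cases "p dvd t")
      case True
      then show ?thesis using t assms(1) prime_gt_0_nat by auto
    next
      case False
      then have "coprime t p" using assms(1) by (simp add: prime_imp_coprime coprime_commute)
      then show ?thesis using t by (simp add: coprime_dvd_mult_right_iff)
    qed
  qed auto
  show "{t. t dvd D} \<inter> (\<lambda>t. p * t) ` {t. t dvd D} = {}"
    using assms(2) by (auto dest: dvd_mult_left)
qed

text \<open>Adding a prime p to S removes the factors with p dividing n, which replaces f(\<tau>) by
  f(\<tau>)/f(p \<tau>). The leading exponent is multiplied by 1 - p accordingly.\<close>

lemma sieved_product_eta_quotient: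
  assumes "finite S" "\<And>p. p \<in> S \<Longrightarrow> prime p"
  shows "\<exists>a :: nat \<Rightarrow> int. \<forall>\<tau>. Im \<tau> > 0 \<longrightarrow>
     summable (\<lambda>k. sieved_coeff S k * q_of \<tau> ^ k) \<and>
     q_of (of_real ((\<Prod>p\<in>S. 1 - real p) / 24) * \<tau>) * exp (- (\<Sum>k. sieved_coeff S k * q_of \<tau> ^ k))
     = (\<Prod>t | t dvd \<Prod>S. dedekind_eta (of_nat t * \<tau>) powi a t)"
  using assms
proof (induction S rule: finite_induct)
  case empty
  have c: "sieved_coeff {} = sigma_coeff" by (rule ext) (simp add: sieved_coeff_def sigma_coeff_eq)
  show ?case
  proof (intro exI[of _ "\<lambda>_. 1"] allI impI conjI)
    fix \<tau> assume \<tau>: "Im \<tau> > 0"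
    show "summable (\<lambda>k. sieved_coeff {} k * q_of \<tau> ^ k)"
      unfolding c using sigma_series_sums[OF norm_q_of_less_1[OF \<tau>]] by (simp add: sums_iff)
    show "q_of (of_real ((\<Prod>p\<in>{}. 1 - real p) / 24) * \<tau>) * exp (- (\<Sum>k. sieved_coeff {} k * q_of \<tau> ^ k))
     = (\<Prod>t | t dvd \<Prod>{}. dedekind_eta (of_nat t * \<tau>) powi 1)"
      unfolding c using dedekind_eta_exp[OF \<tau>] by (simp add: sigma_series_def)
  qed
next
  case (insert p S)
  have pp: "prime p" and S: "\<And>r. r \<in> S \<Longrightarrow> prime r" using insert.prems by auto
  have p0: "p > 0" using pp prime_gt_0_nat by blast
  define D where "D = \<Prod>S"
  have "\<not> p dvd D"
  proof
    assume "p dvd D"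
    then obtain r where "r \<in> S" "p dvd r" unfolding D_def using prime_dvd_prod_iff[OF insert.hyps(1) pp] by auto
    then have "p = r" using primes_dvd_imp_eq[OF pp S] by blast
    then show False using \<open>r \<in> S\<close> insert.hyps(2) by simp
  qed
  note div = divisors_prime_mult[OF pp this]
  have D0: "D > 0" unfolding D_def using S prime_gt_0_nat by (intro prod_pos) auto
  obtain a :: "nat \<Rightarrow> int" where a: "\<And>\<tau>. Im \<tau> > 0 \<Longrightarrow> summable (\<lambda>k. sieved_coeff S k * q_of \<tau> ^ k)"
    "\<And>\<tau>. Im \<tau> > 0 \<Longrightarrow> q_of (of_real ((\<Prod>p\<in>S. 1 - real p) / 24) * \<tau>) * exp (- (\<Sum>k. sieved_coeff S k * q_of \<tau> ^ k))
     = (\<Prod>t | t dvd D. dedekind_eta (of_nat t * \<tau>) powi a t)"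
  proof -
    have "\<exists>a :: nat \<Rightarrow> int. \<forall>\<tau>. Im \<tau> > 0 \<longrightarrow> summable (\<lambda>k. sieved_coeff S k * q_of \<tau> ^ k) \<and>
     q_of (of_real ((\<Prod>p\<in>S. 1 - real p) / 24) * \<tau>) * exp (- (\<Sum>k. sieved_coeff S k * q_of \<tau> ^ k))
     = (\<Prod>t | t dvd D. dedekind_eta (of_nat t * \<tau>) powi a t)"
      unfolding D_def by (rule insert.IH) (rule S)
    then obtain a :: "nat \<Rightarrow> int" where *: "\<forall>\<tau>. Im \<tau> > 0 \<longrightarrow> summable (\<lambda>k. sieved_coeff S k * q_of \<tau> ^ k) \<and>
     q_of (of_real ((\<Prod>p\<in>S. 1 - real p) / 24) * \<tau>) * exp (- (\<Sum>k. sieved_coeff S k * q_of \<tau> ^ k))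
     = (\<Prod>t | t dvd D. dedekind_eta (of_nat t * \<tau>) powi a t)" by (elim exE)
    show ?thesis by (rule that[of a]) (use * in simp_all)
  qed
  \<comment> \<open>The divisors of pD are those of D and their multiples by p, and the latter
    receive the opposite sign. Iterated from the constant 1, this produces the Mobius
    function.\<close>
  define a' where "a' t = (if p dvd t then - a (t div p) else a t)" for t
  show ?case
  proof (intro exI[of _ a'] allI impI conjI)
    fix \<tau> assume \<tau>: "Im \<tau> > 0"
    define s where "s \<tau> = (\<Sum>k. sieved_coeff S k * q_of \<tau> ^ k)" for \<tau>
    have p\<tau>: "Im (of_nat p * \<tau>) > 0" using \<tau> p0 by simp
    have s1: "(\<lambda>k. sieved_coeff S k * q_of \<tau> ^ k) sums s \<tau>" unfolding s_def using a(1)[OF \<tau>] by (rule summable_sums)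
    have "(\<lambda>k. sieved_coeff S k * q_of (of_nat p * \<tau>) ^ k) sums s (of_nat p * \<tau>)" unfolding s_def using a(1)[OF p\<tau>] by (rule summable_sums)
    from sums_dvd_shift[OF p0 this]
    have s2: "(\<lambda>k. if p dvd k then sieved_coeff S (k div p) * q_of \<tau> ^ k else 0) sums s (of_nat p * \<tau>)"
    proof (rule sums_cong[THEN iffD1, rotated])
      fix k
      have "q_of (of_nat p * \<tau>) ^ (k div p) = q_of \<tau> ^ k" if "p dvd k"
        unfolding q_of_power[of \<tau> p, symmetric] power_mult[symmetric] using that by simp
      then show "(if p dvd k then sieved_coeff S (k div p) * q_of (of_nat p * \<tau>) ^ (k div p) else 0) =
         (if p dvd k then sieved_coeff S (k div p) * q_of \<tau> ^ k else 0)" by simp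
    qed
    have "(\<lambda>k. sieved_coeff S k * q_of \<tau> ^ k - (if p dvd k then sieved_coeff S (k div p) * q_of \<tau> ^ k else 0)) sums (s \<tau> - s (of_nat p * \<tau>))"
      by (rule sums_diff[OF s1 s2])
    moreover have "sieved_coeff S k * q_of \<tau> ^ k - (if p dvd k then sieved_coeff S (k div p) * q_of \<tau> ^ k else 0) = sieved_coeff (insert p S) k * q_of \<tau> ^ k" for k
    proof -
      have "sieved_coeff (insert p S) k = sieved_coeff S k - (if p dvd k then sieved_coeff S (k div p) else 0)"
        by (rule sieved_coeff_insert[OF pp insert.hyps(2)]) (rule S)
      then show ?thesis by (simp add: left_diff_distrib)
    qed
    ultimately have s3: "(\<lambda>k. sieved_coeff (insert p S) k * q_of \<tau> ^ k) sums (s \<tau> - s (of_nat p * \<tau>))" by simp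
    then show "summable (\<lambda>k. sieved_coeff (insert p S) k * q_of \<tau> ^ k)" by (simp add: sums_iff)
    define K where "K = (\<Prod>p\<in>S. 1 - real p) / 24"
    have "(\<Prod>r\<in>insert p S. 1 - real r) / 24 = K - real p * K"
      using insert.hyps by (simp add: K_def algebra_simps diff_divide_distrib)
    then have qK: "q_of (of_real ((\<Prod>r\<in>insert p S. 1 - real r) / 24) * \<tau>) = q_of (of_real K * \<tau> - of_real K * (of_nat p * \<tau>))"
      by (simp only:) (simp add: algebra_simps)
    have "q_of (of_real ((\<Prod>r\<in>insert p S. 1 - real r) / 24) * \<tau>) * exp (- (\<Sum>k. sieved_coeff (insert p S) k * q_of \<tau> ^ k))
      = (q_of (of_real K * \<tau>) * exp (- s \<tau>)) / (q_of (of_real K * (of_nat p * \<tau>)) * exp (- s (of_nat p * \<tau>)))"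
    proof -
      have sum: "(\<Sum>k. sieved_coeff (insert p S) k * q_of \<tau> ^ k) = s \<tau> - s (of_nat p * \<tau>)" using s3 by (simp add: sums_iff)
      have "exp (- (x - y)) = exp (- x) / exp (- y)" for x y :: complex by (simp add: exp_diff[symmetric])
      from this[of "s \<tau>" "s (of_nat p * \<tau>)"] show ?thesis
        unfolding sum qK q_of_diff by (simp only: times_divide_times_eq)
    qed
    also have "\<dots> = (\<Prod>t | t dvd D. dedekind_eta (of_nat t * \<tau>) powi a t) / (\<Prod>t | t dvd D. dedekind_eta (of_nat t * (of_nat p * \<tau>)) powi a t)"
      unfolding a(2)[OF \<tau>, symmetric] a(2)[OF p\<tau>, symmetric] K_def s_def ..
    also have "\<dots> = (\<Prod>t | t dvd D. dedekind_eta (of_nat t * \<tau>) powi a' t) * (\<Prod>t\<in>(\<lambda>t. p * t) ` {t. t dvd D}. dedekind_eta (of_nat t * \<tau>) powi a' t)"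
    proof -
      have "(\<Prod>t | t dvd D. dedekind_eta (of_nat t * \<tau>) powi a' t) = (\<Prod>t | t dvd D. dedekind_eta (of_nat t * \<tau>) powi a t)"
        using \<open>\<not> p dvd D\<close> by (intro prod.cong refl) (auto simp: a'_def dest: dvd_trans)
      moreover have "(\<Prod>t\<in>(\<lambda>t. p * t) ` {t. t dvd D}. dedekind_eta (of_nat t * \<tau>) powi a' t) = (\<Prod>t | t dvd D. inverse (dedekind_eta (of_nat t * (of_nat p * \<tau>)) powi a t))"
        using p0 by (subst prod.reindex) (auto simp: inj_on_def a'_def power_int_minus mult_ac)
      ultimately show ?thesis by (simp add: prod_inversef[symmetric] divide_inverse o_def)
    qed
    also have "\<dots> = (\<Prod>t | t dvd p * D. dedekind_eta (of_nat t * \<tau>) powi a' t)"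
      unfolding div(1) by (rule prod.union_disjoint[symmetric]) (use D0 div(2) in auto)
    also have "p * D = \<Prod>(insert p S)" using insert.hyps by (simp add: D_def)
    finally show "q_of (of_real ((\<Prod>r\<in>insert p S. 1 - real r) / 24) * \<tau>) * exp (- (\<Sum>k. sieved_coeff (insert p S) k * q_of \<tau> ^ k))
      = (\<Prod>t | t dvd \<Prod>(insert p S). dedekind_eta (of_nat t * \<tau>) powi a' t)" .
  qed
qed

context real_primitive_character begin

lemma eta_quotient_eta:
  assumes "u = 1"
  shows "eta_quotient eta"
proof -
  have psi: "\<psi> b = 1" for b using psi_add_mult[of 1 "b - 1"] by (simp add: assms)
  have coeff: "eta_coeff u (\<lambda>n a. of_int (weight (int n) (int a))) k = sieved_coeff (prime_factors P) k" if "k > 0" for k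
  proof -
    have "eta_coeff u (\<lambda>n a. of_int (weight (int n) (int a))) k = (\<Sum>n | n dvd k. if coprime (int n) (int P) then 1 / of_nat (k div n) else 0)"
      unfolding eta_coeff_def weight_def chi_def psi using assms
      by (intro sum.cong refl) (auto simp: zeta_root_def)
    also have "\<dots> = sieved_coeff (prime_factors P) k"
      unfolding sieved_coeff_def using that
      by (intro sum.mono_neutral_cong_right) (auto simp: coprime_int_iff_prime_factors[OF P_pos])
    finally show ?thesis .
  qed
  have coeff0: "eta_coeff u e 0 = 0" for e by (simp add: eta_coeff_def)
  have s0: "sieved_coeff (prime_factors P) 0 = 0" by (simp add: sieved_coeff_def)
  have coeffs: "eta_coeff u (\<lambda>n a. of_int (weight (int n) (int a))) = sieved_coeff (prime_factors P)"
  proof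
    fix k
    show "eta_coeff u (\<lambda>n a. of_int (weight (int n) (int a))) k = sieved_coeff (prime_factors P) k"
      using coeff[of k] coeff0 s0 by (cases "k = 0") simp_all
  qed
  obtain a :: "nat \<Rightarrow> int" where a: "\<And>\<tau>. Im \<tau> > 0 \<Longrightarrow>
     q_of (of_real ((\<Prod>p\<in>prime_factors P. 1 - real p) / 24) * \<tau>) * exp (- (\<Sum>k. sieved_coeff (prime_factors P) k * q_of \<tau> ^ k))
     = (\<Prod>t | t dvd \<Prod>(prime_factors P). dedekind_eta (of_nat t * \<tau>) powi a t)"
    using sieved_product_eta_quotient[of "prime_factors P"] by (auto simp: in_prime_factors_iff)
  have "eta \<tau> = 1 * (\<Prod>t | t dvd P. dedekind_eta (of_nat t * \<tau>) powr of_int (a t))" if \<tau>: "Im \<tau> > 0" for \<tau>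
  proof -
    have "eta \<tau> = (\<Prod>t | t dvd P. dedekind_eta (of_nat t * \<tau>) powi a t)"
      unfolding eta_exp[OF \<tau>] coeffs kappa_def
      using a[OF \<tau>] assms squarefree_prod_prime_factors[OF squarefree_P] by simp
    also have "\<dots> = (\<Prod>t | t dvd P. dedekind_eta (of_nat t * \<tau>) powr of_int (a t))"
    proof (rule prod.cong[OF refl])
      fix t assume "t \<in> {t. t dvd P}"
      then have "t > 0" using P_pos by (auto intro: Nat.gr0I)
      then have "dedekind_eta (of_nat t * \<tau>) \<noteq> 0" using \<tau> by (intro dedekind_eta_nonzero) simp
      then show "dedekind_eta (of_nat t * \<tau>) powi a t = dedekind_eta (of_nat t * \<tau>) powr of_int (a t)"
        by (simp add: complex_powr_of_int)
    qed
    finally show ?thesis by simp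
  qed
  then show ?thesis unfolding eta_quotient_def upper_half_plane_iff[symmetric]
    using P_pos by (intro exI[of _ P] exI[of _ 1] exI[of _ "\<lambda>t. of_int (a t)"]) (auto simp: upper_half_plane_iff)
qed

end

section \<open>Conductors and primitive characters\<close>

lemma prod_primes_properties:
  fixes S :: "nat set"
  assumes "finite S" "\<And>p. p \<in> S \<Longrightarrow> prime p"
  shows "squarefree (\<Prod>S)" "prime_factors (\<Prod>S) = S" "\<Prod>S > 0"
proof -
  show pos: "\<Prod>S > 0" using assms prime_gt_0_nat by (intro prod_pos) auto
  show pf: "prime_factors (\<Prod>S) = S"
  proof (intro equalityI subsetI)
    fix p assume "p \<in> prime_factors (\<Prod>S)"
    then have p: "prime p" "p dvd \<Prod>S" by (auto simp: in_prime_factors_iff)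
    then obtain q where "q \<in> S" "p dvd q" using prime_dvd_prod_iff[OF assms(1) p(1)] by auto
    then show "p \<in> S" using primes_dvd_imp_eq[OF p(1) assms(2)] by blast
  next
    fix p assume p: "p \<in> S"
    then have "p dvd \<Prod>S" using assms(1) by (intro dvd_prodI) auto
    then show "p \<in> prime_factors (\<Prod>S)" using assms(2)[OF p] pos by (simp add: in_prime_factors_iff)
  qed
  show "squarefree (\<Prod>S)"
    using assms
  proof (induction S rule: finite_induct)
    case (insert p S)
    have "coprime p (\<Prod>S)"
    proof (rule prod_coprime_right)
      fix q assume "q \<in> S"
      then show "coprime p q" using insert by (intro primes_coprime) auto
    qed
    then show ?case using insert by (simp add: squarefree_mult_coprime squarefree_prime)
  qed simp
qed

lemma real_character_Re:
  assumes "z \<in> {-1, 0, 1::complex}"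
  shows "of_int \<lfloor>Re z\<rfloor> = z" "\<lfloor>Re z\<rfloor> \<in> {-1, 0, 1}"
proof -
  have "\<lfloor>-1 :: real\<rfloor> = -1" by (rule floor_unique) auto
  then show "of_int \<lfloor>Re z\<rfloor> = z" "\<lfloor>Re z\<rfloor> \<in> {-1, 0, 1}" using assms by auto
qed

locale real_dirichlet_character =
  fixes N :: nat and c :: "int \<Rightarrow> complex"
  assumes N_gt_1: "N > 1" and dirichlet: "dirichlet_character N c" and real: "real_character c"
begin

abbreviation "u \<equiv> conductor N c"
abbreviation "P \<equiv> tame_part N c"

lemma c_mult: "c (a * b) = c a * c b" and c_per: "c (a + int N) = c a" and c_0_iff: "c a = 0 \<longleftrightarrow> \<not> coprime a (int N)"
  and c_1: "c 1 = 1" and c_vals: "c a \<in> {-1, 0, 1}"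
  using dirichlet real by (auto simp: dirichlet_character_def real_character_def)

lemma c_cong: "[a = b] (mod int N) \<Longrightarrow> c a = c b"
  by (rule periodic_cong[of c "int N"]) (simp_all add: c_per)

lemma induced_N: "induced_modulus N c N"
  unfolding induced_modulus_def using c_cong c_1 by fastforce

lemma induced_u: "induced_modulus N c u"
  unfolding conductor_def by (rule LeastI[where P = "induced_modulus N c", OF induced_N])

lemma u_dvd_N: "u dvd N"
  using induced_u by (simp add: induced_modulus_def)

lemma u_pos: "u > 0"
  using u_dvd_N N_gt_1 by (auto intro: Nat.gr0I)

lemma not_induced:
  assumes "d dvd u" "d < u"
  obtains t where "coprime t (int N)" "[t = 1] (mod int d)" "c t \<noteq> 1"
proof -
  have "\<not> induced_modulus N c d"
    using assms(2) unfolding conductor_def by (rule not_less_Least)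
  moreover have "d dvd N" using assms(1) u_dvd_N by (rule dvd_trans)
  ultimately show ?thesis using that unfolding induced_modulus_def by blast
qed

lemma coprime_N_u: "coprime a (int N) \<Longrightarrow> coprime a (int u)"
  using u_dvd_N by (meson coprime_divisors dvd_refl int_dvd_int_iff)

text \<open>Multiplying by an inverse of b modulo N reduces to the case b = 1, which is the
  definition of an induced modulus.\<close>

lemma c_cong_u:
  assumes "coprime a (int N)" "coprime b (int N)" "[a = b] (mod int u)"
  shows "c a = c b"
proof -
  obtain b' where b': "[b * b' = 1] (mod int N)" using assms(2) cong_solve_coprime_int by blast
  have cb': "coprime b' (int N)"
    using b' cong_imp_coprime[of 1 "b * b'" "int N"] by (auto simp: cong_sym)
  have "[b * b' = 1] (mod int u)" using b' u_dvd_N by (meson cong_dvd_modulus int_dvd_int_iff)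
  then have "[a * b' = 1] (mod int u)" using cong_trans[OF cong_scalar_right[OF assms(3)]] by blast
  then have "c (a * b') = 1" using induced_u assms(1) cb' unfolding induced_modulus_def by simp
  moreover have "c (b * b') = 1" using c_cong[OF b'] c_1 by simp
  moreover have "c b' \<noteq> 0" using cb' c_0_iff by simp
  ultimately show ?thesis by (simp add: c_mult) (metis mult_right_cancel)
qed

lemma lift_coprime:
  assumes "coprime a (int u)"
  obtains b where "coprime b (int N)" "[b = a] (mod int u)"
proof -
  obtain j where "coprime (a + int j * int u) (int N)"
    using coprime_shift[OF assms, of N] N_gt_1 by auto
  then show ?thesis using that[of "a + int j * int u"] by (simp add: cong_def)
qed

text \<open>Existence: the value at a unit modulo u is that of the given character at any lift prime
  to N, and the choice of lift does not matter. Uniqueness, required by the definite description,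
  holds because such lifts exist for all units.\<close>

lemma primitive_character_properties:
  "dirichlet_character u (primitive_character N c)"
  "coprime a (int N) \<Longrightarrow> primitive_character N c a = c a"
proof -
  define lft where "lft a = (SOME b. coprime b (int N) \<and> [b = a] (mod int u))" for a
  have lft: "coprime (lft a) (int N)" "[lft a = a] (mod int u)" if "coprime a (int u)" for a
    using lift_coprime[OF that] someI_ex[of "\<lambda>b. coprime b (int N) \<and> [b = a] (mod int u)"]
    unfolding lft_def by blast+
  define \<psi> where "\<psi> a = (if coprime a (int u) then c (lft a) else 0)" for a
  have psi: "\<psi> a = c b" if "coprime b (int N)" "[b = a] (mod int u)" for a b
  proof -
    have "coprime a (int u)" using coprime_N_u[OF that(1)] that(2) cong_imp_coprime by blast
    then show ?thesis using c_cong_u[OF lft(1) that(1)] lft(2) cong_trans cong_sym that(2)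
      unfolding \<psi>_def by metis
  qed
  have D: "dirichlet_character u \<psi>"
    unfolding dirichlet_character_def
  proof (intro conjI allI)
    show "u > 0" by (rule u_pos)
    show "\<psi> 1 = 1" using psi[of 1 1] c_1 by simp
    fix a
    have cop: "coprime (a + int u) (int u) \<longleftrightarrow> coprime a (int u)" by (simp add: coprime_iff_gcd_eq_1)
    show "\<psi> (a + int u) = \<psi> a"
    proof (cases "coprime a (int u)")
      case True
      have "[lft a = a + int u] (mod int u)" using lft(2)[OF True] by (simp add: cong_def)
      then show ?thesis using psi[OF lft(1)[OF True]] True unfolding \<psi>_def[of a] by simp
    next
      case False then show ?thesis using cop by (simp add: \<psi>_def)
    qed
    show "\<psi> a = 0 \<longleftrightarrow> \<not> coprime a (int u)"
      using lft(1) c_0_iff by (auto simp: \<psi>_def)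
    fix b
    show "\<psi> (a * b) = \<psi> a * \<psi> b"
    proof (cases "coprime a (int u) \<and> coprime b (int u)")
      case True
      then have "\<psi> (a * b) = c (lft a * lft b)"
        by (intro psi) (auto intro: lft cong_mult)
      then show ?thesis using True by (simp add: \<psi>_def c_mult)
    qed (auto simp: \<psi>_def)
  qed
  have ag: "\<forall>a. coprime a (int N) \<longrightarrow> \<psi> a = c a" using psi by simp
  have uniq: "\<phi> = \<psi>" if "dirichlet_character u \<phi>" "\<forall>a. coprime a (int N) \<longrightarrow> \<phi> a = c a" for \<phi>
  proof
    fix a
    have per: "\<phi> (a + int u) = \<phi> a" and z: "\<phi> a = 0 \<longleftrightarrow> \<not> coprime a (int u)" for a
      using that(1) by (auto simp: dirichlet_character_def)
    show "\<phi> a = \<psi> a"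
    proof (cases "coprime a (int u)")
      case True
      then have "\<phi> a = \<phi> (lft a)" using periodic_cong[of \<phi> "int u", OF per] lft(2) by (metis cong_sym)
      then show ?thesis using that(2) lft(1)[OF True] True by (simp add: \<psi>_def)
    qed (simp add: z \<psi>_def)
  qed
  have "primitive_character N c = \<psi>"
    unfolding primitive_character_def
  proof (rule the_equality)
    show "dirichlet_character u \<psi> \<and> (\<forall>a. coprime a (int N) \<longrightarrow> \<psi> a = c a)" using D ag by (rule conjI)
    show "\<phi> = \<psi>" if "dirichlet_character u \<phi> \<and> (\<forall>a. coprime a (int N) \<longrightarrow> \<phi> a = c a)" for \<phi>
      using that by (intro uniq) (rule conjunct1, assumption, rule conjunct2)
  qed
  then show "dirichlet_character u (primitive_character N c)"
    "coprime a (int N) \<Longrightarrow> primitive_character N c a = c a"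
    using D ag by auto
qed

text \<open>Nothing is lost by the floor, since the values are -1, 0 or 1.\<close>

definition psi_int :: "int \<Rightarrow> int" where
  "psi_int a = \<lfloor>Re (primitive_character N c a)\<rfloor>"

lemma psi_int:
  "of_int (psi_int a) = primitive_character N c a" "psi_int a \<in> {-1, 0, 1}"
proof -
  note D = primitive_character_properties(1)[unfolded dirichlet_character_def]
  have "primitive_character N c a \<in> {-1, 0, 1}"
  proof (cases "coprime a (int u)")
    case True
    then obtain b where b: "coprime b (int N)" "[b = a] (mod int u)" by (rule lift_coprime)
    have "primitive_character N c a = primitive_character N c b"
      using periodic_cong[of "primitive_character N c" "int u" b a] D b(2) by simp
    then show ?thesis using primitive_character_properties(2)[OF b(1)] c_vals[of b] by simp
  next
    case False then show ?thesis using D by simp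
  qed
  then show "of_int (psi_int a) = primitive_character N c a" "psi_int a \<in> {-1, 0, 1}"
    unfolding psi_int_def by (rule real_character_Re)+
qed

lemma finite_tame_primes: "finite {p. prime p \<and> p dvd N \<and> \<not> p dvd u}"
proof (rule finite_subset)
  show "{p. prime p \<and> p dvd N \<and> \<not> p dvd u} \<subseteq> {p. p dvd N}" by blast
  show "finite {p. p dvd N}" using N_gt_1 by simp
qed

lemma tame_part_properties:
  "squarefree P" "prime_factors P = {p. prime p \<and> p dvd N \<and> \<not> p dvd u}" "P > 0"
  using prod_primes_properties[OF finite_tame_primes] by (auto simp: tame_part_def)

text \<open>N and uP have the same prime factors, so the same integers are prime to both.\<close>

lemma coprime_N_iff: "coprime a (int N) \<longleftrightarrow> coprime a (int u) \<and> coprime a (int P)"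
proof -
  have "(\<forall>p\<in>prime_factors N. \<not> int p dvd a) \<longleftrightarrow> (\<forall>p\<in>prime_factors u \<union> prime_factors P. \<not> int p dvd a)"
  proof -
    have "prime_factors N = prime_factors u \<union> prime_factors P"
      unfolding tame_part_properties(2)
    proof (rule equalityI; rule subsetI)
      fix p assume "p \<in> prime_factors N"
      then show "p \<in> prime_factors u \<union> {p. prime p \<and> p dvd N \<and> \<not> p dvd u}"
        using u_pos by (auto simp: in_prime_factors_iff)
    next
      fix p assume "p \<in> prime_factors u \<union> {p. prime p \<and> p dvd N \<and> \<not> p dvd u}"
      then have "prime p" "p dvd N" using dvd_trans[OF _ u_dvd_N, of p] by (auto simp: in_prime_factors_iff)
      then show "p \<in> prime_factors N" using N_gt_1 by (simp add: in_prime_factors_iff)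
    qed
    then show ?thesis by simp
  qed
  then show ?thesis
    using N_gt_1 u_pos tame_part_properties(3) by (simp add: coprime_int_iff_prime_factors ball_Un)
qed

lemma coprime_u_P: "coprime u P"
proof -
  have "coprime (int u) (int P)"
    unfolding coprime_int_iff_prime_factors[OF tame_part_properties(3)] tame_part_properties(2) by auto
  then show ?thesis by simp
qed

lemma uP_gt_1: "u * P > 1"
proof (cases "u = 1")
  case True
  obtain p where p: "prime p" "p dvd N" using prime_factor_nat[of N] N_gt_1 by auto
  then have "p \<in> prime_factors P" unfolding tame_part_properties(2) using True by auto
  then have "p dvd P" by auto
  then have "p \<le> P" using tame_part_properties(3) by (simp add: dvd_imp_le)
  then show ?thesis using True prime_gt_1_nat[OF p(1)] by simp
next
  case False
  then have "1 * 1 < u * P" using u_pos tame_part_properties(3)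
    by (intro mult_less_le_imp_less) auto
  then show ?thesis by simp
qed

lemma psi_int_mult: "psi_int (a * b) = psi_int a * psi_int b"
proof -
  have "(of_int (psi_int (a * b)) :: complex) = of_int (psi_int a * psi_int b)"
    using primitive_character_properties(1) by (simp add: psi_int(1) dirichlet_character_def)
  then show ?thesis by (simp only: of_int_eq_iff)
qed

sublocale prim: real_primitive_character u P psi_int
proof
  show "u > 0" by (rule u_pos)
  show "P > 0" by (rule tame_part_properties(3))
  show "squarefree P" by (rule tame_part_properties(1))
  show "coprime u P" by (rule coprime_u_P)
  show "u * P > 1" by (rule uP_gt_1)
  note D = primitive_character_properties(1)[unfolded dirichlet_character_def]
  show "psi_int (a * b) = psi_int a * psi_int b" for a b by (rule psi_int_mult)
  show "psi_int (a + int u) = psi_int a" for a using D by (simp add: psi_int_def)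
  show "psi_int a = 0 \<longleftrightarrow> \<not> coprime a (int u)" for a
  proof -
    have "psi_int a = 0 \<longleftrightarrow> primitive_character N c a = 0" unfolding psi_int(1)[symmetric] by (simp only: of_int_eq_0_iff)
    then show ?thesis using D by simp
  qed
  show "psi_int a \<in> {-1, 0, 1}" for a by (rule psi_int(2))
  fix d assume "d dvd u" "d < u"
  then obtain t where t: "coprime t (int N)" "[t = 1] (mod int d)" "c t \<noteq> 1" by (rule not_induced)
  then have "psi_int t \<noteq> 1" using psi_int(1)[of t] primitive_character_properties(2)[OF t(1)] by auto
  then show "\<exists>t. coprime t (int u) \<and> [t = 1] (mod int d) \<and> psi_int t \<noteq> 1"
    using t coprime_N_u by blast
qed

lemma c_eq: "c a = of_int (prim.chi a)"
proof (cases "coprime a (int N)")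
  case True
  then have "coprime a (int P)" by (simp only: coprime_N_iff)
  then have "prim.chi a = psi_int a" unfolding prim.chi_def by (rule if_P)
  then show ?thesis by (simp only: psi_int(1) primitive_character_properties(2)[OF True])
next
  case False
  then have "\<not> coprime a (int (u * P))" by (simp only: coprime_N_iff of_nat_mult coprime_mult_right_iff not_False_eq_True)
  then have "prim.chi a = 0" by (simp only: prim.chi_0_iff not_False_eq_True)
  moreover have "c a = 0" using False by (simp only: c_0_iff not_False_eq_True)
  ultimately show ?thesis by simp
qed

lemma generalized_eta_eq: "generalized_eta N c = prim.eta"
proof
  fix \<tau>
  have "(if u = 1 then q_of (\<tau> * (\<Prod>p | prime p \<and> p dvd N. 1 - of_nat p) / 24) else 1) = q_of (of_real prim.kappa * \<tau>)"
  proof (cases "u = 1")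
    case True
    have "prime_factors P = {p. prime p \<and> p dvd N}" unfolding tame_part_properties(2) True by auto
    then show ?thesis unfolding prim.kappa_def using True by (simp add: mult.commute)
  next
    case False then show ?thesis by (simp add: prim.kappa_def)
  qed
  moreover have "cnj (primitive_character N c (int a) * c (int (Suc n))) = of_int (prim.weight (int (Suc n)) (int a))" for a n
  proof -
    have "cnj (of_int i * of_int j) = of_int (j * i)" for i j :: int by (simp add: mult.commute)
    then show ?thesis by (simp only: psi_int(1)[symmetric] c_eq prim.weight_def)
  qed
  ultimately show "generalized_eta N c \<tau> = prim.eta \<tau>"
    unfolding generalized_eta_def prim.eta_def Let_def by (simp only:)
qed

lemma eta_level_eq: "eta_level N c = u ^ 2 * P"
  by (simp add: eta_level_def)

lemma principal_iff: "eta_quotient (generalized_eta N c) \<longleftrightarrow> principal_character N c"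
proof
  assume "eta_quotient (generalized_eta N c)"
  then have eq: "eta_quotient prim.eta" by (simp add: generalized_eta_eq)
  have "c a = 1" if "coprime a (int N)" for a
  proof -
    have "coprime a (int prim.M)" using that coprime_N_iff[of a] by (simp add: prim.M_def)
    from prim.psi_trivial_of_eta_quotient[OF eq this] show ?thesis
      using coprime_N_iff[of a] that by (simp add: c_eq prim.chi_def)
  qed
  then show "principal_character N c" unfolding principal_character_def using c_0_iff by auto
next
  assume "principal_character N c"
  \<comment> \<open>A principal character is induced from modulus 1, so its conductor is 1.\<close>
  then have "induced_modulus N c 1" by (auto simp: induced_modulus_def principal_character_def)
  then have "u \<le> 1" unfolding conductor_def by (rule Least_le)
  then have "u = 1" using u_pos by simp
  then show "eta_quotient (generalized_eta N c)" unfolding generalized_eta_eq by (rule prim.eta_quotient_eta)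
qed

end

text \<open>Parabolicity is claimed under integrality of the cusp orders, because a translation at a
  cusp acts by exp(2 \<pi> i) to the power order times width. The 24th power clears the denominator
  for every real character.\<close>

theorem theorem1:
  fixes N :: nat and chi :: "int \<Rightarrow> complex"
  assumes "N > 1" and "dirichlet_character N chi" and "real_character chi"
  shows "gmf (Gamma0 (eta_level N chi)) (generalized_eta N chi) \<and>
         cuspidal_divisor (generalized_eta N chi) \<and>
         (integral_cusp_orders N chi \<longrightarrow>
            parabolic_gmf (Gamma0 (eta_level N chi)) (generalized_eta N chi)) \<and>
         parabolic_gmf (Gamma0 (eta_level N chi)) (\<lambda>\<tau>. generalized_eta N chi \<tau> ^ 24) \<and>
         (eta_quotient (generalized_eta N chi) \<longleftrightarrow> principal_character N chi)"
proof -
  interpret real_dirichlet_character N chi by standard (fact assms)+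
  have "cuspidal_divisor prim.eta"
    unfolding cuspidal_divisor_def
  proof (intro ballI conjI)
    fix \<tau> assume \<tau>: "\<tau> \<in> upper_half_plane"
    show "prim.eta \<tau> \<noteq> 0" using \<tau> prim.eta_nonzero by (simp add: upper_half_plane_iff)
    have "isCont prim.eta \<tau>"
      using holomorphic_on_imp_continuous_on[OF prim.eta_holomorphic] \<tau>
      unfolding continuous_on_eq_continuous_at[OF open_upper_half_plane] by (rule bspec)
    then show "\<not> is_pole prim.eta \<tau>"
      unfolding isCont_def is_pole_def using not_tendsto_and_filterlim_at_infinity[of "at \<tau>"] by auto
  qed
  moreover have "parabolic_gmf (Gamma0 (u ^ 2 * P)) prim.eta" if "integral_cusp_orders N chi"
    using that prim.dvd_24_jordan_nat[of "totient P"]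
    by (intro prim.parabolic_gmf_eta) (simp add: integral_cusp_orders_def)
  ultimately show ?thesis
    using principal_iff prim.gmf_eta prim.parabolic_gmf_eta_24
    by (simp add: generalized_eta_eq eta_level_eq)
qed

end
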